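(* Fix $d\in\mathbb{N}$ and let $F_1,\dots,F_d$ be Rademacher functionals with $F_i\in\operatorname{dom}(D)$, $F_i\in\operatorname{dom}(D^2)$, $\mathbb{E}[F_i]=0$ and $\mathbb{E}\big[\|(pq)^{-1/4}DF_i\|_{\ell^4(\mathbb{N})}^4\big]<\infty$ for every $i=1,\dots,d$. Define $\mathbf{F}:=(F_1,\dots,F_d)$ and let $\mathbf{N}=(N_1,\dots,N_d)$ be a centred Gaussian random vector with symmetric and positive semidefinite covariance matrix $\Sigma=(\Sigma_{ij})_{i,j=1}^d$. For $i,j=1,\dots,d$ define \begin{align*} B_1(i,j) &:= \Big(\frac{15}{4}\sum_{k,\ell,m=1}^\infty(\mathbb{E}[(D_kF_i)^2(D_\ell F_i)^2])^{1/2}(\mathbb{E}[(D_mD_kF_j)^2(D_mD_\ell F_j)^2])^{1/2}\Big)^{1/2},\\ B_2(i,j) &:= \Big(\frac34\sum_{k,\ell,m=1}^\infty\frac{1}{p_mq_m}(\mathbb{E}[(D_mD_kF_i)^2(D_mD_\ell F_i)^2])^{1/2}(\mathbb{E}[(D_mD_kF_j)^2(D_mD_\ell F_j)^2])^{1/2}\Big)^{1/2},\\ B_3(i,j) &:= \frac12d^{3/2}\sum_{k=1}^\infty\frac{|p_k-q_k|}{\sqrt{p_kq_k}}(\mathbb{E}[(D_kF_i)^2])^{1/2}(\mathbb{E}[(D_kF_j)^4])^{1/2},\\ B_4(i,j) &:= \frac{5}{12}d^2\sum_{k=1}^\infty\frac{1}{p_kq_k}(\mathbb{E}[(D_kF_i)^4])^{1/4}(\mathbb{E}[(D_kF_j)^4])^{3/4}.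 \end{align*} Then $$d_4(\mathbf{F},\mathbf{N})\le\frac12\sum_{i,j=1}^d\big[|\Sigma_{ij}-\operatorname{cov}(F_i,F_j)|+B_1(i,j)+B_2(i,j)+B_3(i,j)+B_4(i,j)\big].$$
   Context: Rademacher setting. Let $p=(p_k)_{k\in\mathbb{N}}$ with $0<p_k<1$, $q=(q_k)_{k\in\mathbb{N}}$ with $q_k=1-p_k$. Let $\Omega=\{-1,+1\}^{\mathbb{N}}$ with the product $\sigma$-algebra and $P=\bigotimes_{k\ge1}(p_k\delta_{+1}+q_k\delta_{-1})$, and let $X=(X_k)_{k\in\mathbb{N}}$, $X_k(\omega)=\omega_k$ (a Rademacher sequence). A Rademacher functional is a real random variable $F=F(X)$ on this space. Put $Y_k=(2\sqrt{p_kq_k})^{-1}(X_k-p_k+q_k)$. Chaos decomposition. For $n\ge1$ let $\ell_0^2(\mathbb{N})^{\circ n}$ be the set of symmetric square-summable functions $f:\mathbb{N}^n\to\mathbb{R}$ vanishing whenever two arguments coincide, and put $J_n(f)=\sum_{(i_1,\dots,i_n)\in\mathbb{N}^n}f(i_1,\dots,i_n)Y_{i_1}\cdots Y_{i_n}$. Every $F\in L^2(\Omega)$ can be written uniquely as $F=\mathbb{E}[F]+\sum_{n\ge1}J_n(f_n)$ with $f_n\in\ell_0^2(\mathbb{N})^{\circ n}$. Discrete Malliavin derivatives. For $\omega\in\Omega$, $k\in\mathbb{N}$, let $\omega^k_\pm$ be $\omega$ with its $k$-th coordinate replaced by $\pm1$, and $F_k^\pm(\omega)=F(\omega_\pm^k)$.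 Put $DF=(D_kF)_{k\in\mathbb{N}}$, $D_kF=\sqrt{p_kq_k}\,(F_k^+-F_k^-)$; the second-order derivative is obtained by iteration, $D_mD_kF=D_m(D_kF)$. For $F\in L^2(\Omega)$ with chaos kernels $f_n$ and $r\in\mathbb{N}$, $F\in\operatorname{dom}(D^r)$ means $\sum_{n\ge r}\frac{n!}{(n-r)!}\,n!\,\|f_n\|^2_{\ell^2(\mathbb{N}^n)}<\infty$; $\operatorname{dom}(D)=\operatorname{dom}(D^1)$. The sequence $(pq)^{-1/4}DF$ is $((p_kq_k)^{-1/4}D_kF)_{k\in\mathbb{N}}$. Distance. For a function $g:\mathbb{R}^d\to\mathbb{R}$ put $M_k(g)=\max_{1\le i_1,\dots,i_k\le d}\big\|\frac{\partial^k g}{\partial x_{i_1}\cdots\partial x_{i_k}}\big\|_\infty$ (supremum norm). For $\mathbb{R}^d$-valued random vectors $\mathbf{X},\mathbf{Y}$, $d_4(\mathbf{X},\mathbf{Y})=\sup_g|\mathbb{E}[g(\mathbf{X})]-\mathbb{E}[g(\mathbf{Y})]|$, where the supremum runs over all four times partially differentiable $g:\mathbb{R}^d\to\mathbb{R}$ with bounded partial derivatives satisfying $M_1(g),M_2(g),M_3(g),M_4(g)\le1$. *)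

theory Defs
  imports "HOL-Probability.Probability"
begin

(* The positive integers indexing a Rademacher sequence are represented by type nat
   (starting at 0).  Expectations of nonnegative quantities, and series with nonnegative
   terms, are taken in ennreal, so that no convergence has to be presupposed. *)

abbreviation qprob :: "(nat \<Rightarrow> real) \<Rightarrow> nat \<Rightarrow> real" where
  "qprob p k \<equiv> 1 - p k"

(* The space of this measure is the set of all functions from nat to {-1, 1}; the k-th factor
   is p k * delta_(+1) + q k * delta_(-1). *)
definition rademacher_space :: "(nat \<Rightarrow> real) \<Rightarrow> (nat \<Rightarrow> real) measure" where
  "rademacher_space p =
     PiM UNIV (\<lambda>k. point_measure {-1, 1} (\<lambda>x. ennreal (if x = 1 then p k else qprob p k)))"

definition rad_Y :: "(nat \<Rightarrow> real) \<Rightarrow> nat \<Rightarrow> (nat \<Rightarrow> real) \<Rightarrow> real" where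
  "rad_Y p k \<omega> = (\<omega> k - p k + qprob p k) / (2 * sqrt (p k * qprob p k))"

definition malliavin_D ::
  "(nat \<Rightarrow> real) \<Rightarrow> nat \<Rightarrow> ((nat \<Rightarrow> real) \<Rightarrow> real) \<Rightarrow> (nat \<Rightarrow> real) \<Rightarrow> real" where
  "malliavin_D p k F \<omega> = sqrt (p k * qprob p k) * (F (fun_upd \<omega> k 1) - F (fun_upd \<omega> k (-1)))"

definition square_integrable :: "'a measure \<Rightarrow> ('a \<Rightarrow> real) \<Rightarrow> bool" where
  "square_integrable M F \<longleftrightarrow> F \<in> borel_measurable M \<and> integrable M (\<lambda>\<omega>. (F \<omega>)\<^sup>2)"

definition L2_tendsto ::
  "'a measure \<Rightarrow> ('b \<Rightarrow> 'a \<Rightarrow> real) \<Rightarrow> ('a \<Rightarrow> real) \<Rightarrow> 'b filter \<Rightarrow> bool" where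
  "L2_tendsto M G H \<F> \<longleftrightarrow>
     ((\<lambda>x. \<integral>\<^sup>+\<omega>. ennreal ((G x \<omega> - H \<omega>)\<^sup>2) \<partial>M) \<longlongrightarrow> 0) \<F>"

(* A function of n integer arguments is represented by a function on lists; only its values on
   lists of length n matter. *)
definition ell2_sym0 :: "nat \<Rightarrow> (nat list \<Rightarrow> real) set" where
  "ell2_sym0 n = {f.
     (\<forall>xs ys. length xs = n \<and> mset xs = mset ys \<longrightarrow> f xs = f ys) \<and>
     (\<forall>xs. length xs = n \<and> \<not> distinct xs \<longrightarrow> f xs = 0) \<and>
     (\<lambda>xs. (f xs)\<^sup>2) summable_on {xs. length xs = n}}"

(* G is (a version of) the discrete multiple stochastic integral J_n(f): the sum over all
   n-tuples is the unconditional sum in the square-mean sense. *)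
definition is_multiple_integral ::
  "(nat \<Rightarrow> real) \<Rightarrow> nat \<Rightarrow> (nat list \<Rightarrow> real) \<Rightarrow> ((nat \<Rightarrow> real) \<Rightarrow> real) \<Rightarrow> bool" where
  "is_multiple_integral p n f G \<longleftrightarrow>
     square_integrable (rademacher_space p) G \<and>
     L2_tendsto (rademacher_space p)
       (\<lambda>A \<omega>. \<Sum>xs\<in>A. f xs * prod_list (map (\<lambda>i. rad_Y p i \<omega>) xs)) G
       (finite_subsets_at_top {xs. length xs = n})"

definition is_chaos_kernels ::
  "(nat \<Rightarrow> real) \<Rightarrow> ((nat \<Rightarrow> real) \<Rightarrow> real) \<Rightarrow> (nat \<Rightarrow> nat list \<Rightarrow> real) \<Rightarrow> bool" where
  "is_chaos_kernels p F f \<longleftrightarrow>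
     (\<forall>n\<ge>1. f n \<in> ell2_sym0 n) \<and>
     (\<exists>G. (\<forall>n\<ge>1. is_multiple_integral p n (f n) (G n)) \<and>
       L2_tendsto (rademacher_space p)
         (\<lambda>K \<omega>. (\<integral>\<omega>'. F \<omega>' \<partial>rademacher_space p) + (\<Sum>n=1..K. G n \<omega>)) F sequentially)"

(* The kernels of order n >= 1 of a square-integrable F exist and are unique (on lists of
   length n), so the existential quantifier just names them.  Intended for r >= 1. *)
definition malliavin_dom :: "(nat \<Rightarrow> real) \<Rightarrow> nat \<Rightarrow> ((nat \<Rightarrow> real) \<Rightarrow> real) set" where
  "malliavin_dom p r = {F.
     square_integrable (rademacher_space p) F \<and>
     (\<exists>f. is_chaos_kernels p F f \<and>
       (\<lambda>n. fact n / fact (n - r) * fact n * (\<Sum>\<^sub>\<infinity>xs\<in>{xs. length xs = n}. (f n xs)\<^sup>2))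
         summable_on {r..})}"

definition ell4_norm_pow4 :: "(nat \<Rightarrow> real) \<Rightarrow> ennreal" where
  "ell4_norm_pow4 a = (\<Sum>k. ennreal (\<bar>a k\<bar> ^ 4))"

definition covariance :: "'a measure \<Rightarrow> ('a \<Rightarrow> real) \<Rightarrow> ('a \<Rightarrow> real) \<Rightarrow> real" where
  "covariance M X Y = (\<integral>\<omega>. (X \<omega> - (\<integral>\<omega>'. X \<omega>' \<partial>M)) * (Y \<omega> - (\<integral>\<omega>'. Y \<omega>' \<partial>M)) \<partial>M)"

(* Every linear functional is normally distributed; a normal law may be degenerate. *)
definition gaussian_random_vector :: "'a measure \<Rightarrow> ('a \<Rightarrow> real ^ 'd) \<Rightarrow> bool" where
  "gaussian_random_vector M N \<longleftrightarrow>
     N \<in> borel_measurable M \<and>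
     (\<forall>t. (\<exists>\<mu>. AE \<omega> in M. t \<bullet> N \<omega> = \<mu>) \<or>
          (\<exists>\<mu> \<sigma>. \<sigma> > 0 \<and>
             distributed M lborel (\<lambda>\<omega>. t \<bullet> N \<omega>) (\<lambda>x. ennreal (normal_density \<mu> \<sigma> x))))"

definition partially_differentiable :: "'d \<Rightarrow> (real ^ 'd \<Rightarrow> real) \<Rightarrow> bool" where
  "partially_differentiable i g \<longleftrightarrow>
     (\<forall>x. (\<lambda>t. g (x + t *\<^sub>R axis i 1)) differentiable (at (0::real)))"

definition partial_deriv :: "'d \<Rightarrow> (real ^ 'd \<Rightarrow> real) \<Rightarrow> real ^ 'd \<Rightarrow> real" where
  "partial_deriv i g x = deriv (\<lambda>t. g (x + t *\<^sub>R axis i 1)) 0"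

definition iter_partial :: "'d list \<Rightarrow> (real ^ 'd \<Rightarrow> real) \<Rightarrow> real ^ 'd \<Rightarrow> real" where
  "iter_partial is g = foldr partial_deriv is g"

definition deriv_bound :: "nat \<Rightarrow> (real ^ 'd \<Rightarrow> real) \<Rightarrow> ennreal" where
  "deriv_bound k g =
     Max ((\<lambda>is. SUP x. ennreal \<bar>iter_partial is g x\<bar>) ` {is. length is = k})"

definition d4_test_functions :: "(real ^ 'd \<Rightarrow> real) set" where
  "d4_test_functions = {g.
     (\<forall>is i. length is < 4 \<longrightarrow> partially_differentiable i (iter_partial is g)) \<and>
     (\<forall>is. 1 \<le> length is \<and> length is \<le> 4 \<longrightarrow> bounded (range (iter_partial is g))) \<and>
     deriv_bound 1 g \<le> 1 \<and> deriv_bound 2 g \<le> 1 \<and> deriv_bound 3 g \<le> 1 \<and> deriv_bound 4 g \<le> 1}"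

(* Test functions are Lipschitz, so the two expectations exist for integrable X and Y. *)
definition d4 ::
  "'a measure \<Rightarrow> ('a \<Rightarrow> real ^ 'd) \<Rightarrow> 'b measure \<Rightarrow> ('b \<Rightarrow> real ^ 'd) \<Rightarrow> ennreal" where
  "d4 M X M' Y =
     (SUP g\<in>d4_test_functions. ennreal \<bar>(\<integral>\<omega>. g (X \<omega>) \<partial>M) - (\<integral>\<omega>. g (Y \<omega>) \<partial>M')\<bar>)"

(* Powers with exponent a > 0 on the extended nonnegative reals. *)
definition epowr :: "ennreal \<Rightarrow> real \<Rightarrow> ennreal" where
  "epowr x a = (if x = \<infinity> then \<infinity> else ennreal (enn2real x powr a))"

definition eexp :: "(nat \<Rightarrow> real) \<Rightarrow> ((nat \<Rightarrow> real) \<Rightarrow> real) \<Rightarrow> ennreal" where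
  "eexp p G = (\<integral>\<^sup>+\<omega>. ennreal (G \<omega>) \<partial>rademacher_space p)"

definition bound_B1 ::
  "(nat \<Rightarrow> real) \<Rightarrow> ('d \<Rightarrow> (nat \<Rightarrow> real) \<Rightarrow> real) \<Rightarrow> 'd \<Rightarrow> 'd \<Rightarrow> ennreal" where
  "bound_B1 p F i j =
     epowr (15 / 4 * (\<Sum>k. \<Sum>l. \<Sum>m.
       epowr (eexp p (\<lambda>\<omega>. (malliavin_D p k (F i) \<omega>)\<^sup>2 * (malliavin_D p l (F i) \<omega>)\<^sup>2)) (1/2) *
       epowr (eexp p (\<lambda>\<omega>. (malliavin_D p m (malliavin_D p k (F j)) \<omega>)\<^sup>2 *
                           (malliavin_D p m (malliavin_D p l (F j)) \<omega>)\<^sup>2)) (1/2))) (1/2)"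

definition bound_B2 ::
  "(nat \<Rightarrow> real) \<Rightarrow> ('d \<Rightarrow> (nat \<Rightarrow> real) \<Rightarrow> real) \<Rightarrow> 'd \<Rightarrow> 'd \<Rightarrow> ennreal" where
  "bound_B2 p F i j =
     epowr (3 / 4 * (\<Sum>k. \<Sum>l. \<Sum>m.
       ennreal (1 / (p m * qprob p m)) *
       epowr (eexp p (\<lambda>\<omega>. (malliavin_D p m (malliavin_D p k (F i)) \<omega>)\<^sup>2 *
                           (malliavin_D p m (malliavin_D p l (F i)) \<omega>)\<^sup>2)) (1/2) *
       epowr (eexp p (\<lambda>\<omega>. (malliavin_D p m (malliavin_D p k (F j)) \<omega>)\<^sup>2 *
                           (malliavin_D p m (malliavin_D p l (F j)) \<omega>)\<^sup>2)) (1/2))) (1/2)"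

definition bound_B3 ::
  "(nat \<Rightarrow> real) \<Rightarrow> ('d::finite \<Rightarrow> (nat \<Rightarrow> real) \<Rightarrow> real) \<Rightarrow> 'd \<Rightarrow> 'd \<Rightarrow> ennreal" where
  "bound_B3 p F i j =
     ennreal (1 / 2 * real CARD('d) powr (3 / 2)) * (\<Sum>k.
       ennreal (\<bar>p k - qprob p k\<bar> / sqrt (p k * qprob p k)) *
       epowr (eexp p (\<lambda>\<omega>. (malliavin_D p k (F i) \<omega>)\<^sup>2)) (1/2) *
       epowr (eexp p (\<lambda>\<omega>. (malliavin_D p k (F j) \<omega>) ^ 4)) (1/2))"

definition bound_B4 ::
  "(nat \<Rightarrow> real) \<Rightarrow> ('d::finite \<Rightarrow> (nat \<Rightarrow> real) \<Rightarrow> real) \<Rightarrow> 'd \<Rightarrow> 'd \<Rightarrow> ennreal" where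
  "bound_B4 p F i j =
     ennreal (5 / 12 * real CARD('d) ^ 2) * (\<Sum>k.
       ennreal (1 / (p k * qprob p k)) *
       epowr (eexp p (\<lambda>\<omega>. (malliavin_D p k (F i) \<omega>) ^ 4)) (1/4) *
       epowr (eexp p (\<lambda>\<omega>. (malliavin_D p k (F j) \<omega>) ^ 4)) (3/4))"

end

theory Submission
  imports Defs
begin

text \<open>The argument avoids the chaos calculus and the operator \<open>L\<^sup>-\<^sup>1\<close>. Freeze all coordinates beyond
  the \<open>n\<close>-th and work on the remaining finite cube. Let \<open>P\<^sub>s\<close> keep each of the first \<open>n\<close> coordinates
  with probability \<open>s\<close> and resample it otherwise. Then \<open>D\<^sub>k P\<^sub>s = s P\<^sub>s D\<^sub>k\<close> and the derivative in \<open>s\<close> of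
  \<open>E[f P\<^sub>s F]\<close> is \<open>\<Sum>\<^sub>k E[D\<^sub>k f P\<^sub>s D\<^sub>k F]\<close>, which gives the covariance formula and the Poincare
  inequality. With the Gaussian smoothing \<open>U v x = E[g(x + sqrt v N)]\<close>, which solves the heat
  equation for \<open>\<Sigma>\<close>, the difference of the two expectations is the increment over \<open>[0, 1]\<close> of
  \<open>t \<mapsto> E[U (1 - t) (sqrt t F)]\<close>. Its derivative is controlled by the fluctuation of
  \<open>\<Sum>\<^sub>k D\<^sub>k F\<^sub>j P\<^sub>s D\<^sub>k F\<^sub>i\<close> and by a trapezoidal chain rule for \<open>D\<^sub>k\<close>. Integrating the resulting
  inequality over the frozen coordinates costs only Cauchy-Schwarz inequalities, and the errors
  caused by freezing vanish as \<open>n\<close> grows because the chaos decomposition makes the functionals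
  square-mean limits of cylinder functions.\<close>

section \<open>Resampling finitely many coordinates\<close>

text \<open>On a finite cube every mean is a finite weighted sum, so the Stein argument is algebra
  there and raises no question of integrability or of limits under the integral. The matrix \<Sigma>
  may be singular, so the Gaussian vector enters through sums of independent copies and not through
  a density. Fourth partials of a test function are bounded but possibly discontinuous; all
  expansions therefore rest on Lipschitz third partials. The number 5/12 is 1/6 from Taylor's
  formula plus 1/4 from the trapezoidal correction, and the square of d in the fourth bound comes
  from comparing a cube of a sum with the sum of cubes. The overall factor 1/2 stems from the
  derivative 1 / (2 sqrt t) of \<open>sqrt t\<close>: with the argument scaled by
  \<open>c = sqrt t\<close> the defect in Stein's identity is of order c, which cancels the
  singularity at t = 0 and leaves a bound uniform in t, so that the mean value theorem replaces an
  integral over t.\<close>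

definition avg :: "(nat \<Rightarrow> real) \<Rightarrow> nat \<Rightarrow> ((nat \<Rightarrow> real) \<Rightarrow> real) \<Rightarrow> (nat \<Rightarrow> real) \<Rightarrow> real" where
  "avg p k F w = p k * F (fun_upd w k 1) + qprob p k * F (fun_upd w k (-1))"

definition resample ::
  "(nat \<Rightarrow> real) \<Rightarrow> real \<Rightarrow> nat \<Rightarrow> ((nat \<Rightarrow> real) \<Rightarrow> real) \<Rightarrow> (nat \<Rightarrow> real) \<Rightarrow> real" where
  "resample p s k F w = s * F w + (1 - s) * avg p k F w"

text \<open>For \<open>s = exp (- t)\<close> this is the Ornstein-Uhlenbeck semigroup at time \<open>t\<close>, acting on the first \<open>n\<close>
  coordinates only.\<close>

primrec mehler ::
  "(nat \<Rightarrow> real) \<Rightarrow> real \<Rightarrow> nat \<Rightarrow> ((nat \<Rightarrow> real) \<Rightarrow> real) \<Rightarrow> (nat \<Rightarrow> real) \<Rightarrow> real" where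
  "mehler p s 0 F = F"
| "mehler p s (Suc n) F = mehler p s n (resample p s n F)"

text \<open>At s = 0 each of the first \<open>n\<close> coordinates is resampled for certain. This
  is the conditional expectation given the remaining coordinates, as a finite sum that is defined at
  every \<open>w\<close> without reference to a measure.\<close>

abbreviation head_mean ::
  "(nat \<Rightarrow> real) \<Rightarrow> nat \<Rightarrow> ((nat \<Rightarrow> real) \<Rightarrow> real) \<Rightarrow> (nat \<Rightarrow> real) \<Rightarrow> real" where
  "head_mean p \<equiv> mehler p 0"

text \<open>The new value \<open>x\<close> is an arbitrary real and not only -1 or 1, because later
  arguments compare sequences that need not take these two values.\<close>

definition free_of :: "nat \<Rightarrow> ((nat \<Rightarrow> real) \<Rightarrow> 'a) \<Rightarrow> bool" where
  "free_of k F \<longleftrightarrow> (\<forall>w x. F (fun_upd w k x) = F w)"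

lemma avg_eq_resample: "avg p k = resample p 0 k"
  by (simp add: fun_eq_iff resample_def)

lemma free_ofD: "free_of k F \<Longrightarrow> F (fun_upd w k x) = F w"
  by (simp add: free_of_def)

lemma free_of_D: "free_of k (malliavin_D p k F)"
  by (simp add: free_of_def malliavin_D_def)

lemma free_of_avg: "free_of k (avg p k F)"
  by (simp add: free_of_def avg_def)

lemma avg_mult: "free_of k F \<Longrightarrow> avg p k (\<lambda>w. F w * G w) w = F w * avg p k G w"
  by (simp add: free_of_def avg_def algebra_simps)

lemma avg_free_of: "free_of k F \<Longrightarrow> avg p k F = F"
  by (simp add: free_of_def avg_def fun_eq_iff algebra_simps)

lemma resample_free_of: "free_of k F \<Longrightarrow> resample p s k F = F"
  by (simp add: resample_def avg_free_of fun_eq_iff algebra_simps)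

lemma free_of_resample: assumes "free_of k F" shows "free_of k (resample p s m F)"
proof (cases "m = k")
  case False
  have "F (fun_upd (fun_upd w k x) m y) = F (fun_upd w m y)" for w x y
    using assms False by (simp add: free_of_def fun_upd_twist[of k m])
  then show ?thesis using assms by (simp add: free_of_def resample_def avg_def)
next
  case True
  then show ?thesis using assms by (simp add: resample_free_of)
qed

lemma free_of_mehler: "free_of k F \<Longrightarrow> free_of k (mehler p s n F)"
  by (induction n arbitrary: F) (auto intro: free_of_resample)

lemma mehler_lin:
  "mehler p s n (\<lambda>w. a * F w + b * G w) w = a * mehler p s n F w + b * mehler p s n G w"
proof (induction n arbitrary: F G)
  case (Suc n)
  have "resample p s n (\<lambda>w. a * F w + b * G w)
      = (\<lambda>w. a * resample p s n F w + b * resample p s n G w)"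
    by (simp add: fun_eq_iff resample_def avg_def algebra_simps)
  then show ?case using Suc by simp
qed simp

lemma mehler_add: "mehler p s n (\<lambda>w. F w + G w) w = mehler p s n F w + mehler p s n G w"
  using mehler_lin[of p s n 1 F 1 G w] by simp

lemma mehler_diff: "mehler p s n (\<lambda>w. F w - G w) w = mehler p s n F w - mehler p s n G w"
  using mehler_lin[of p s n 1 F "-1" G w] by simp

lemma mehler_cmult: "mehler p s n (\<lambda>w. a * F w) w = a * mehler p s n F w"
  using mehler_lin[of p s n a F 0 F w] by simp

lemma mehler_const [simp]: "mehler p s n (\<lambda>w. c) w = c"
proof (induction n)
  case (Suc n)
  have "resample p s n (\<lambda>w. c) = (\<lambda>w. c)"
    by (simp add: fun_eq_iff resample_def avg_def algebra_simps)
  then show ?case using Suc by simp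
qed simp

lemma mehler_sum:
  "mehler p s n (\<lambda>w. \<Sum>i\<in>A. F i w) w = (\<Sum>i\<in>A. mehler p s n (F i) w)"
  by (induction A rule: infinite_finite_induct) (simp_all add: mehler_add)

lemma avg_comm: "avg p k (avg p m F) = avg p m (avg p k F)"
  by (cases "k = m") (auto simp: fun_eq_iff avg_def algebra_simps fun_upd_twist[of k m])

lemma avg_lin: "avg p k (\<lambda>w. a * F w + b * G w) w = a * avg p k F w + b * avg p k G w"
  by (simp add: avg_def algebra_simps)

lemma avg_resample: "avg p k (resample p s m F) = resample p s m (avg p k F)"
proof -
  have *: "resample p s m F = (\<lambda>w. s * F w + (1 - s) * avg p m F w)" for F
    by (simp add: fun_eq_iff resample_def)
  show ?thesis unfolding * by (simp add: fun_eq_iff avg_lin avg_comm[of p k m])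
qed

lemma avg_mehler: "avg p k (mehler p s n F) = mehler p s n (avg p k F)"
  by (induction n arbitrary: F) (simp_all add: avg_resample)

lemma D_resample:
  assumes "k \<noteq> m" shows "malliavin_D p k (resample p s m F) = resample p s m (malliavin_D p k F)"
proof
  fix w show "malliavin_D p k (resample p s m F) w = resample p s m (malliavin_D p k F) w"
    using assms fun_upd_twist[of k m w]
    by (simp add: resample_def malliavin_D_def avg_def algebra_simps)
qed

text \<open>The resampled part no longer depends on coordinate \<open>k\<close>, so
  \<open>D k\<close> annihilates it and only the weight of the kept part survives.\<close>

lemma D_resample_same:
  "malliavin_D p k (resample p s k F) = (\<lambda>w. s * malliavin_D p k F w)"
  by (simp add: fun_eq_iff resample_def malliavin_D_def avg_def algebra_simps)

lemma D_mehler_ge: "n \<le> k \<Longrightarrow> malliavin_D p k (mehler p s n F) = mehler p s n (malliavin_D p k F)"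
  by (induction n arbitrary: F) (simp_all add: D_resample)

text \<open>Exactly one factor of the product operator, that of coordinate \<open>k\<close>, yields
  \<open>s\<close>; \<open>D k\<close> commutes with all the others.\<close>

lemma D_mehler:
  "k < n \<Longrightarrow> malliavin_D p k (mehler p s n F) = (\<lambda>w. s * mehler p s n (malliavin_D p k F) w)"
proof (induction n arbitrary: F)
  case (Suc n)
  show ?case
  proof (cases "k = n")
    case True
    then show ?thesis
      by (simp add: D_mehler_ge D_resample_same mehler_cmult resample_free_of free_of_D fun_eq_iff)
  next
    case False
    then show ?thesis using Suc by (simp add: D_resample)
  qed
qed simp

text \<open>Coordinate \<open>k\<close> is averaged anyway: averages over different coordinates
  commute, and averaging one coordinate twice changes nothing.\<close>

lemma head_mean_avg: "k < n \<Longrightarrow> head_mean p n (avg p k F) = head_mean p n F"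
proof (induction n arbitrary: F)
  case (Suc n)
  show ?case
  proof (cases "k = n")
    case True
    then show ?thesis by (simp add: avg_free_of free_of_avg avg_eq_resample[symmetric])
  next
    case False
    then show ?thesis using Suc by (simp add: avg_resample[symmetric])
  qed
qed simp

text \<open>Invariance of the product law: each resampling step is an affine combination of two
  functions with the same head mean. Together with Jensen's inequality it makes the semigroup a
  contraction.\<close>

lemma head_mean_mehler:
  assumes "m \<le> n" shows "head_mean p n (mehler p s m F) w = head_mean p n F w"
  using assms
proof (induction m arbitrary: F)
  case (Suc m)
  have "head_mean p n (resample p s m F) w = s * head_mean p n F w + (1 - s) * head_mean p n F w"
    using Suc.prems by (simp add: resample_def[abs_def] mehler_lin head_mean_avg)
  then show ?case using Suc by (simp add: algebra_simps)
qed simp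

lemma head_mean_free: "k < n \<Longrightarrow> free_of k (head_mean p n F)"
proof (induction n arbitrary: F)
  case (Suc n) then show ?case
    by (cases "k = n") (auto intro: free_of_mehler simp: avg_eq_resample[symmetric] free_of_avg)
qed simp

text \<open>The covariance under a two-point law is the product of the two increments times p q. The
  factor \<open>sqrt (p k * qprob p k)\<close> in the derivative is the normalisation that absorbs
  this weight.\<close>

lemma avg_D:
  "avg p k (\<lambda>w. F w * G w) w - avg p k F w * avg p k G w = malliavin_D p k F w * malliavin_D p k G w"
  if "0 < p k" "p k < 1"
proof -
  have "sqrt (p k * qprob p k) * sqrt (p k * qprob p k) = p k * qprob p k" using that by simp
  then have "malliavin_D p k F w * malliavin_D p k G w
     = p k * qprob p k * (F (fun_upd w k 1) - F (fun_upd w k (-1))) * (G (fun_upd w k 1) - G (fun_upd w k (-1)))"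
    by (simp add: malliavin_D_def)
  then show ?thesis by (simp add: avg_def algebra_simps)
qed

text \<open>Averages over coordinate \<open>m\<close> stand where the usual product rule has values
  at \<open>w\<close>. Every term is then free of \<open>m\<close>, and the averages can be removed
  by Jensen's inequality. The last term measures the asymmetry of the coin.\<close>

lemma D_mult:
  assumes "0 < p m" "p m < 1"
  shows "malliavin_D p m (\<lambda>w. F w * G w) w
    = malliavin_D p m F w * avg p m G w + avg p m F w * malliavin_D p m G w
      + (qprob p m - p m) / sqrt (p m * qprob p m) * malliavin_D p m F w * malliavin_D p m G w"
proof -
  define r where "r = sqrt (p m * qprob p m)"
  have r: "r \<noteq> 0" using assms by (simp add: r_def)
  have c: "(qprob p m - p m) / r * (r * x) * (r * y) = (qprob p m - p m) * r * x * y" for x y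
    using r by simp
  show ?thesis
    unfolding malliavin_D_def r_def[symmetric] c by (simp add: avg_def algebra_simps)
qed

lemma mehler_1 [simp]: "mehler p 1 n F = F"
  by (induction n arbitrary: F) (simp_all add: resample_def[abs_def])

lemma mehler_mult_free:
  "(\<And>k. k < n \<Longrightarrow> free_of k G) \<Longrightarrow> mehler p s n (\<lambda>w. F w * G w) w = mehler p s n F w * G w"
proof (induction n arbitrary: F)
  case (Suc n)
  have "resample p s n (\<lambda>w. F w * G w) = (\<lambda>w. resample p s n F w * G w)"
    using Suc.prems[of n] by (simp add: fun_eq_iff resample_def avg_def free_of_def algebra_simps)
  then show ?case using Suc by simp
qed simp

section \<open>Positivity, Jensen and Cauchy-Schwarz inequalities for the resampling
  operators\<close>

locale rademacher =
  fixes p :: "nat \<Rightarrow> real"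
  assumes p_pos: "0 < p k" and p_less: "p k < 1"
begin

abbreviation "D \<equiv> malliavin_D p"
abbreviation "e \<equiv> head_mean p"

lemma q_pos: "0 < qprob p k" using p_less[of k] by simp
lemma pq_pos: "0 < p k * qprob p k" using p_pos q_pos by simp

lemma avg_mono: "(\<And>w. F w \<le> G w) \<Longrightarrow> avg p k F w \<le> avg p k G w"
  unfolding avg_def using p_pos[of k] q_pos[of k] by (intro add_mono mult_left_mono) auto

lemma resample_mono:
  "0 \<le> s \<Longrightarrow> s \<le> 1 \<Longrightarrow> (\<And>w. F w \<le> G w) \<Longrightarrow> resample p s k F w \<le> resample p s k G w"
  unfolding resample_def by (intro add_mono mult_left_mono avg_mono) auto

lemma mehler_mono:
  "0 \<le> s \<Longrightarrow> s \<le> 1 \<Longrightarrow> (\<And>w. F w \<le> G w) \<Longrightarrow> mehler p s n F w \<le> mehler p s n G w"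
proof (induction n arbitrary: F G)
  case (Suc n)
  show ?case unfolding mehler.simps by (rule Suc.IH) (use Suc.prems in \<open>auto intro: resample_mono\<close>)
qed simp

lemma mehler_nonneg: "0 \<le> s \<Longrightarrow> s \<le> 1 \<Longrightarrow> (\<And>w. 0 \<le> F w) \<Longrightarrow> 0 \<le> mehler p s n F w"
  using mehler_mono[of s "\<lambda>_. 0" F n w] by simp

lemma mehler_abs: "0 \<le> s \<Longrightarrow> s \<le> 1 \<Longrightarrow> \<bar>mehler p s n F w\<bar> \<le> mehler p s n (\<lambda>w. \<bar>F w\<bar>) w"
  using mehler_mono[of s F "\<lambda>w. \<bar>F w\<bar>" n w] mehler_mono[of s "\<lambda>w. - F w" "\<lambda>w. \<bar>F w\<bar>" n w]
    mehler_cmult[of p s n "-1" F w] by (simp add: abs_le_iff)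

text \<open>A variance is nonnegative: for fixed \<open>w\<close> the operator is positive, linear
  and preserves constants, that is, it is an expectation, and \<open>c\<close> is the mean of
  \<open>F\<close> under it.\<close>

lemma mehler_power2_le:
  assumes "0 \<le> s" "s \<le> 1" shows "(mehler p s n F w)\<^sup>2 \<le> mehler p s n (\<lambda>w. (F w)\<^sup>2) w"
proof -
  define c where "c = mehler p s n F w"
  have "0 \<le> mehler p s n (\<lambda>w. (F w - c)\<^sup>2) w" using assms by (intro mehler_nonneg) auto
  also have "(\<lambda>w. (F w - c)\<^sup>2) = (\<lambda>w. (1 * (F w)\<^sup>2 + (-2 * c) * F w) + c\<^sup>2)"
    by (simp add: power2_eq_square algebra_simps)
  also have "mehler p s n \<dots> w = mehler p s n (\<lambda>w. (F w)\<^sup>2) w - 2 * c * c + c\<^sup>2"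
    by (simp only: mehler_add mehler_cmult mehler_const) (simp add: c_def)
  finally show ?thesis by (simp add: c_def power2_eq_square)
qed

text \<open>The discriminant argument for the nonnegative quadratic form \<open>e n\<close> of
  \<open>(a F - b G)^2\<close>; only positivity and linearity of the head mean enter.\<close>

lemma e_CS: "(e n (\<lambda>w. F w * G w) w)\<^sup>2 \<le> e n (\<lambda>w. (F w)\<^sup>2) w * e n (\<lambda>w. (G w)\<^sup>2) w"
proof -
  define x y z where "x = e n (\<lambda>w. (G w)\<^sup>2) w" and "y = e n (\<lambda>w. F w * G w) w"
    and "z = e n (\<lambda>w. (F w)\<^sup>2) w"
  have q: "0 \<le> a\<^sup>2 * z - 2 * a * b * y + b\<^sup>2 * x" for a b
  proof -
    have "0 \<le> e n (\<lambda>w. (a * F w - b * G w)\<^sup>2) w" by (intro mehler_nonneg) auto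
    also have "(\<lambda>w. (a * F w - b * G w)\<^sup>2)
        = (\<lambda>w. (a\<^sup>2 * (F w)\<^sup>2 + (- 2 * a * b) * (F w * G w)) + b\<^sup>2 * (G w)\<^sup>2)"
      by (simp add: power2_eq_square algebra_simps)
    also have "e n \<dots> w = (a\<^sup>2 * z + (- 2 * a * b) * y) + b\<^sup>2 * x"
      by (simp only: mehler_add mehler_lin mehler_cmult) (simp add: x_def y_def z_def)
    finally show ?thesis by simp
  qed
  have x0: "0 \<le> x" "0 \<le> z" unfolding x_def z_def by (auto intro: mehler_nonneg)
  have "y\<^sup>2 \<le> z * x"
  proof (cases "x = 0")
    case True
    have "y = 0"
    proof (rule ccontr)
      assume "y \<noteq> 0"
      \<comment> \<open>For \<open>x = 0\<close> the form is linear in \<open>b\<close>, and this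
        choice of \<open>b\<close> would make it equal to -z - 2, which is negative.\<close>
      have "0 \<le> z - 2 * ((z + 1) / y) * y" using q[of 1 "(z + 1) / y"] True by simp
      then show False using \<open>y \<noteq> 0\<close> x0 by simp
    qed
    then show ?thesis using True by simp
  next
    case False
    \<comment> \<open>The minimising ratio of \<open>a\<close> and \<open>b\<close>, scaled so that
      no division by \<open>x\<close> occurs.\<close>
    have "0 \<le> x * (x * z - y\<^sup>2)" using q[of x y] by (simp add: power2_eq_square algebra_simps)
    then show ?thesis using x0 False by (simp add: zero_le_mult_iff mult.commute)
  qed
  then show ?thesis by (simp add: x_def y_def z_def)
qed

lemma e_CS_sqrt:
  "\<bar>e n (\<lambda>w. F w * G w) w\<bar> \<le> sqrt (e n (\<lambda>w. (F w)\<^sup>2) w) * sqrt (e n (\<lambda>w. (G w)\<^sup>2) w)"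
  using real_sqrt_le_mono[OF e_CS[of n F G w]] by (simp add: real_sqrt_mult)

lemma e_norm_triangle:
  "sqrt (e n (\<lambda>w. (F w + G w)\<^sup>2) w) \<le> sqrt (e n (\<lambda>w. (F w)\<^sup>2) w) + sqrt (e n (\<lambda>w. (G w)\<^sup>2) w)"
proof (rule real_le_lsqrt)
  have nn: "0 \<le> e n (\<lambda>w. (F w)\<^sup>2) w" "0 \<le> e n (\<lambda>w. (G w)\<^sup>2) w" by (auto intro: mehler_nonneg)
  then show "0 \<le> sqrt (e n (\<lambda>w. (F w)\<^sup>2) w) + sqrt (e n (\<lambda>w. (G w)\<^sup>2) w)" by simp
  have "(\<lambda>w. (F w + G w)\<^sup>2) = (\<lambda>w. ((F w)\<^sup>2 + 2 * (F w * G w)) + (G w)\<^sup>2)"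
    by (simp add: power2_eq_square algebra_simps)
  then have "e n (\<lambda>w. (F w + G w)\<^sup>2) w
    = (e n (\<lambda>w. (F w)\<^sup>2) w + 2 * e n (\<lambda>w. F w * G w) w) + e n (\<lambda>w. (G w)\<^sup>2) w"
    by (simp only: mehler_add mehler_cmult)
  also have "\<dots> \<le> (sqrt (e n (\<lambda>w. (F w)\<^sup>2) w) + sqrt (e n (\<lambda>w. (G w)\<^sup>2) w))\<^sup>2"
    using e_CS_sqrt[of n F G w] nn by (simp add: power2_sum)
  finally show "e n (\<lambda>w. (F w + G w)\<^sup>2) w
    \<le> (sqrt (e n (\<lambda>w. (F w)\<^sup>2) w) + sqrt (e n (\<lambda>w. (G w)\<^sup>2) w))\<^sup>2" .
qed

lemma avg_power2_le: "(avg p k F w)\<^sup>2 \<le> avg p k (\<lambda>w. (F w)\<^sup>2) w"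
proof -
  define x y where "x = F (fun_upd w k 1)" "y = F (fun_upd w k (-1))"
  have "avg p k (\<lambda>w. (F w)\<^sup>2) w - (avg p k F w)\<^sup>2 = p k * qprob p k * (x - y)\<^sup>2"
    unfolding avg_def x_y_def[symmetric] by (simp add: power2_eq_square algebra_simps)
  also have "\<dots> \<ge> 0" using pq_pos[of k] by simp
  finally show ?thesis by simp
qed

text \<open>The derivative of the interpolation of \<open>F\<close> between its mean and itself, one coordinate at a
  time; with the mean value theorem it yields both the covariance formula and the Poincare inequality.\<close>

lemma DERIV_mehler:
  assumes "n \<le> N"
  shows "((\<lambda>s. e N (\<lambda>w. f w * mehler p s n F w) w) has_real_derivative
    (\<Sum>k<n. e N (\<lambda>w. D k f w * mehler p s n (D k F) w) w)) (at s)"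
  using assms
\<comment> \<open>\<open>N\<close> stays fixed while \<open>n\<close> decreases, so the outer mean
  still averages over the coordinate that is split off.\<close>
proof (induction n arbitrary: F)
  case (Suc n)
  let ?A = "avg p n F"
  have r: "resample p s n F = (\<lambda>w. s * F w + (1 - s) * ?A w)" for s
    by (simp add: resample_def fun_eq_iff)
  have split: "e N (\<lambda>w. f w * mehler p s n (resample p s n F) w) w
      = s * e N (\<lambda>w. f w * mehler p s n F w) w + (1 - s) * e N (\<lambda>w. f w * mehler p s n ?A w) w" for s
  proof -
    have "(\<lambda>w. f w * mehler p s n (resample p s n F) w)
      = (\<lambda>w. s * (f w * mehler p s n F w) + (1 - s) * (f w * mehler p s n ?A w))"
      unfolding r mehler_lin by (simp add: algebra_simps)
    then show ?thesis by (simp only: mehler_lin)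
  qed
  let ?S = "\<lambda>G. \<Sum>k<n. e N (\<lambda>w. D k f w * mehler p s n (D k G) w) w"
  have d: "((\<lambda>s. s * e N (\<lambda>w. f w * mehler p s n F w) w + (1 - s) * e N (\<lambda>w. f w * mehler p s n ?A w) w)
    has_real_derivative (s * ?S F + (1 - s) * ?S ?A + (e N (\<lambda>w. f w * mehler p s n F w) w
       - e N (\<lambda>w. f w * mehler p s n ?A w) w))) (at s)"
    using Suc by (auto intro!: derivative_eq_intros)
  have "e N (\<lambda>w. D k f w * mehler p s n (D k (resample p s n F)) w) w
     = s * e N (\<lambda>w. D k f w * mehler p s n (D k F) w) w
     + (1 - s) * e N (\<lambda>w. D k f w * mehler p s n (D k ?A) w) w" for k
  proof -
    have "D k (resample p s n F) = (\<lambda>w. s * D k F w + (1 - s) * D k ?A w)"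
      by (simp add: r fun_eq_iff malliavin_D_def algebra_simps)
    then have "(\<lambda>w. D k f w * mehler p s n (D k (resample p s n F)) w)
      = (\<lambda>w. s * (D k f w * mehler p s n (D k F) w) + (1 - s) * (D k f w * mehler p s n (D k ?A) w))"
      by (simp only: mehler_lin) (simp add: algebra_simps)
    then show ?thesis by (simp only: mehler_lin)
  qed
  then have 1: "s * ?S F + (1 - s) * ?S ?A
      = (\<Sum>k<n. e N (\<lambda>w. D k f w * mehler p s n (D k (resample p s n F)) w) w)"
    by (simp add: sum.distrib sum_distrib_left)
  \<comment> \<open>Differentiating the explicit weight \<open>s\<close> of coordinate
    \<open>n\<close> leaves the difference between a function and its average over that coordinate.
    Averaged against \<open>f\<close>, it is the one-coordinate covariance of
    \<open>avg_D\<close>.\<close>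
  have 2: "e N (\<lambda>w. f w * mehler p s n F w) w - e N (\<lambda>w. f w * mehler p s n ?A w) w
     = e N (\<lambda>w. D n f w * mehler p s n (D n F) w) w"
  proof -
    let ?G = "mehler p s n F"
    have nN: "n < N" using Suc.prems by simp
    have "e N (\<lambda>w. f w * mehler p s n ?A w) w = e N (avg p n (\<lambda>w. avg p n ?G w * f w)) w"
      unfolding head_mean_avg[OF nN] by (simp add: avg_mehler[symmetric] mult.commute)
    also have "\<dots> = e N (\<lambda>w. avg p n ?G w * avg p n f w) w"
      by (simp add: avg_mult[OF free_of_avg, abs_def])
    finally have "e N (\<lambda>w. f w * ?G w) w - e N (\<lambda>w. f w * mehler p s n ?A w) w
      = e N (\<lambda>w. avg p n (\<lambda>w. f w * ?G w) w - avg p n f w * avg p n ?G w) w"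
      using nN by (simp add: mehler_diff head_mean_avg mult.commute)
    then show ?thesis by (simp add: avg_D p_pos p_less D_mehler_ge)
  qed
  show ?case using d unfolding split[symmetric] 1 2
    by (simp add: D_resample resample_free_of free_of_D)
qed simp

text \<open>The function \<open>h\<close> increases on the unit interval: its derivative is the sum
  of the gradient energies minus the same sum with one factor smoothed, which is nonnegative by
  Young's inequality and contractivity. At s = 0 the smoothed function is the mean, at s = 1 it is
  \<open>F\<close>.\<close>

lemma poincare:
  "e n (\<lambda>w. (F w)\<^sup>2) w - (e n F w)\<^sup>2 \<le> (\<Sum>k<n. e n (\<lambda>w. (D k F w)\<^sup>2) w)"
proof -
  let ?B = "\<Sum>k<n. e n (\<lambda>w. (D k F w)\<^sup>2) w"
  let ?h = "\<lambda>s. s * ?B - e n (\<lambda>w. F w * mehler p s n F w) w"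
  have "?h 0 \<le> ?h 1"
  proof (rule DERIV_nonneg_imp_nondecreasing[where f = ?h])
    fix s :: real assume s: "0 \<le> s" "s \<le> 1"
    have "e n (\<lambda>w. D k F w * mehler p s n (D k F) w) w \<le> e n (\<lambda>w. (D k F w)\<^sup>2) w" for k
    proof -
      have "e n (\<lambda>w. (mehler p s n (D k F) w)\<^sup>2) w \<le> e n (mehler p s n (\<lambda>w. (D k F w)\<^sup>2)) w"
        using s by (intro mehler_mono mehler_power2_le) auto
      then have 1: "e n (\<lambda>w. (mehler p s n (D k F) w)\<^sup>2) w \<le> e n (\<lambda>w. (D k F w)\<^sup>2) w"
        by (simp add: head_mean_mehler)
      have "e n (\<lambda>w. D k F w * mehler p s n (D k F) w) w
          \<le> e n (\<lambda>w. (1/2) * (D k F w)\<^sup>2 + (1/2) * (mehler p s n (D k F) w)\<^sup>2) w"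
      proof (intro mehler_mono)
        show "D k F w * mehler p s n (D k F) w \<le> (1/2) * (D k F w)\<^sup>2 + (1/2) * (mehler p s n (D k F) w)\<^sup>2" for w
          using sum_squares_bound[of "D k F w" "mehler p s n (D k F) w"] by simp
      qed auto
      also have "\<dots> \<le> e n (\<lambda>w. (D k F w)\<^sup>2) w" using 1 unfolding mehler_lin by simp
      finally show ?thesis .
    qed
    then have "(\<Sum>k<n. e n (\<lambda>w. D k F w * mehler p s n (D k F) w) w) \<le> ?B" by (intro sum_mono) auto
    moreover have "(?h has_real_derivative
        (?B - (\<Sum>k<n. e n (\<lambda>w. D k F w * mehler p s n (D k F) w) w))) (at s)"
      using DERIV_mehler[of n n F F w s] by (auto intro!: derivative_eq_intros)
    ultimately show "\<exists>y. (?h has_real_derivative y) (at s) \<and> 0 \<le> y" by force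
  qed simp
  moreover have "e n (\<lambda>w. F w * e n F w) w = (e n F w)\<^sup>2"
    using mehler_mult_free[of n "e n F" p 0 F w]
    by (simp add: head_mean_free power2_eq_square)
  ultimately show ?thesis by (simp add: power2_eq_square)
qed

end

section \<open>Comparison of derivatives and inequalities between power sums\<close>

text \<open>A majorant whose derivative dominates replaces an integral over the parameter, so
  neither continuity nor measurability of \<open>f'\<close> has to be known.\<close>

lemma DERIV_abs_le:
  fixes f f' B B' :: "real \<Rightarrow> real"
  assumes "\<And>t. 0 \<le> t \<Longrightarrow> t \<le> 1 \<Longrightarrow> (f has_real_derivative f' t) (at t)"
    and "\<And>t. 0 \<le> t \<Longrightarrow> t \<le> 1 \<Longrightarrow> (B has_real_derivative B' t) (at t)"
    and "\<And>t. 0 \<le> t \<Longrightarrow> t \<le> 1 \<Longrightarrow> \<bar>f' t\<bar> \<le> B' t"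
    and t: "0 \<le> t" "t \<le> 1"
  shows "\<bar>f t - f 0\<bar> \<le> B t - B 0"
proof -
  have "B 0 + f 0 \<le> B t + f t"
  proof (rule DERIV_nonneg_imp_nondecreasing[where f = "\<lambda>t. B t + f t"])
    fix s assume s: "0 \<le> s" "s \<le> t"
    then have "((\<lambda>t. B t + f t) has_real_derivative (B' s + f' s)) (at s)"
      using assms(1,2)[of s] t by (intro derivative_intros) auto
    then show "\<exists>y. ((\<lambda>t. B t + f t) has_real_derivative y) (at s) \<and> 0 \<le> y"
      using assms(3)[of s] s t by (intro exI[of _ "B' s + f' s"]) auto
  qed (use t in simp)
  moreover have "B 0 - f 0 \<le> B t - f t"
  proof (rule DERIV_nonneg_imp_nondecreasing[where f = "\<lambda>t. B t - f t"])
    fix s assume s: "0 \<le> s" "s \<le> t"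
    then have "((\<lambda>t. B t - f t) has_real_derivative (B' s - f' s)) (at s)"
      using assms(1,2)[of s] t by (intro derivative_intros) auto
    then show "\<exists>y. ((\<lambda>t. B t - f t) has_real_derivative y) (at s) \<and> 0 \<le> y"
      using assms(3)[of s] s t by (intro exI[of _ "B' s - f' s"]) auto
  qed (use t in simp)
  ultimately show ?thesis by (simp add: abs_le_iff)
qed

lemma affine_DERIV_bound:
  fixes f f' :: "real \<Rightarrow> real"
  assumes "\<And>s. 0 \<le> s \<Longrightarrow> s \<le> 1 \<Longrightarrow> (f has_real_derivative f' s) (at s)"
    and "\<And>s. 0 \<le> s \<Longrightarrow> s \<le> 1 \<Longrightarrow> \<bar>f' s\<bar> \<le> \<alpha> + s * \<beta>"
  shows "\<bar>f 1 - f 0\<bar> \<le> \<alpha> + \<beta> / 2"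
proof -
  have "((\<lambda>t. \<alpha> * t + \<beta> * t\<^sup>2 / 2) has_real_derivative (\<alpha> + t * \<beta>)) (at t)" for t
    by (auto intro!: derivative_eq_intros)
  from DERIV_abs_le[OF assms(1) this assms(2), of 1] show ?thesis by simp
qed

lemma sum_abs_power2_le:
  fixes x :: "'d::finite \<Rightarrow> real"
  shows "(\<Sum>j\<in>UNIV. \<bar>x j\<bar>)\<^sup>2 \<le> real CARD('d) * (\<Sum>j\<in>UNIV. (x j)\<^sup>2)"
  using Cauchy_Schwarz_ineq_sum[of "\<lambda>_. 1" "\<lambda>j. \<bar>x j\<bar>" UNIV] by simp

text \<open>Chebyshev's sum inequality for the equally ordered families of the numbers and of their
  squares, combined with the bound for the square of the sum.\<close>

lemma sum_abs_power3_le: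
  fixes x :: "'d::finite \<Rightarrow> real"
  shows "(\<Sum>j\<in>UNIV. \<bar>x j\<bar>) ^ 3 \<le> (real CARD('d))\<^sup>2 * (\<Sum>j\<in>UNIV. \<bar>x j\<bar> ^ 3)"
proof -
  define y where "y = (\<lambda>j. \<bar>x j\<bar>)"
  have y0: "0 \<le> y j" for j by (simp add: y_def)
  let ?S = "\<lambda>n. \<Sum>j\<in>UNIV. y j ^ n"
  have cheb: "0 \<le> 2 * (real CARD('d) * ?S 3 - ?S 1 * ?S 2)"
  proof -
    have "0 \<le> (y i - y j) * (y i ^ 2 - y j ^ 2)" for i j
    proof -
      have "(y i - y j) * (y i ^ 2 - y j ^ 2) = (y i - y j)\<^sup>2 * (y i + y j)"
        by (simp add: power2_eq_square algebra_simps)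
      then show ?thesis by (simp add: y0)
    qed
    then have "0 \<le> (\<Sum>i\<in>UNIV. \<Sum>j\<in>UNIV. (y i - y j) * (y i ^ 2 - y j ^ 2))"
      by (intro sum_nonneg) auto
    also have "\<dots> = (\<Sum>i\<in>UNIV. \<Sum>j\<in>UNIV. y i ^ 3 + y j ^ 3 - y i * y j ^ 2 - y j * y i ^ 2)"
      by (simp add: algebra_simps power2_eq_square power3_eq_cube)
    also have "\<dots> = 2 * (real CARD('d) * ?S 3 - ?S 1 * ?S 2)"
    proof -
      have "(\<Sum>i\<in>UNIV. \<Sum>j\<in>UNIV. y i * y j ^ 2) = ?S 1 * ?S 2" by (simp add: sum_product y_def)
      moreover have "(\<Sum>i\<in>UNIV. \<Sum>j\<in>UNIV. y j * y i ^ 2) = ?S 1 * ?S 2"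
        by (subst sum.swap) (simp add: sum_product y_def)
      ultimately show ?thesis by (simp add: sum.distrib sum_subtractf sum_distrib_left sum_negf y_def)
    qed
    finally show ?thesis .
  qed
  have "?S 1 ^ 3 = ?S 1 * (?S 1)\<^sup>2" by (simp add: power3_eq_cube power2_eq_square)
  also have "\<dots> \<le> ?S 1 * (real CARD('d) * ?S 2)"
    using sum_abs_power2_le[of x] y0 by (intro mult_left_mono sum_nonneg) (auto simp: y_def)
  also have "\<dots> = real CARD('d) * (?S 1 * ?S 2)" by simp
  also have "\<dots> \<le> real CARD('d) * (real CARD('d) * ?S 3)"
    using cheb by (intro mult_left_mono) auto
  finally show ?thesis by (simp add: power2_eq_square y_def)
qed

text \<open>Jensen's inequality has to be applied before the square is expanded: \<open>E[(P b\<^sub>k)\<^sup>2 (P b\<^sub>l)\<^sup>2]\<close> is in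
  general not bounded by \<open>E[b\<^sub>k\<^sup>2 b\<^sub>l\<^sup>2]\<close>.\<close>

lemma mehler_quadratic:
  assumes "rademacher p" "0 \<le> s" "s \<le> 1"
  shows "(\<Sum>k\<in>A. a k w * mehler p s n (b k) w)\<^sup>2
    \<le> (\<Sum>k\<in>A. \<Sum>l\<in>A. a k w * a l w * mehler p s n (\<lambda>w. b k w * b l w) w)"
proof -
  have "(\<Sum>k\<in>A. a k w * mehler p s n (b k) w) = mehler p s n (\<lambda>w'. \<Sum>k\<in>A. a k w * b k w') w"
    by (simp add: mehler_sum mehler_cmult)
  then have "(\<Sum>k\<in>A. a k w * mehler p s n (b k) w)\<^sup>2
      \<le> mehler p s n (\<lambda>w'. (\<Sum>k\<in>A. a k w * b k w')\<^sup>2) w"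
    using rademacher.mehler_power2_le[OF assms, of n "\<lambda>w'. \<Sum>k\<in>A. a k w * b k w'" w] by simp
  also have "(\<lambda>w'. (\<Sum>k\<in>A. a k w * b k w')\<^sup>2)
      = (\<lambda>w'. \<Sum>k\<in>A. \<Sum>l\<in>A. (a k w * a l w) * (b k w' * b l w'))"
    by (simp add: power2_eq_square sum_product algebra_simps)
  finally show ?thesis by (simp only: mehler_sum mehler_cmult)
qed

section \<open>Conditional forms of the bounds and the fluctuation of the gradient pairing\<close>

context rademacher
begin

text \<open>The truncated, conditional form of the first bound: head means for expectations, finite
  sums for series, numerical constant left out. \<open>b2\<close>, \<open>b3\<close> and
  \<open>b4\<close> are formed likewise, and \<open>bsum\<close> supplies the constants.\<close>

definition b1 where
  "b1 n F G w = sqrt (\<Sum>k<n. \<Sum>l<n. \<Sum>m<n.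
      sqrt (e n (\<lambda>w. (D k F w)\<^sup>2 * (D l F w)\<^sup>2) w) *
      sqrt (e n (\<lambda>w. (D m (D k G) w)\<^sup>2 * (D m (D l G) w)\<^sup>2) w))"

definition b2 where
  "b2 n F G w = sqrt (\<Sum>k<n. \<Sum>l<n. \<Sum>m<n. 1 / (p m * qprob p m) *
      sqrt (e n (\<lambda>w. (D m (D k F) w)\<^sup>2 * (D m (D l F) w)\<^sup>2) w) *
      sqrt (e n (\<lambda>w. (D m (D k G) w)\<^sup>2 * (D m (D l G) w)\<^sup>2) w))"

definition b3 where
  "b3 n F G w = (\<Sum>k<n. \<bar>p k - qprob p k\<bar> / sqrt (p k * qprob p k) *
      sqrt (e n (\<lambda>w. (D k F w)\<^sup>2) w) * sqrt (e n (\<lambda>w. (D k G w) ^ 4) w))"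

text \<open>The exponents 1/4 and 3/4 appear as nested square roots, the shape that two applications
  of Cauchy-Schwarz produce.\<close>

definition b4 where
  "b4 n F G w = (\<Sum>k<n. 1 / (p k * qprob p k) *
      (sqrt (sqrt (e n (\<lambda>w. (D k F w) ^ 4) w) * sqrt (e n (\<lambda>w. (D k G w) ^ 4) w)) *
      sqrt (e n (\<lambda>w. (D k G w) ^ 4) w)))"

lemma e_mono: "(\<And>w. F w \<le> G w) \<Longrightarrow> e n F w \<le> e n G w"
  by (rule mehler_mono) auto

lemma e_nonneg: "(\<And>w. 0 \<le> F w) \<Longrightarrow> 0 \<le> e n F w"
  by (rule mehler_nonneg) auto

lemma e_mehler_power2_le:
  assumes "0 \<le> s" "s \<le> 1"
  shows "e n (\<lambda>w. (mehler p s n F w)\<^sup>2) w \<le> e n (\<lambda>w. (F w)\<^sup>2) w"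
proof -
  have "e n (\<lambda>w. (mehler p s n F w)\<^sup>2) w \<le> e n (mehler p s n (\<lambda>w. (F w)\<^sup>2)) w"
    using assms by (intro e_mono mehler_power2_le)
  then show ?thesis by (simp add: head_mean_mehler)
qed

text \<open>A fourth power is the square of a square: Jensen's inequality handles the inner one,
  mean-square contractivity the outer one.\<close>

lemma e_mehler_power4_le:
  assumes "0 \<le> s" "s \<le> 1"
  shows "e n (\<lambda>w. (mehler p s n F w) ^ 4) w \<le> e n (\<lambda>w. (F w) ^ 4) w"
proof -
  have 4: "x ^ 4 = (x\<^sup>2)\<^sup>2" for x :: real by simp
  have "e n (\<lambda>w. (mehler p s n F w) ^ 4) w \<le> e n (\<lambda>w. (mehler p s n (\<lambda>w. (F w)\<^sup>2) w)\<^sup>2) w"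
    unfolding 4 using assms by (intro e_mono power_mono mehler_power2_le) auto
  also have "\<dots> \<le> e n (\<lambda>w. ((F w)\<^sup>2)\<^sup>2) w" using assms by (rule e_mehler_power2_le)
  finally show ?thesis by simp
qed

text \<open>Once the square is expanded after Jensen's inequality, the semigroup acts on the product
  \<open>b k * b l\<close>. Cauchy-Schwarz and contractivity then leave the mixed moments for the
  pair \<open>k\<close>, \<open>l\<close> that occur in the first two bounds.\<close>

lemma e_quadratic:
  assumes "0 \<le> s" "s \<le> 1"
  shows "e n (\<lambda>w. (\<Sum>k\<in>A. a k w * mehler p s n (b k) w)\<^sup>2) w
    \<le> (\<Sum>k\<in>A. \<Sum>l\<in>A. sqrt (e n (\<lambda>w. (a k w)\<^sup>2 * (a l w)\<^sup>2) w) *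
                       sqrt (e n (\<lambda>w. (b k w)\<^sup>2 * (b l w)\<^sup>2) w))"
proof -
  have "e n (\<lambda>w. (\<Sum>k\<in>A. a k w * mehler p s n (b k) w)\<^sup>2) w
     \<le> e n (\<lambda>w. \<Sum>k\<in>A. \<Sum>l\<in>A. a k w * a l w * mehler p s n (\<lambda>w. b k w * b l w) w) w"
    by (intro e_mono mehler_quadratic) (use assms rademacher_axioms in auto)
  also have "\<dots> = (\<Sum>k\<in>A. \<Sum>l\<in>A. e n (\<lambda>w. a k w * a l w * mehler p s n (\<lambda>w. b k w * b l w) w) w)"
    by (simp add: mehler_sum)
  also have "\<dots> \<le> (\<Sum>k\<in>A. \<Sum>l\<in>A. sqrt (e n (\<lambda>w. (a k w)\<^sup>2 * (a l w)\<^sup>2) w) *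
                       sqrt (e n (\<lambda>w. (b k w)\<^sup>2 * (b l w)\<^sup>2) w))"
  proof (intro sum_mono)
    fix k l
    have "e n (\<lambda>w. a k w * a l w * mehler p s n (\<lambda>w. b k w * b l w) w) w
      \<le> sqrt (e n (\<lambda>w. (a k w * a l w)\<^sup>2) w) *
        sqrt (e n (\<lambda>w. (mehler p s n (\<lambda>w. b k w * b l w) w)\<^sup>2) w)"
      by (rule order_trans[OF abs_ge_self e_CS_sqrt])
    also have "\<dots> \<le> sqrt (e n (\<lambda>w. (a k w * a l w)\<^sup>2) w) *
        sqrt (e n (\<lambda>w. (b k w * b l w)\<^sup>2) w)"
      using assms by (intro mult_left_mono real_sqrt_le_mono e_mehler_power2_le)
        (auto intro!: e_nonneg)
    finally show "e n (\<lambda>w. a k w * a l w * mehler p s n (\<lambda>w. b k w * b l w) w) w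
      \<le> sqrt (e n (\<lambda>w. (a k w)\<^sup>2 * (a l w)\<^sup>2) w) * sqrt (e n (\<lambda>w. (b k w)\<^sup>2 * (b l w)\<^sup>2) w)"
      by (simp add: power_mult_distrib)
  qed
  finally show ?thesis .
qed

lemma e_norm_cmult: "sqrt (e n (\<lambda>w. (c * F w)\<^sup>2) w) = \<bar>c\<bar> * sqrt (e n (\<lambda>w. (F w)\<^sup>2) w)"
  by (simp add: power_mult_distrib mehler_cmult real_sqrt_mult)

lemma e_norm_avg:
  assumes "m < n" shows "sqrt (e n (\<lambda>w. (avg p m F w)\<^sup>2) w) \<le> sqrt (e n (\<lambda>w. (F w)\<^sup>2) w)"
proof -
  have "e n (\<lambda>w. (avg p m F w)\<^sup>2) w \<le> e n (avg p m (\<lambda>w. (F w)\<^sup>2)) w"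
    by (intro e_mono avg_power2_le)
  then show ?thesis using assms by (simp add: head_mean_avg)
qed

text \<open>The integrand in the derivative of \<open>e n (G * P_s F)\<close> with respect to s.
  Integrated over s from 0 to 1 it would give the usual pairing of DG with the negative of D applied
  to the pseudo-inverse of L at F.\<close>

definition Gam where
  "Gam n s F G w = (\<Sum>k<n. D k G w * mehler p s n (D k F) w)"

lemma avg_sum: "avg p m (\<lambda>w. \<Sum>i\<in>A. F i w) w = (\<Sum>i\<in>A. avg p m (F i) w)"
  by (simp add: avg_def sum.distrib sum_distrib_left)

lemma D_sum: "D m (\<lambda>w. \<Sum>i\<in>A. F i w) w = (\<Sum>i\<in>A. D m (F i) w)"
  by (simp add: malliavin_D_def sum_subtractf sum_distrib_left right_diff_distrib)

text \<open>In the product rule one factor of each mixed term is free of \<open>m\<close>, so the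
  average over coordinate \<open>m\<close> can be pulled outside the whole sum over
  \<open>k\<close>, where it only contracts. The weight \<open>s\<close> comes from exchanging
  \<open>D m\<close> with the semigroup.\<close>

lemma D_Gam:
  fixes s :: real and F G :: "(nat \<Rightarrow> real) \<Rightarrow> real"
  assumes m: "m < n"
  defines "U \<equiv> \<lambda>w. \<Sum>k<n. D m (D k G) w * mehler p s n (D k F) w"
    and "V \<equiv> \<lambda>w. \<Sum>k<n. D k G w * mehler p s n (D m (D k F)) w"
    and "W \<equiv> \<lambda>w. \<Sum>k<n. D m (D k G) w * mehler p s n (D m (D k F)) w"
  shows "D m (Gam n s F G) w = avg p m U w + s * avg p m V w
     + s * ((qprob p m - p m) / sqrt (p m * qprob p m)) * W w"
proof -
  let ?c = "(qprob p m - p m) / sqrt (p m * qprob p m)"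
  have "D m (\<lambda>w. D k G w * mehler p s n (D k F) w) w
     = avg p m (\<lambda>w. D m (D k G) w * mehler p s n (D k F) w) w
       + s * avg p m (\<lambda>w. D k G w * mehler p s n (D m (D k F)) w) w
       + s * ?c * (D m (D k G) w * mehler p s n (D m (D k F)) w)" for k
  proof -
    have 1: "avg p m (\<lambda>w. D m (D k G) w * mehler p s n (D k F) w) w
        = D m (D k G) w * avg p m (mehler p s n (D k F)) w"
      by (intro avg_mult free_of_D)
    have 2: "avg p m (\<lambda>w. mehler p s n (D m (D k F)) w * D k G w) w
        = mehler p s n (D m (D k F)) w * avg p m (D k G) w"
      by (intro avg_mult free_of_mehler free_of_D)
    show ?thesis unfolding D_mult[where p = p and m = m, OF p_pos p_less] 1
      using 2 by (simp add: D_mehler[OF m] mult.commute mult.left_commute)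
  qed
  then show ?thesis
    unfolding Gam_def[abs_def] D_sum U_def V_def W_def avg_sum
    by (simp add: sum.distrib sum_distrib_left)
qed

text \<open>The three parts of \<open>D\<^sub>m \<Gamma>\<close> are separated by Minkowski's inequality. The bound \<open>3 (x\<^sup>2 + y\<^sup>2 + z\<^sup>2)\<close>
  would leave a root in which the roles of \<open>F\<close> and \<open>G\<close> are mixed, and this root cannot be bounded
  by \<open>B\<^sub>1(i,j)\<close> after summation over \<open>i\<close> and \<open>j\<close>. Integrating over \<open>s\<close> gives the coefficients
  \<open>3/2 \<le> sqrt (15/4)\<close> and \<open>1/2 \<le> sqrt (3/4)\<close>.\<close>

lemma e_Gam_deviation:
  assumes s: "0 \<le> s" "s \<le> 1"
  shows "e n (\<lambda>w'. \<bar>Gam n s F G w' - e n (Gam n s F G) w\<bar>) w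
    \<le> b1 n F G w + s * (b1 n G F w + b2 n F G w)"
proof -
  \<comment> \<open>The mean is subtracted at the fixed \<open>w\<close>, hence as a number, and
    \<open>D m\<close> does not see it.\<close>
  define H where "H = (\<lambda>w'. Gam n s F G w' - e n (Gam n s F G) w)"
  define U where "U = (\<lambda>m w. \<Sum>k<n. D m (D k G) w * mehler p s n (D k F) w)"
  define V where "V = (\<lambda>m w. \<Sum>k<n. D k G w * mehler p s n (D m (D k F)) w)"
  define W where "W = (\<lambda>m w. \<Sum>k<n. D m (D k G) w * mehler p s n (D m (D k F)) w)"
  define N where "N = (\<lambda>X. sqrt (e n (\<lambda>w. (X w)\<^sup>2) w))"
  define c where "c = (\<lambda>m. (qprob p m - p m) / sqrt (p m * qprob p m))"
  have N0: "N X \<ge> 0" for X by (auto simp: N_def intro!: e_nonneg)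
  have "N (D m H) \<le> N (U m) + (s * N (V m) + s * (\<bar>c m\<bar> * N (W m)))" if m: "m < n" for m
  proof -
    have "D m H = D m (Gam n s F G)" by (simp add: H_def fun_eq_iff malliavin_D_def)
    also have "\<dots> = (\<lambda>w. avg p m (U m) w + (s * avg p m (V m) w + (s * c m) * W m w))"
      using D_Gam[OF m] by (simp add: fun_eq_iff U_def V_def W_def c_def)
    finally have "N (D m H) \<le> N (avg p m (U m)) + N (\<lambda>w. s * avg p m (V m) w + (s * c m) * W m w)"
      unfolding N_def by (simp only: e_norm_triangle)
    also have "\<dots> \<le> N (avg p m (U m)) + (N (\<lambda>w. s * avg p m (V m) w) + N (\<lambda>w. (s * c m) * W m w))"
      unfolding N_def by (intro add_left_mono e_norm_triangle)
    also have "\<dots> = N (avg p m (U m)) + (s * N (avg p m (V m)) + s * (\<bar>c m\<bar> * N (W m)))"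
      unfolding N_def e_norm_cmult using s by (simp add: abs_mult)
    also have "\<dots> \<le> N (U m) + (s * N (V m) + s * (\<bar>c m\<bar> * N (W m)))"
      unfolding N_def using s m by (intro add_mono mult_left_mono e_norm_avg) auto
    finally show ?thesis .
  qed
  then have "L2_set (\<lambda>m. N (D m H)) {..<n}
      \<le> L2_set (\<lambda>m. N (U m) + (s * N (V m) + s * (\<bar>c m\<bar> * N (W m)))) {..<n}"
    by (intro L2_set_mono) (auto simp: N0)
  also have "\<dots> \<le> L2_set (\<lambda>m. N (U m)) {..<n} + L2_set (\<lambda>m. s * N (V m) + s * (\<bar>c m\<bar> * N (W m))) {..<n}"
    by (rule L2_set_triangle_ineq)
  also have "\<dots> \<le> L2_set (\<lambda>m. N (U m)) {..<n}
      + (L2_set (\<lambda>m. s * N (V m)) {..<n} + L2_set (\<lambda>m. s * (\<bar>c m\<bar> * N (W m))) {..<n})"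
    by (intro add_left_mono L2_set_triangle_ineq)
  also have "\<dots> = L2_set (\<lambda>m. N (U m)) {..<n}
      + s * (L2_set (\<lambda>m. N (V m)) {..<n} + L2_set (\<lambda>m. \<bar>c m\<bar> * N (W m)) {..<n})"
    using s by (simp add: L2_set_right_distrib[symmetric] algebra_simps)
  finally have main: "L2_set (\<lambda>m. N (D m H)) {..<n} \<le> L2_set (\<lambda>m. N (U m)) {..<n}
      + s * (L2_set (\<lambda>m. N (V m)) {..<n} + L2_set (\<lambda>m. \<bar>c m\<bar> * N (W m)) {..<n})" .

  let ?A = "\<lambda>F k l. sqrt (e n (\<lambda>w. (D k F w)\<^sup>2 * (D l F w)\<^sup>2) w)"
  let ?B = "\<lambda>F m k l. sqrt (e n (\<lambda>w. (D m (D k F) w)\<^sup>2 * (D m (D l F) w)\<^sup>2) w)"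
  have N2: "(N X)\<^sup>2 = e n (\<lambda>w. (X w)\<^sup>2) w" for X by (auto simp: N_def intro!: e_nonneg)
  have AB0: "?A F k l \<ge> 0" "?B F m k l \<ge> 0" for F k l m by (auto intro!: e_nonneg)
  have swap: "(\<Sum>m<n. \<Sum>k<n. \<Sum>l<n. f k l m) = (\<Sum>k<n. \<Sum>l<n. \<Sum>m<n. f k l m)"
    for f :: "nat \<Rightarrow> nat \<Rightarrow> nat \<Rightarrow> real"
  proof -
    have "(\<Sum>m<n. \<Sum>k<n. \<Sum>l<n. f k l m) = (\<Sum>k<n. \<Sum>m<n. \<Sum>l<n. f k l m)" by (rule sum.swap)
    also have "\<dots> = (\<Sum>k<n. \<Sum>l<n. \<Sum>m<n. f k l m)" by (intro sum.cong sum.swap refl)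
    finally show ?thesis .
  qed
  have u: "L2_set (\<lambda>m. N (U m)) {..<n} \<le> b1 n F G w"
  proof -
    have "(\<Sum>m<n. (N (U m))\<^sup>2) \<le> (\<Sum>m<n. \<Sum>k<n. \<Sum>l<n. ?B G m k l * ?A F k l)"
      unfolding N2 U_def using s by (intro sum_mono e_quadratic)
    also have "\<dots> = (\<Sum>k<n. \<Sum>l<n. \<Sum>m<n. ?A F k l * ?B G m k l)"
      by (subst swap) (simp only: mult.commute)
    finally show ?thesis unfolding L2_set_def b1_def by (intro real_sqrt_le_mono)
  qed
  have v: "L2_set (\<lambda>m. N (V m)) {..<n} \<le> b1 n G F w"
  proof -
    have "(\<Sum>m<n. (N (V m))\<^sup>2) \<le> (\<Sum>m<n. \<Sum>k<n. \<Sum>l<n. ?A G k l * ?B F m k l)"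
      unfolding N2 V_def using s by (intro sum_mono e_quadratic)
    also have "\<dots> = (\<Sum>k<n. \<Sum>l<n. \<Sum>m<n. ?A G k l * ?B F m k l)"
      by (rule swap)
    finally show ?thesis unfolding L2_set_def b1_def by (intro real_sqrt_le_mono)
  qed
  have w: "L2_set (\<lambda>m. \<bar>c m\<bar> * N (W m)) {..<n} \<le> b2 n F G w"
  proof -
    have "(\<Sum>m<n. (\<bar>c m\<bar> * N (W m))\<^sup>2)
        \<le> (\<Sum>m<n. 1 / (p m * qprob p m) * (\<Sum>k<n. \<Sum>l<n. ?B G m k l * ?B F m k l))"
    proof (rule sum_mono)
      fix m
      \<comment> \<open>The squared asymmetry factor is \<open>(q - p)^2 / (p q)\<close>; bounding
        its numerator by 1 gives the weight of the second bound.\<close>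
      have "\<bar>qprob p m - p m\<bar> \<le> 1" using p_pos[of m] p_less[of m] by simp
      then have "(qprob p m - p m)\<^sup>2 \<le> 1" by (simp add: abs_square_le_1)
      then have c2: "(c m)\<^sup>2 \<le> 1 / (p m * qprob p m)"
        unfolding c_def power_divide using pq_pos[of m] by (simp add: divide_right_mono)
      have "(N (W m))\<^sup>2 \<le> (\<Sum>k<n. \<Sum>l<n. ?B G m k l * ?B F m k l)"
        unfolding N2 W_def using s by (intro e_quadratic)
      then show "(\<bar>c m\<bar> * N (W m))\<^sup>2 \<le> 1 / (p m * qprob p m) * (\<Sum>k<n. \<Sum>l<n. ?B G m k l * ?B F m k l)"
        unfolding power_mult_distrib power2_abs using c2 pq_pos[of m] by (intro mult_mono) auto
    qed
    also have "\<dots> = (\<Sum>k<n. \<Sum>l<n. \<Sum>m<n. 1 / (p m * qprob p m) * ?B F m k l * ?B G m k l)"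
      unfolding sum_distrib_left by (subst swap) (simp only: ac_simps)
    finally show ?thesis unfolding L2_set_def b2_def by (intro real_sqrt_le_mono)
  qed

  \<comment> \<open>With mean zero the Poincare inequality controls the mean square of
    \<open>H\<close> by its gradient alone; the mean absolute value is then estimated by the root of
    the mean square.\<close>
  have "e n H w = 0" unfolding H_def by (simp add: mehler_diff)
  then have "e n (\<lambda>w. (H w)\<^sup>2) w \<le> (\<Sum>m<n. (N (D m H))\<^sup>2)"
    using poincare[of n H w] unfolding N2 by simp
  then have H2: "N H \<le> L2_set (\<lambda>m. N (D m H)) {..<n}"
    unfolding L2_set_def N_def by (rule real_sqrt_le_mono)
  have "e n (\<lambda>w. \<bar>H w\<bar>) w \<le> N H"
    using e_CS_sqrt[of n "\<lambda>_. 1" "\<lambda>w. \<bar>H w\<bar>" w] by (simp add: N_def)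
  also note H2
  also note main
  also have "L2_set (\<lambda>m. N (U m)) {..<n}
      + s * (L2_set (\<lambda>m. N (V m)) {..<n} + L2_set (\<lambda>m. \<bar>c m\<bar> * N (W m)) {..<n})
     \<le> b1 n F G w + s * (b1 n G F w + b2 n F G w)"
    using u v w s by (intro add_mono mult_left_mono) auto
  finally show ?thesis by (simp add: H_def)
qed

end

section \<open>Hoelder estimates for the chain rule remainder\<close>

context rademacher
begin

lemma e_abs_mult_square_le:
  assumes "0 \<le> s" "s \<le> 1"
  shows "e n (\<lambda>w. \<bar>mehler p s n F w\<bar> * (G w)\<^sup>2) w
    \<le> sqrt (e n (\<lambda>w. (F w)\<^sup>2) w) * sqrt (e n (\<lambda>w. (G w) ^ 4) w)"
proof -
  have "e n (\<lambda>w. \<bar>mehler p s n F w\<bar> * (G w)\<^sup>2) w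
    \<le> sqrt (e n (\<lambda>w. \<bar>mehler p s n F w\<bar>\<^sup>2) w) * sqrt (e n (\<lambda>w. ((G w)\<^sup>2)\<^sup>2) w)"
    by (rule order_trans[OF abs_ge_self e_CS_sqrt])
  also have "\<dots> \<le> sqrt (e n (\<lambda>w. (F w)\<^sup>2) w) * sqrt (e n (\<lambda>w. ((G w)\<^sup>2)\<^sup>2) w)"
    using e_mehler_power2_le[OF assms, of n F w]
    by (intro mult_right_mono real_sqrt_le_mono) (auto intro!: e_nonneg)
  finally show ?thesis by simp
qed

text \<open>Hoelder's inequality with exponents 4 and 4/3, obtained from Cauchy-Schwarz for the
  splitting of the integrand into \<open>\<bar>P\<bar> * \<bar>G\<bar>\<close> and the square of
  \<open>G\<close>, and once more for the square of the first factor.\<close>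

lemma e_abs_mult_cube_le:
  assumes "0 \<le> s" "s \<le> 1"
  shows "e n (\<lambda>w. \<bar>mehler p s n F w\<bar> * \<bar>G w\<bar> ^ 3) w
    \<le> sqrt (sqrt (e n (\<lambda>w. (F w) ^ 4) w) * sqrt (e n (\<lambda>w. (G w) ^ 4) w))
       * sqrt (e n (\<lambda>w. (G w) ^ 4) w)"
proof -
  let ?P = "mehler p s n F"
  have *: "(\<lambda>w. \<bar>?P w\<bar> * \<bar>G w\<bar> ^ 3) = (\<lambda>w. (\<bar>?P w\<bar> * \<bar>G w\<bar>) * (G w)\<^sup>2)"
    by (simp add: power3_eq_cube power2_eq_square mult.assoc fun_eq_iff)
  have "e n (\<lambda>w. \<bar>?P w\<bar> * \<bar>G w\<bar> ^ 3) w
    \<le> sqrt (e n (\<lambda>w. (\<bar>?P w\<bar> * \<bar>G w\<bar>)\<^sup>2) w) * sqrt (e n (\<lambda>w. ((G w)\<^sup>2)\<^sup>2) w)"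
    unfolding * by (rule order_trans[OF abs_ge_self e_CS_sqrt])
  also have "\<dots> = sqrt (e n (\<lambda>w. (?P w)\<^sup>2 * (G w)\<^sup>2) w) * sqrt (e n (\<lambda>w. (G w) ^ 4) w)"
    by (simp add: power_mult_distrib)
  also have "\<dots> \<le> sqrt (sqrt (e n (\<lambda>w. (F w) ^ 4) w) * sqrt (e n (\<lambda>w. (G w) ^ 4) w))
       * sqrt (e n (\<lambda>w. (G w) ^ 4) w)"
  proof (intro mult_right_mono real_sqrt_le_mono)
    have "e n (\<lambda>w. (?P w)\<^sup>2 * (G w)\<^sup>2) w
      \<le> sqrt (e n (\<lambda>w. ((?P w)\<^sup>2)\<^sup>2) w) * sqrt (e n (\<lambda>w. ((G w)\<^sup>2)\<^sup>2) w)"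
      by (rule order_trans[OF abs_ge_self e_CS_sqrt])
    also have "\<dots> = sqrt (e n (\<lambda>w. (?P w) ^ 4) w) * sqrt (e n (\<lambda>w. (G w) ^ 4) w)"
      by simp
    also have "\<dots> \<le> sqrt (e n (\<lambda>w. (F w) ^ 4) w) * sqrt (e n (\<lambda>w. (G w) ^ 4) w)"
      using e_mehler_power4_le[OF assms, of n F w]
      by (intro mult_right_mono real_sqrt_le_mono) (auto intro!: e_nonneg)
    finally show "e n (\<lambda>w. (?P w)\<^sup>2 * (G w)\<^sup>2) w
      \<le> sqrt (e n (\<lambda>w. (F w) ^ 4) w) * sqrt (e n (\<lambda>w. (G w) ^ 4) w)" .
  qed (auto intro!: e_nonneg)
  finally show ?thesis .
qed

abbreviation vec where "vec F w \<equiv> \<chi> i. F i w"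

section \<open>Stein interpolation on finitely many coordinates\<close>

text \<open>The trapezoidal weight is taken as \<open>q = p k\<close>, so the weighted derivatives
  at the two end points form the average of \<open>h'\<close> over coordinate \<open>k\<close>. The
  linear term is thereby free of \<open>k\<close>, and the quadratic error carries the factor
  \<open>p k - qprob p k\<close>.\<close>

lemma D_chain_rule:
  fixes F :: "'d::finite \<Rightarrow> (nat \<Rightarrow> real) \<Rightarrow> real" and h :: "real ^ 'd \<Rightarrow> real"
  assumes trap: "\<And>a b q. 0 \<le> q \<Longrightarrow> q \<le> 1 \<Longrightarrow>
      \<bar>h a - h b - (\<Sum>j\<in>UNIV. (a $ j - b $ j) * (q * h' j a + (1 - q) * h' j b))\<bar>
      \<le> \<bar>q - (1 - q)\<bar> / 2 * (\<Sum>j\<in>UNIV. \<bar>a $ j - b $ j\<bar>)\<^sup>2 + 5/12 * (\<Sum>j\<in>UNIV. \<bar>a $ j - b $ j\<bar>) ^ 3"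
    and c: "0 \<le> c" "c \<le> 1"
  defines "W \<equiv> \<lambda>w. c *\<^sub>R vec F w"
  shows "\<bar>D k (\<lambda>w. h (W w)) w - c * (\<Sum>j\<in>UNIV. D k (F j) w * avg p k (\<lambda>w. h' j (W w)) w)\<bar>
    \<le> c * (\<bar>p k - qprob p k\<bar> / sqrt (p k * qprob p k) * (real CARD('d) / 2 * (\<Sum>j\<in>UNIV. (D k (F j) w)\<^sup>2))
        + 1 / (p k * qprob p k) * (5/12 * (real CARD('d))\<^sup>2 * (\<Sum>j\<in>UNIV. \<bar>D k (F j) w\<bar> ^ 3)))"
proof -
  define r where "r = sqrt (p k * qprob p k)"
  have r: "r > 0" "r * r = p k * qprob p k" using pq_pos[of k] by (simp_all add: r_def)
  define a b where "a = W (fun_upd w k 1)" and "b = W (fun_upd w k (-1))"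
  have ab: "a $ j - b $ j = c / r * D k (F j) w" for j
    unfolding a_def b_def W_def malliavin_D_def r_def[symmetric] using r by (simp add: right_diff_distrib)
  define S where "S = (\<Sum>j\<in>UNIV. \<bar>D k (F j) w\<bar>)"
  have S: "(\<Sum>j\<in>UNIV. \<bar>a $ j - b $ j\<bar>) = c / r * S"
    unfolding ab S_def using c r by (simp add: abs_mult sum_distrib_left)
  have S0: "S \<ge> 0" by (simp add: S_def sum_nonneg)
  have A: "h' j a * p k + h' j b * qprob p k = avg p k (\<lambda>w. h' j (W w)) w" for j
    by (simp add: avg_def a_def b_def)
  have "(\<Sum>j\<in>UNIV. (a $ j - b $ j) * (p k * h' j a + qprob p k * h' j b))
      = c / r * (\<Sum>j\<in>UNIV. D k (F j) w * avg p k (\<lambda>w. h' j (W w)) w)"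
    unfolding ab A[symmetric] sum_distrib_left by (intro sum.cong refl) (simp add: mult_ac)
  then have "\<bar>h a - h b - c / r * (\<Sum>j\<in>UNIV. D k (F j) w * avg p k (\<lambda>w. h' j (W w)) w)\<bar>
      \<le> \<bar>p k - qprob p k\<bar> / 2 * (c / r * S)\<^sup>2 + 5/12 * (c / r * S) ^ 3"
    using trap[of "p k" a b] p_pos[of k] p_less[of k] by (simp add: S)
  then have "r * \<bar>h a - h b - c / r * (\<Sum>j\<in>UNIV. D k (F j) w * avg p k (\<lambda>w. h' j (W w)) w)\<bar>
      \<le> r * (\<bar>p k - qprob p k\<bar> / 2 * (c / r * S)\<^sup>2 + 5/12 * (c / r * S) ^ 3)"
    using r by (intro mult_left_mono) auto
  moreover have "r * \<bar>h a - h b - c / r * (\<Sum>j\<in>UNIV. D k (F j) w * avg p k (\<lambda>w. h' j (W w)) w)\<bar>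
     = \<bar>r * (h a - h b - c / r * (\<Sum>j\<in>UNIV. D k (F j) w * avg p k (\<lambda>w. h' j (W w)) w))\<bar>"
    using r by (simp add: abs_mult)
  moreover have "r * (h a - h b - c / r * (\<Sum>j\<in>UNIV. D k (F j) w * avg p k (\<lambda>w. h' j (W w)) w))
     = D k (\<lambda>w. h (W w)) w - c * (\<Sum>j\<in>UNIV. D k (F j) w * avg p k (\<lambda>w. h' j (W w)) w)"
    unfolding malliavin_D_def a_def b_def r_def[symmetric] using r(1) by (simp add: right_diff_distrib)
  ultimately have 1: "\<bar>D k (\<lambda>w. h (W w)) w - c * (\<Sum>j\<in>UNIV. D k (F j) w * avg p k (\<lambda>w. h' j (W w)) w)\<bar>
     \<le> r * (\<bar>p k - qprob p k\<bar> / 2 * (c / r * S)\<^sup>2 + 5/12 * (c / r * S) ^ 3)" by simp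
  also have "\<dots> = \<bar>p k - qprob p k\<bar> / r * (c\<^sup>2 * (S\<^sup>2 / 2)) + 1 / (r * r) * (c ^ 3 * (5/12 * S ^ 3))"
    using r(1) by (simp add: field_simps power2_eq_square power3_eq_cube)
  also have "\<dots> \<le> \<bar>p k - qprob p k\<bar> / r * (c * (real CARD('d) * (\<Sum>j\<in>UNIV. (D k (F j) w)\<^sup>2) / 2))
      + 1 / (r * r) * (c * (5/12 * ((real CARD('d))\<^sup>2 * (\<Sum>j\<in>UNIV. \<bar>D k (F j) w\<bar> ^ 3))))"
  proof -
    \<comment> \<open>All but one power of \<open>c\<close> are given up; the remaining one is what
      cancels the singular factor of the interpolation.\<close>
    have "c\<^sup>2 \<le> c" "c ^ 3 \<le> c" using c power_decreasing[of 1 2 c] power_decreasing[of 1 3 c] by auto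
    then show ?thesis
      using sum_abs_power2_le[of "\<lambda>j. D k (F j) w"] sum_abs_power3_le[of "\<lambda>j. D k (F j) w"] r(1) S0 c
      unfolding S_def[symmetric]
      by (intro add_mono mult_left_mono mult_mono) auto
  qed
  also have "\<dots> = c * (\<bar>p k - qprob p k\<bar> / sqrt (p k * qprob p k) * (real CARD('d) / 2 * (\<Sum>j\<in>UNIV. (D k (F j) w)\<^sup>2))
        + 1 / (p k * qprob p k) * (5/12 * (real CARD('d))\<^sup>2 * (\<Sum>j\<in>UNIV. \<bar>D k (F j) w\<bar> ^ 3)))"
    unfolding r(2) r_def[symmetric] by (simp only: ring_distribs) (simp add: ac_simps)
  finally show ?thesis .
qed

text \<open>The coefficient 3/2 is 1 + 1/2: the half belongs to the transposed \<open>b1\<close>,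
  which the deviation estimate multiplies by s and which has the same sum over all pairs.\<close>

definition bsum where
  "bsum n (F :: 'd::finite \<Rightarrow> _) i j w = 3/2 * b1 n (F i) (F j) w + 1/2 * b2 n (F i) (F j) w
    + 1/2 * real CARD('d) powr (3/2) * b3 n (F i) (F j) w
    + 5/12 * real CARD('d) ^ 2 * b4 n (F i) (F j) w"

text \<open>An approximate Stein identity: \<open>F i\<close> is replaced by its smoothing at
  parameter s. At s = 0 the smoothing is the zero mean and \<open>chi\<close> vanishes, at s = 1 it
  is \<open>F i\<close>. The derivative in s splits into chain rule remainders and the deviation of
  \<open>Gam\<close> from its mean.\<close>

lemma stein_interpolation:
  fixes F :: "'d::finite \<Rightarrow> (nat \<Rightarrow> real) \<Rightarrow> real"
    and h1 :: "'d \<Rightarrow> real ^ 'd \<Rightarrow> real" and h2 :: "'d \<Rightarrow> 'd \<Rightarrow> real ^ 'd \<Rightarrow> real"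
  assumes trap: "\<And>i a b q. 0 \<le> q \<Longrightarrow> q \<le> 1 \<Longrightarrow>
      \<bar>h1 i a - h1 i b - (\<Sum>j\<in>UNIV. (a $ j - b $ j) * (q * h2 i j a + (1 - q) * h2 i j b))\<bar>
      \<le> \<bar>q - (1 - q)\<bar> / 2 * (\<Sum>j\<in>UNIV. \<bar>a $ j - b $ j\<bar>)\<^sup>2 + 5/12 * (\<Sum>j\<in>UNIV. \<bar>a $ j - b $ j\<bar>) ^ 3"
    and h2: "\<And>i j x. \<bar>h2 i j x\<bar> \<le> 1"
    and c: "0 \<le> c" "c \<le> 1"
    and mean: "\<And>i. e n (F i) w = 0"
  defines "W \<equiv> \<lambda>w. c *\<^sub>R vec F w"
  shows "\<bar>(\<Sum>i\<in>UNIV. e n (\<lambda>w. h1 i (W w) * F i w) w)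
     - c * (\<Sum>i\<in>UNIV. \<Sum>j\<in>UNIV. S i j * e n (\<lambda>w. h2 i j (W w)) w)\<bar>
    \<le> c * (\<Sum>i\<in>UNIV. \<Sum>j\<in>UNIV. \<bar>S i j - e n (\<lambda>w. F i w * F j w) w\<bar> + bsum n F i j w)"
proof -
  define E2 where "E2 i j = e n (\<lambda>w. h2 i j (W w)) w" for i j
  have E2: "\<bar>E2 i j\<bar> \<le> 1" for i j
    using mehler_abs[of 0 n "\<lambda>w. h2 i j (W w)" w] e_mono[of "\<lambda>w. \<bar>h2 i j (W w)\<bar>" "\<lambda>_. 1" n w] h2
    by (simp add: E2_def)
  define chi where "chi = (\<lambda>s. (\<Sum>i\<in>UNIV. e n (\<lambda>w. h1 i (W w) * mehler p s n (F i) w) w)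
     - c * (\<Sum>i\<in>UNIV. \<Sum>j\<in>UNIV. E2 i j * e n (\<lambda>w. F j w * mehler p s n (F i) w) w))"
  define chi' where "chi' = (\<lambda>s. (\<Sum>i\<in>UNIV. \<Sum>k<n. e n (\<lambda>w. D k (\<lambda>w. h1 i (W w)) w * mehler p s n (D k (F i)) w) w)
     - c * (\<Sum>i\<in>UNIV. \<Sum>j\<in>UNIV. E2 i j * (\<Sum>k<n. e n (\<lambda>w. D k (F j) w * mehler p s n (D k (F i)) w) w)))"
  have der: "(chi has_real_derivative chi' s) (at s)" for s
    unfolding chi_def chi'_def by (intro derivative_intros DERIV_cmult DERIV_mehler order_refl)
  let ?b34 = "\<lambda>i j. 1/2 * real CARD('d) powr (3/2) * b3 n (F i) (F j) w
    + 5/12 * real CARD('d) ^ 2 * b4 n (F i) (F j) w"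
  let ?\<alpha> = "c * (\<Sum>i\<in>UNIV. \<Sum>j\<in>UNIV. b1 n (F i) (F j) w + ?b34 i j)"
  let ?\<beta> = "c * (\<Sum>i\<in>UNIV. \<Sum>j\<in>UNIV. b1 n (F i) (F j) w + b2 n (F i) (F j) w)"
  have d1: "1 \<le> real CARD('d)" using zero_less_card_finite[where 'a='d] by linarith
  have bound: "\<bar>chi' s\<bar> \<le> ?\<alpha> + s * ?\<beta>" if s: "0 \<le> s" "s \<le> 1" for s
  proof -
    define R where "R i k = (\<lambda>w. D k (\<lambda>w. h1 i (W w)) w
        - c * (\<Sum>j\<in>UNIV. D k (F j) w * avg p k (\<lambda>w. h2 i j (W w)) w))" for i k
    let ?P = "\<lambda>i k. mehler p s n (D k (F i))"
    \<comment> \<open>The average of \<open>h2\<close> stands next to factors that are free of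
      \<open>k\<close>, so it can be widened to an average of the whole product, which the head mean
      absorbs. Hence the main term contains \<open>h2\<close> itself.\<close>
    have main: "e n (\<lambda>w. D k (\<lambda>w. h1 i (W w)) w * ?P i k w) w
        = e n (\<lambda>w. R i k w * ?P i k w) w
         + c * (\<Sum>j\<in>UNIV. e n (\<lambda>w. h2 i j (W w) * (D k (F j) w * ?P i k w)) w)" if k: "k < n" for i k
    proof -
      have "e n (\<lambda>w. D k (F j) w * avg p k (\<lambda>w. h2 i j (W w)) w * ?P i k w) w
        = e n (\<lambda>w. h2 i j (W w) * (D k (F j) w * ?P i k w)) w" for j
      proof -
        have "free_of k (\<lambda>w. D k (F j) w * ?P i k w)"
          using free_of_D[of k p "F j"] free_of_mehler[OF free_of_D[of k p "F i"], of p s n]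
          by (simp add: free_of_def)
        then have "(\<lambda>w. D k (F j) w * avg p k (\<lambda>w. h2 i j (W w)) w * ?P i k w)
          = avg p k (\<lambda>w. (D k (F j) w * ?P i k w) * h2 i j (W w))"
          by (simp add: avg_mult fun_eq_iff)
        then show ?thesis by (simp add: head_mean_avg[OF k] mult.commute)
      qed
      then have "c * (\<Sum>j\<in>UNIV. e n (\<lambda>w. h2 i j (W w) * (D k (F j) w * ?P i k w)) w)
        = e n (\<lambda>w. c * (\<Sum>j\<in>UNIV. D k (F j) w * avg p k (\<lambda>w. h2 i j (W w)) w * ?P i k w)) w"
        by (simp add: mehler_cmult mehler_sum)
      moreover have "(\<lambda>w. D k (\<lambda>w. h1 i (W w)) w * ?P i k w)
         = (\<lambda>w. R i k w * ?P i k w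
           + c * (\<Sum>j\<in>UNIV. D k (F j) w * avg p k (\<lambda>w. h2 i j (W w)) w * ?P i k w))"
        by (simp add: R_def fun_eq_iff algebra_simps sum_distrib_left)
      ultimately show ?thesis by (simp only: mehler_add)
    qed
    \<comment> \<open>Subtracting the product of the means leaves \<open>h2\<close> against the
      deviation of \<open>Gam\<close>, the quantity bounded by
      \<open>e_Gam_deviation\<close>.\<close>
    have gam: "(\<Sum>k<n. e n (\<lambda>w. h2 i j (W w) * (D k (F j) w * ?P i k w)) w)
        - E2 i j * (\<Sum>k<n. e n (\<lambda>w. D k (F j) w * ?P i k w) w)
      = e n (\<lambda>w'. h2 i j (W w') * (Gam n s (F i) (F j) w' - e n (Gam n s (F i) (F j)) w)) w" for i j
    proof -
      have 1: "(\<Sum>k<n. e n (\<lambda>w. D k (F j) w * ?P i k w) w) = e n (Gam n s (F i) (F j)) w"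
        by (simp add: Gam_def[abs_def] mehler_sum)
      have 2: "(\<Sum>k<n. e n (\<lambda>w. h2 i j (W w) * (D k (F j) w * ?P i k w)) w)
          = e n (\<lambda>w. h2 i j (W w) * Gam n s (F i) (F j) w) w"
        by (simp add: Gam_def mehler_sum sum_distrib_left)
      have 3: "E2 i j * g = e n (\<lambda>w. g * h2 i j (W w)) w" for g
        by (simp add: E2_def mehler_cmult)
      show ?thesis unfolding 1 2 3 mehler_diff[symmetric] by (simp add: algebra_simps)
    qed
    have "chi' s = (\<Sum>i\<in>UNIV. \<Sum>k<n. e n (\<lambda>w. R i k w * ?P i k w) w)
      + c * (\<Sum>i\<in>UNIV. \<Sum>j\<in>UNIV. (\<Sum>k<n. e n (\<lambda>w. h2 i j (W w) * (D k (F j) w * ?P i k w)) w)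
          - E2 i j * (\<Sum>k<n. e n (\<lambda>w. D k (F j) w * ?P i k w) w))"
    proof -
      have "(\<Sum>k<n. e n (\<lambda>w. D k (\<lambda>w. h1 i (W w)) w * ?P i k w) w)
        = (\<Sum>k<n. e n (\<lambda>w. R i k w * ?P i k w) w)
         + c * (\<Sum>j\<in>UNIV. \<Sum>k<n. e n (\<lambda>w. h2 i j (W w) * (D k (F j) w * ?P i k w)) w)" for i
        by (simp add: main sum.distrib sum_distrib_left) (rule sum.swap)
      then show ?thesis
        by (simp add: chi'_def sum.distrib sum_subtractf sum_distrib_left right_diff_distrib)
    qed
    then have "\<bar>chi' s\<bar> \<le> \<bar>\<Sum>i\<in>UNIV. \<Sum>k<n. e n (\<lambda>w. R i k w * ?P i k w) w\<bar>
      + \<bar>c * (\<Sum>i\<in>UNIV. \<Sum>j\<in>UNIV. e n (\<lambda>w'. h2 i j (W w') * (Gam n s (F i) (F j) w' - e n (Gam n s (F i) (F j)) w)) w)\<bar>"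
      unfolding gam by linarith
    also have "\<dots> \<le> (\<Sum>i\<in>UNIV. \<Sum>k<n. \<bar>e n (\<lambda>w. R i k w * ?P i k w) w\<bar>)
      + c * (\<Sum>i\<in>UNIV. \<Sum>j\<in>UNIV. \<bar>e n (\<lambda>w'. h2 i j (W w') * (Gam n s (F i) (F j) w' - e n (Gam n s (F i) (F j)) w)) w\<bar>)"
      unfolding abs_mult abs_of_nonneg[OF c(1)]
      by (intro add_mono mult_left_mono c order_trans[OF sum_abs] sum_mono order_refl)
    also have "\<dots> \<le> c * (\<Sum>i\<in>UNIV. \<Sum>j\<in>UNIV. ?b34 i j)
      + c * (\<Sum>i\<in>UNIV. \<Sum>j\<in>UNIV. b1 n (F i) (F j) w + s * (b1 n (F j) (F i) w + b2 n (F i) (F j) w))"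
    proof (intro add_mono mult_left_mono sum_mono c)
      fix i j
      let ?G = "\<lambda>w'. Gam n s (F i) (F j) w' - e n (Gam n s (F i) (F j)) w"
      have "\<bar>e n (\<lambda>w'. h2 i j (W w') * ?G w') w\<bar> \<le> e n (\<lambda>w'. \<bar>h2 i j (W w') * ?G w'\<bar>) w"
        by (intro mehler_abs) auto
      also have "\<dots> \<le> e n (\<lambda>w'. \<bar>?G w'\<bar>) w"
        using h2 by (intro e_mono) (simp add: abs_mult mult_left_le_one_le)
      also have "\<dots> \<le> b1 n (F i) (F j) w + s * (b1 n (F j) (F i) w + b2 n (F i) (F j) w)"
        using s by (rule e_Gam_deviation)
      finally show "\<bar>e n (\<lambda>w'. h2 i j (W w') * ?G w') w\<bar>
        \<le> b1 n (F i) (F j) w + s * (b1 n (F j) (F i) w + b2 n (F i) (F j) w)" .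
    next
      have "(\<Sum>k<n. \<bar>e n (\<lambda>w. R i k w * ?P i k w) w\<bar>) \<le> c * (\<Sum>j\<in>UNIV. ?b34 i j)" for i
      proof -
        let ?u = "\<lambda>k. \<bar>p k - qprob p k\<bar> / sqrt (p k * qprob p k)"
        let ?v = "\<lambda>k. 1 / (p k * qprob p k)"
        let ?d = "real CARD('d)"
        let ?X = "\<lambda>k j. sqrt (e n (\<lambda>w. (D k (F i) w)\<^sup>2) w) * sqrt (e n (\<lambda>w. (D k (F j) w) ^ 4) w)"
        let ?Y = "\<lambda>k j. sqrt (sqrt (e n (\<lambda>w. (D k (F i) w) ^ 4) w) * sqrt (e n (\<lambda>w. (D k (F j) w) ^ 4) w))
              * sqrt (e n (\<lambda>w. (D k (F j) w) ^ 4) w)"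
        have uv: "?u k \<ge> 0" "?v k \<ge> 0" for k using pq_pos[of k] by auto
        have "\<bar>e n (\<lambda>w. R i k w * ?P i k w) w\<bar>
          \<le> c * (\<Sum>j\<in>UNIV. ?d / 2 * (?u k * ?X k j) + 5/12 * ?d\<^sup>2 * (?v k * ?Y k j))" for k
        proof -
          have "\<bar>e n (\<lambda>w. R i k w * ?P i k w) w\<bar> \<le> e n (\<lambda>w. \<bar>R i k w * ?P i k w\<bar>) w"
            by (intro mehler_abs) auto
          also have "\<dots> \<le> e n (\<lambda>w. c * (?u k * (?d / 2 * (\<Sum>j\<in>UNIV. (D k (F j) w)\<^sup>2))
            + ?v k * (5/12 * ?d\<^sup>2 * (\<Sum>j\<in>UNIV. \<bar>D k (F j) w\<bar> ^ 3))) * \<bar>?P i k w\<bar>) w"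
            unfolding abs_mult R_def W_def
            by (intro e_mono mult_right_mono D_chain_rule trap c) auto
          also have "(\<lambda>w. c * (?u k * (?d / 2 * (\<Sum>j\<in>UNIV. (D k (F j) w)\<^sup>2))
            + ?v k * (5/12 * ?d\<^sup>2 * (\<Sum>j\<in>UNIV. \<bar>D k (F j) w\<bar> ^ 3))) * \<bar>?P i k w\<bar>)
            = (\<lambda>w. c * (\<Sum>j\<in>UNIV. ?d / 2 * ?u k * (\<bar>?P i k w\<bar> * (D k (F j) w)\<^sup>2)
                + 5/12 * ?d\<^sup>2 * ?v k * (\<bar>?P i k w\<bar> * \<bar>D k (F j) w\<bar> ^ 3)))"
            by (simp only: sum.distrib sum_distrib_left sum_distrib_right distrib_left distrib_right mult_ac)
          also have "e n \<dots> w = c * (\<Sum>j\<in>UNIV. ?d / 2 * ?u k * e n (\<lambda>w. \<bar>?P i k w\<bar> * (D k (F j) w)\<^sup>2) w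
                + 5/12 * ?d\<^sup>2 * ?v k * e n (\<lambda>w. \<bar>?P i k w\<bar> * \<bar>D k (F j) w\<bar> ^ 3) w)"
            by (simp only: mehler_cmult mehler_sum mehler_lin)
          also have "\<dots> \<le> c * (\<Sum>j\<in>UNIV. ?d / 2 * ?u k * ?X k j + 5/12 * ?d\<^sup>2 * ?v k * ?Y k j)"
            using s uv by (intro mult_left_mono sum_mono add_mono c e_abs_mult_square_le e_abs_mult_cube_le
                mult_nonneg_nonneg) auto
          finally show ?thesis by (simp only: mult.assoc)
        qed
        then have "(\<Sum>k<n. \<bar>e n (\<lambda>w. R i k w * ?P i k w) w\<bar>)
          \<le> (\<Sum>k<n. c * (\<Sum>j\<in>UNIV. ?d / 2 * (?u k * ?X k j) + 5/12 * ?d\<^sup>2 * (?v k * ?Y k j)))"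
          by (intro sum_mono)
        also have "\<dots> = c * (\<Sum>j\<in>UNIV. ?d / 2 * b3 n (F i) (F j) w + 5/12 * ?d\<^sup>2 * b4 n (F i) (F j) w)"
          by (simp only: sum_distrib_left[symmetric], subst sum.swap,
              simp only: b3_def b4_def sum.distrib sum_distrib_left[symmetric] mult.assoc)
        also have "\<dots> \<le> c * (\<Sum>j\<in>UNIV. ?b34 i j)"
        proof (intro mult_left_mono sum_mono add_right_mono c)
          fix j
          \<comment> \<open>The power sum inequality yields the factor d / 2, which is enlarged to
            the coefficient of \<open>b3\<close> in \<open>bsum\<close>.\<close>
          have "?d powr 1 \<le> ?d powr (3/2)" using d1 by (intro powr_mono) auto
          then have "?d / 2 \<le> 1/2 * ?d powr (3/2)" using d1 by simp
          moreover have "b3 n (F i) (F j) w \<ge> 0" unfolding b3_def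
            using uv by (intro sum_nonneg mult_nonneg_nonneg) (auto intro!: e_nonneg)
          ultimately show "?d / 2 * b3 n (F i) (F j) w \<le> 1/2 * ?d powr (3/2) * b3 n (F i) (F j) w"
            by (rule mult_right_mono)
        qed
        finally show ?thesis .
      qed
      then show "(\<Sum>i\<in>UNIV. \<Sum>k<n. \<bar>e n (\<lambda>w. R i k w * ?P i k w) w\<bar>)
        \<le> c * (\<Sum>i\<in>UNIV. \<Sum>j\<in>UNIV. ?b34 i j)"
        unfolding sum_distrib_left[of c "\<lambda>i. \<Sum>j\<in>UNIV. ?b34 i j"] by (intro sum_mono)
    qed
    also have "\<dots> = ?\<alpha> + s * ?\<beta>"
    proof -
      \<comment> \<open>A transposed \<open>b1\<close> cannot be compared with \<open>b1\<close> for
        a single pair; only the sums over all pairs agree.\<close>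
      have "(\<Sum>i\<in>UNIV. \<Sum>j\<in>UNIV. b1 n (F j) (F i) w) = (\<Sum>i\<in>UNIV. \<Sum>j\<in>UNIV. b1 n (F i) (F j) w)"
        by (rule sum.swap)
      then show ?thesis
        by (simp only: sum.distrib sum_distrib_left[symmetric]) (simp only: algebra_simps)
    qed
    finally show ?thesis .
  qed
  have "\<bar>chi 1 - chi 0\<bar> \<le> ?\<alpha> + ?\<beta> / 2"
    using der bound by (rule affine_DERIV_bound)
  also have "?\<alpha> + ?\<beta> / 2 = c * (\<Sum>i\<in>UNIV. \<Sum>j\<in>UNIV. bsum n F i j w)"
    unfolding bsum_def by (simp only: sum.distrib sum_distrib_left[symmetric]) (simp add: field_simps)
  finally have A: "\<bar>chi 1 - chi 0\<bar> \<le> c * (\<Sum>i\<in>UNIV. \<Sum>j\<in>UNIV. bsum n F i j w)" .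
  have z: "e n (\<lambda>w. G w * e n (F i) w) w = 0" for G i
    using mehler_mult_free[of n "e n (F i)" p 0 G w] by (simp add: head_mean_free mean)
  have chi0: "chi 0 = 0" unfolding chi_def by (simp add: z)
  have chi1: "chi 1 = (\<Sum>i\<in>UNIV. e n (\<lambda>w. h1 i (W w) * F i w) w)
     - c * (\<Sum>i\<in>UNIV. \<Sum>j\<in>UNIV. E2 i j * e n (\<lambda>w. F i w * F j w) w)"
    unfolding chi_def by (simp add: mult.commute)
  \<comment> \<open>\<open>chi 1\<close> carries the conditional second moments in place of
    \<open>S\<close>; exchanging them costs their distance, as \<open>E2\<close> is bounded by
    1.\<close>
  have "(\<Sum>i\<in>UNIV. e n (\<lambda>w. h1 i (W w) * F i w) w) - c * (\<Sum>i\<in>UNIV. \<Sum>j\<in>UNIV. S i j * E2 i j)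
     = (chi 1 - chi 0) - c * (\<Sum>i\<in>UNIV. \<Sum>j\<in>UNIV. (S i j - e n (\<lambda>w. F i w * F j w) w) * E2 i j)"
    unfolding chi0 chi1 by (simp add: left_diff_distrib right_diff_distrib sum_subtractf mult.commute)
  also have "\<bar>\<dots>\<bar> \<le> \<bar>chi 1 - chi 0\<bar>
     + \<bar>c * (\<Sum>i\<in>UNIV. \<Sum>j\<in>UNIV. (S i j - e n (\<lambda>w. F i w * F j w) w) * E2 i j)\<bar>"
    by (rule abs_triangle_ineq4)
  also have "\<bar>c * (\<Sum>i\<in>UNIV. \<Sum>j\<in>UNIV. (S i j - e n (\<lambda>w. F i w * F j w) w) * E2 i j)\<bar>
     \<le> c * (\<Sum>i\<in>UNIV. \<Sum>j\<in>UNIV. \<bar>S i j - e n (\<lambda>w. F i w * F j w) w\<bar>)"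
    unfolding abs_mult abs_of_nonneg[OF c(1)]
    by (intro mult_left_mono c order_trans[OF sum_abs] sum_mono)
       (simp add: abs_mult E2 mult_right_le_one_le)
  also note A
  finally show ?thesis unfolding E2_def
    by (simp add: sum.distrib distrib_left add.commute)
qed

end

section \<open>Taylor estimates for test functions\<close>

abbreviation l1norm :: "real ^ 'd::finite \<Rightarrow> real" where
  "l1norm y \<equiv> \<Sum>i\<in>UNIV. \<bar>y $ i\<bar>"

lemma sum_axis: "(\<Sum>i\<in>UNIV. (y $ i) *\<^sub>R axis i 1) = (y :: real ^ 'd::finite)"
  by (simp add: vec_eq_iff axis_def if_distrib cong: if_cong)

lemma partial_DERIV:
  assumes "partially_differentiable i h"
  shows "((\<lambda>t. h (z + t *\<^sub>R axis i 1)) has_real_derivative partial_deriv i h (z + t *\<^sub>R axis i 1)) (at t)"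
proof -
  let ?z = "z + t *\<^sub>R axis i 1"
  have "((\<lambda>u. h (?z + u *\<^sub>R axis i 1)) has_real_derivative partial_deriv i h ?z) (at 0)"
    using assms unfolding partially_differentiable_def partial_deriv_def
    by (intro DERIV_deriv_iff_real_differentiable[THEN iffD2]) auto
  then have "((\<lambda>u. h (z + (t + u) *\<^sub>R axis i 1)) has_real_derivative partial_deriv i h ?z) (at 0)"
    by (simp add: scaleR_add_left add.assoc)
  then show ?thesis
    using DERIV_shift[of "\<lambda>t. h (z + t *\<^sub>R axis i 1)" "partial_deriv i h ?z" 0 t]
    by (simp add: add.commute)
qed

lemma partial_MVT:
  assumes "partially_differentiable i h"
  shows "\<exists>\<theta>. 0 \<le> \<theta> \<and> \<theta> \<le> 1 \<and>
    h (z + c *\<^sub>R axis i 1) - h z = c * partial_deriv i h (z + (\<theta> * c) *\<^sub>R axis i 1)"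
proof -
  let ?f = "\<lambda>t. h (z + (t * c) *\<^sub>R axis i 1)"
  have d: "(?f has_real_derivative partial_deriv i h (z + (t * c) *\<^sub>R axis i 1) * c) (at t)" for t
    using DERIV_chain2[where f = "\<lambda>t. h (z + t *\<^sub>R axis i 1)" and g = "\<lambda>t. t * c" and x = t,
        OF partial_DERIV[OF assms, of z "t * c"], of c UNIV] DERIV_cmult_right[OF DERIV_ident, of c t UNIV]
    by simp
  obtain t where "0 < t" "t < 1" "?f 1 - ?f 0 = (1 - 0) * (partial_deriv i h (z + (t * c) *\<^sub>R axis i 1) * c)"
    using MVT2[of 0 1 ?f "\<lambda>t. partial_deriv i h (z + (t * c) *\<^sub>R axis i 1) * c"] d by auto
  then show ?thesis by (intro exI[of _ t]) (simp add: mult.commute)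
qed

text \<open>Only partial derivatives are given, so the point is moved along one coordinate at a time
  and the one-dimensional mean value theorem is applied to each move.\<close>

lemma lipschitz_from_partials:
  fixes h :: "real ^ 'd::finite \<Rightarrow> real"
  assumes "\<And>i. partially_differentiable i h" and "\<And>i x. \<bar>partial_deriv i h x\<bar> \<le> 1"
  shows "\<bar>h (x + y) - h x\<bar> \<le> l1norm y"
proof -
  have "\<bar>h (x + (\<Sum>i\<in>A. (y $ i) *\<^sub>R axis i 1)) - h x\<bar> \<le> (\<Sum>i\<in>A. \<bar>y $ i\<bar>)" if "finite A" for A
    using that
  proof induction
    case (insert i A)
    let ?z = "x + (\<Sum>i\<in>A. (y $ i) *\<^sub>R axis i 1)"
    obtain \<theta> where "h (?z + (y $ i) *\<^sub>R axis i 1) - h ?z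
        = y $ i * partial_deriv i h (?z + (\<theta> * y $ i) *\<^sub>R axis i 1)"
      using partial_MVT[OF assms(1)] by blast
    then have "\<bar>h (?z + (y $ i) *\<^sub>R axis i 1) - h ?z\<bar> \<le> \<bar>y $ i\<bar>"
      using assms(2) by (simp add: abs_mult mult_right_le_one_le)
    then show ?case using insert by (simp add: algebra_simps)
  qed simp
  from this[of UNIV] show ?thesis by (simp add: sum_axis)
qed

text \<open>Intermediate points of the coordinatewise path are no farther from the base point than
  its end, coordinate by coordinate.\<close>

lemma l1norm_restrict:
  fixes y :: "real ^ 'd::finite"
  assumes "i \<notin> A" "0 \<le> \<theta>" "\<theta> \<le> 1"
  shows "l1norm ((\<Sum>i\<in>A. (y $ i) *\<^sub>R axis i 1) + (\<theta> * y $ i) *\<^sub>R axis i 1) \<le> l1norm y"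
proof (rule sum_mono)
  fix k
  have "(\<Sum>j\<in>A. y $ j *\<^sub>R axis j (1::real)) $ k = (if k \<in> A then y $ k else 0)"
    by (simp add: axis_def if_distrib sum.delta cong: if_cong)
  then show "\<bar>((\<Sum>i\<in>A. (y $ i) *\<^sub>R axis i 1) + (\<theta> * y $ i) *\<^sub>R axis i 1) $ k\<bar> \<le> \<bar>y $ k\<bar>"
    using assms by (auto simp: axis_def abs_mult mult_left_le_one_le)
qed

text \<open>Lipschitz partials make \<open>h\<close> differentiable with a quadratic remainder: each
  move along a coordinate compares a partial derivative at an intermediate point with its value at
  the base point.\<close>

lemma first_order_from_partials:
  fixes h :: "real ^ 'd::finite \<Rightarrow> real"
  assumes "\<And>i. partially_differentiable i h"
    and "\<And>i x y. \<bar>partial_deriv i h (x + y) - partial_deriv i h x\<bar> \<le> l1norm y"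
  shows "\<bar>h (x + y) - h x - (\<Sum>i\<in>UNIV. y $ i * partial_deriv i h x)\<bar> \<le> (l1norm y)\<^sup>2"
proof -
  have "\<bar>h (x + (\<Sum>i\<in>A. (y $ i) *\<^sub>R axis i 1)) - h x - (\<Sum>i\<in>A. y $ i * partial_deriv i h x)\<bar>
      \<le> (\<Sum>i\<in>A. \<bar>y $ i\<bar>) * l1norm y" if "finite A" for A
    using that
  proof induction
    case (insert i A)
    let ?s = "\<Sum>i\<in>A. (y $ i) *\<^sub>R axis i 1"
    let ?z = "x + ?s"
    obtain \<theta> where \<theta>: "0 \<le> \<theta>" "\<theta> \<le> 1" "h (?z + (y $ i) *\<^sub>R axis i 1) - h ?z
        = y $ i * partial_deriv i h (?z + (\<theta> * y $ i) *\<^sub>R axis i 1)"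
      using partial_MVT[OF assms(1)] by blast
    have "\<bar>partial_deriv i h (x + (?s + (\<theta> * y $ i) *\<^sub>R axis i 1)) - partial_deriv i h x\<bar> \<le> l1norm y"
      using l1norm_restrict[of i A \<theta> y] \<theta> insert by (intro order_trans[OF assms(2)]) auto
    then have "\<bar>h (?z + (y $ i) *\<^sub>R axis i 1) - h ?z - y $ i * partial_deriv i h x\<bar> \<le> \<bar>y $ i\<bar> * l1norm y"
      unfolding \<theta>(3) right_diff_distrib[symmetric] abs_mult
      by (intro mult_left_mono) (auto simp: add.assoc)
    then show ?case using insert by (simp add: algebra_simps)
  qed simp
  from this[of UNIV] show ?thesis by (simp add: sum_axis power2_eq_square)
qed

lemma l1norm_scaleR: "l1norm (c *\<^sub>R y) = \<bar>c\<bar> * l1norm y"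
  by (simp add: abs_mult sum_distrib_left)

lemma line_DERIV_from_partials:
  fixes h :: "real ^ 'd::finite \<Rightarrow> real"
  assumes "\<And>i. partially_differentiable i h"
    and "\<And>i x y. \<bar>partial_deriv i h (x + y) - partial_deriv i h x\<bar> \<le> l1norm y"
  shows "((\<lambda>t. h (x + t *\<^sub>R y)) has_real_derivative
    (\<Sum>i\<in>UNIV. y $ i * partial_deriv i h (x + t *\<^sub>R y))) (at t)"
proof -
  let ?D = "\<Sum>i\<in>UNIV. y $ i * partial_deriv i h (x + t *\<^sub>R y)"
  have "((\<lambda>u. (h (x + (t + u) *\<^sub>R y) - h (x + t *\<^sub>R y)) / u - ?D) \<longlongrightarrow> 0) (at 0)"
  proof (rule tendsto_0_le[where K = 1])
    show "((\<lambda>u. \<bar>u\<bar> * (l1norm y)\<^sup>2) \<longlongrightarrow> 0) (at 0)"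
      by (auto intro!: tendsto_eq_intros)
    show "\<forall>\<^sub>F u in at 0. norm ((h (x + (t + u) *\<^sub>R y) - h (x + t *\<^sub>R y)) / u - ?D)
        \<le> norm (\<bar>u\<bar> * (l1norm y)\<^sup>2) * 1"
      unfolding eventually_at_filter
    proof (intro always_eventually allI impI)
      fix u :: real assume u: "u \<noteq> 0"
      have "\<bar>h ((x + t *\<^sub>R y) + u *\<^sub>R y) - h (x + t *\<^sub>R y) - u * ?D\<bar> \<le> (\<bar>u\<bar> * l1norm y)\<^sup>2"
        using first_order_from_partials[OF assms, of "x + t *\<^sub>R y" "u *\<^sub>R y"]
        unfolding l1norm_scaleR by (simp add: sum_distrib_left mult.assoc)
      then have "\<bar>u * ((h (x + (t + u) *\<^sub>R y) - h (x + t *\<^sub>R y)) / u - ?D)\<bar> \<le> \<bar>u\<bar> * (\<bar>u\<bar> * (l1norm y)\<^sup>2)"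
      proof -
        have "u * ((h (x + (t + u) *\<^sub>R y) - h (x + t *\<^sub>R y)) / u - ?D)
            = h ((x + t *\<^sub>R y) + u *\<^sub>R y) - h (x + t *\<^sub>R y) - u * ?D"
          using u by (simp add: field_simps scaleR_add_left)
        then show ?thesis
          using \<open>\<bar>h ((x + t *\<^sub>R y) + u *\<^sub>R y) - h (x + t *\<^sub>R y) - u * ?D\<bar> \<le> (\<bar>u\<bar> * l1norm y)\<^sup>2\<close>
          by (simp add: power_mult_distrib power2_eq_square mult_ac)
      qed
      then have "\<bar>(h (x + (t + u) *\<^sub>R y) - h (x + t *\<^sub>R y)) / u - ?D\<bar> \<le> \<bar>u\<bar> * (l1norm y)\<^sup>2"
        using u unfolding abs_mult by simp
      then show "norm ((h (x + (t + u) *\<^sub>R y) - h (x + t *\<^sub>R y)) / u - ?D) \<le> norm (\<bar>u\<bar> * (l1norm y)\<^sup>2) * 1"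
        by (simp add: abs_mult)
    qed
  qed
  then show ?thesis unfolding DERIV_def by (rule Lim_null[THEN iffD2])
qed

section \<open>Regularity of the test functions of the metric\<close>

lemma d4_partials_bounded:
  fixes g :: "real ^ 'd::finite \<Rightarrow> real"
  assumes "g \<in> d4_test_functions" and l: "1 \<le> length is" "length is \<le> 4"
  shows "\<bar>iter_partial is g x\<bar> \<le> 1"
proof -
  let ?k = "length is"
  have "?k = 1 \<or> ?k = 2 \<or> ?k = 3 \<or> ?k = 4" using l by linarith
  then have "deriv_bound ?k g \<le> 1" using assms(1) by (auto simp: d4_test_functions_def)
  moreover have "finite {is :: 'd list. length is = ?k}"
    using finite_lists_length_eq[of "UNIV :: 'd set" ?k] by simp
  ultimately have "(SUP x. ennreal \<bar>iter_partial is g x\<bar>) \<le> 1"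
    unfolding deriv_bound_def by (subst (asm) Max_le_iff) auto
  then have "ennreal \<bar>iter_partial is g x\<bar> \<le> 1" by (simp add: SUP_le_iff)
  then show ?thesis using ennreal_le_1 by blast
qed

lemma d4_partially_differentiable:
  "g \<in> d4_test_functions \<Longrightarrow> length is < 4 \<Longrightarrow> partially_differentiable i (iter_partial is g)"
  by (auto simp: d4_test_functions_def)

lemma iter_partial_Cons: "iter_partial (i # is) g = partial_deriv i (iter_partial is g)"
  by (simp add: iter_partial_def)

lemma iter_partial_Nil: "iter_partial [] g = g"
  by (simp add: iter_partial_def)

lemma d4_partials_lipschitz:
  fixes g :: "real ^ 'd::finite \<Rightarrow> real"
  assumes "g \<in> d4_test_functions" "length is \<le> 3"
  shows "\<bar>iter_partial is g (x + y) - iter_partial is g x\<bar> \<le> l1norm y"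
  using assms d4_partials_bounded[OF assms(1), of "_ # is", unfolded iter_partial_Cons]
  by (intro lipschitz_from_partials d4_partially_differentiable) auto

lemma l1norm_nonneg: "0 \<le> l1norm y"
  by (simp add: sum_nonneg)

lemma abs_sum_mult_le:
  fixes y :: "real ^ 'd::finite"
  assumes "\<And>i. \<bar>a i\<bar> \<le> M"
  shows "\<bar>\<Sum>i\<in>UNIV. y $ i * a i\<bar> \<le> l1norm y * M"
proof -
  have "\<bar>\<Sum>i\<in>UNIV. y $ i * a i\<bar> \<le> (\<Sum>i\<in>UNIV. \<bar>y $ i * a i\<bar>)" by (rule sum_abs)
  also have "\<dots> \<le> (\<Sum>i\<in>UNIV. \<bar>y $ i\<bar> * M)"
    using assms by (intro sum_mono) (simp add: abs_mult mult_left_mono)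
  finally show ?thesis by (simp add: sum_distrib_right)
qed

locale d4_test =
  fixes g :: "real ^ 'd::finite \<Rightarrow> real"
  assumes d4: "g \<in> d4_test_functions"
begin

abbreviation g1 where "g1 i \<equiv> partial_deriv i g"
text \<open>\<open>foldr\<close> applies the last list entry innermost, so \<open>g2 i j\<close> is
  the iterated partial for \<open>[j, i]\<close> and \<open>g3 i j l\<close> the one for
  \<open>[l, j, i]\<close>.\<close>

abbreviation g2 where "g2 i j \<equiv> partial_deriv j (partial_deriv i g)"
abbreviation g3 where "g3 i j l \<equiv> partial_deriv l (partial_deriv j (partial_deriv i g))"

lemma g_lip: "\<bar>g (x + y) - g x\<bar> \<le> l1norm y"
  using d4_partials_lipschitz[OF d4, of "[]"] by (simp add: iter_partial_Nil)
lemma g1_lip: "\<bar>g1 i (x + y) - g1 i x\<bar> \<le> l1norm y"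
  using d4_partials_lipschitz[OF d4, of "[i]"] by (simp add: iter_partial_def)
lemma g2_lip: "\<bar>g2 i j (x + y) - g2 i j x\<bar> \<le> l1norm y"
  using d4_partials_lipschitz[OF d4, of "[j, i]"] by (simp add: iter_partial_def)
lemma g3_lip: "\<bar>g3 i j l (x + y) - g3 i j l x\<bar> \<le> l1norm y"
  using d4_partials_lipschitz[OF d4, of "[l, j, i]"] by (simp add: iter_partial_def)

lemma g1_bound: "\<bar>g1 i x\<bar> \<le> 1"
  using d4_partials_bounded[OF d4, of "[i]"] by (simp add: iter_partial_def)
lemma g2_bound: "\<bar>g2 i j x\<bar> \<le> 1"
  using d4_partials_bounded[OF d4, of "[j, i]"] by (simp add: iter_partial_def)

lemma g_pd: "partially_differentiable i g" "partially_differentiable j (g1 i)"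
    "partially_differentiable l (g2 i j)"
  using d4_partially_differentiable[OF d4, of "[]"] d4_partially_differentiable[OF d4, of "[i]"]
    d4_partially_differentiable[OF d4, of "[j, i]"] by (simp_all add: iter_partial_def)

lemma g_first_order: "\<bar>g (x + y) - g x - (\<Sum>i\<in>UNIV. y $ i * g1 i x)\<bar> \<le> (l1norm y)\<^sup>2"
  by (intro first_order_from_partials g_pd g1_lip)

lemma g1_first_order: "\<bar>g1 i (x + y) - g1 i x - (\<Sum>j\<in>UNIV. y $ j * g2 i j x)\<bar> \<le> (l1norm y)\<^sup>2"
  by (intro first_order_from_partials g_pd g2_lip)

text \<open>The first-order estimate for the gradient is carried along the segment. Only the cubic
  order in \<open>y\<close> matters for the heat equation, so the constant is not optimised.\<close>

lemma g_second_order: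
  "\<bar>g (x + y) - g x - (\<Sum>i\<in>UNIV. y $ i * g1 i x) - 1/2 * (\<Sum>i\<in>UNIV. \<Sum>j\<in>UNIV. y $ i * y $ j * g2 i j x)\<bar>
    \<le> (l1norm y) ^ 3"
proof -
  let ?A = "\<Sum>i\<in>UNIV. y $ i * g1 i x" and ?B = "\<Sum>i\<in>UNIV. \<Sum>j\<in>UNIV. y $ i * y $ j * g2 i j x"
  let ?f = "\<lambda>t. g (x + t *\<^sub>R y) - t * ?A - t\<^sup>2 / 2 * ?B"
  let ?f' = "\<lambda>t. (\<Sum>i\<in>UNIV. y $ i * g1 i (x + t *\<^sub>R y)) - ?A - t * ?B"
  have "\<bar>?f 1 - ?f 0\<bar> \<le> (\<lambda>t. (l1norm y) ^ 3 * t) 1 - (\<lambda>t. (l1norm y) ^ 3 * t) 0"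
  proof (rule DERIV_abs_le)
    fix t :: real assume t: "0 \<le> t" "t \<le> 1"
    show "(?f has_real_derivative ?f' t) (at t)"
      by (auto intro!: derivative_eq_intros line_DERIV_from_partials g_pd g1_lip)
    show "((\<lambda>t. (l1norm y) ^ 3 * t) has_real_derivative (l1norm y) ^ 3) (at t)"
      by (auto intro!: derivative_eq_intros)
    have "?f' t = (\<Sum>i\<in>UNIV. y $ i * (g1 i (x + t *\<^sub>R y) - g1 i x - (\<Sum>j\<in>UNIV. (t *\<^sub>R y) $ j * g2 i j x)))"
      by (simp add: sum_subtractf right_diff_distrib sum_distrib_left mult_ac)
    also have "\<bar>\<dots>\<bar> \<le> l1norm y * (l1norm (t *\<^sub>R y))\<^sup>2"
      by (intro abs_sum_mult_le g1_first_order)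
    also have "\<dots> = t\<^sup>2 * (l1norm y) ^ 3"
      unfolding l1norm_scaleR using t by (simp add: power2_eq_square power3_eq_cube mult_ac)
    also have "\<dots> \<le> 1 * (l1norm y) ^ 3"
      using t by (intro mult_right_mono) (auto simp: power_le_one l1norm_nonneg)
    finally show "\<bar>?f' t\<bar> \<le> (l1norm y) ^ 3" by simp
  qed auto
  then show ?thesis by simp
qed

text \<open>The trapezoidal rule replaces the usual expansion around one end point, which makes the
  second-order term proportional to \<open>2 q - 1\<close> instead of averaging it out afterwards.\<close>

lemma g1_trapezoid:
  assumes q: "0 \<le> q" "q \<le> 1"
  shows "\<bar>g1 i a - g1 i b - (\<Sum>j\<in>UNIV. (a $ j - b $ j) * (q * g2 i j a + (1 - q) * g2 i j b))\<bar>
    \<le> \<bar>q - (1 - q)\<bar> / 2 * (\<Sum>j\<in>UNIV. \<bar>a $ j - b $ j\<bar>)\<^sup>2 + 5/12 * (\<Sum>j\<in>UNIV. \<bar>a $ j - b $ j\<bar>) ^ 3"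
proof -
  define y where "y = a - b"
  define L where "L = (l1norm y) ^ 3"
  define f where "f t = g1 i (b + t *\<^sub>R y)" for t
  define f1 where "f1 t = (\<Sum>j\<in>UNIV. y $ j * g2 i j (b + t *\<^sub>R y))" for t
  define f2 where "f2 t = (\<Sum>j\<in>UNIV. y $ j * (\<Sum>l\<in>UNIV. y $ l * g3 i j l (b + t *\<^sub>R y)))" for t
  have d1: "(f has_real_derivative f1 t) (at t)" for t
    unfolding f_def f1_def by (intro line_DERIV_from_partials g_pd g2_lip)
  have d2: "(f1 has_real_derivative f2 t) (at t)" for t
    unfolding f1_def f2_def by (intro DERIV_sum DERIV_cmult line_DERIV_from_partials g_pd g3_lip)
  \<comment> \<open>The bound on the fourth partials enters as a Lipschitz bound on the third ones.
    The remainders for \<open>f1\<close> and \<open>f\<close> follow by comparing derivatives, which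
    turns L t into L / 2 and L / 6 at t = 1.\<close>
  have b2: "\<bar>f2 t - f2 0\<bar> \<le> L * t" if "0 \<le> t" for t
  proof -
    have "f2 t - f2 0 = (\<Sum>j\<in>UNIV. y $ j * (\<Sum>l\<in>UNIV. y $ l * (g3 i j l (b + t *\<^sub>R y) - g3 i j l b)))"
      by (simp add: f2_def sum_subtractf right_diff_distrib)
    also have "\<bar>\<dots>\<bar> \<le> l1norm y * (l1norm y * l1norm (t *\<^sub>R y))"
      by (intro abs_sum_mult_le g3_lip)
    finally show ?thesis unfolding l1norm_scaleR using that by (simp add: L_def power3_eq_cube mult_ac)
  qed
  have b1: "\<bar>f1 t - f1 0 - t * f2 0\<bar> \<le> L * t\<^sup>2 / 2" if "0 \<le> t" "t \<le> 1" for t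
  proof -
    have "\<bar>(\<lambda>t. f1 t - t * f2 0) t - (\<lambda>t. f1 t - t * f2 0) 0\<bar> \<le> (\<lambda>t. L * t\<^sup>2 / 2) t - (\<lambda>t. L * t\<^sup>2 / 2) 0"
    proof (rule DERIV_abs_le)
      show "((\<lambda>t. f1 t - t * f2 0) has_real_derivative f2 t - f2 0) (at t)" for t
        by (auto intro!: derivative_eq_intros d2)
      show "((\<lambda>t. L * t\<^sup>2 / 2) has_real_derivative L * t) (at t)" for t
        by (auto intro!: derivative_eq_intros)
    qed (use that b2 in auto)
    then show ?thesis by (simp add: algebra_simps)
  qed
  have b0: "\<bar>f 1 - f 0 - f1 0 - f2 0 / 2\<bar> \<le> L / 6"
  proof -
    let ?f = "\<lambda>t. f t - t * f1 0 - t\<^sup>2 / 2 * f2 0"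
    have "\<bar>?f 1 - ?f 0\<bar> \<le> (\<lambda>t. L * t ^ 3 / 6) 1 - (\<lambda>t. L * t ^ 3 / 6) 0"
    proof (rule DERIV_abs_le)
      show "(?f has_real_derivative f1 t - f1 0 - t * f2 0) (at t)" for t
        by (auto intro!: derivative_eq_intros d1)
      show "((\<lambda>t. L * t ^ 3 / 6) has_real_derivative L * t\<^sup>2 / 2) (at t)" for t
        by (auto intro!: derivative_eq_intros)
    qed (use b1 in auto)
    then show ?thesis by (simp add: algebra_simps)
  qed
  have b1': "\<bar>f1 1 - f1 0 - f2 0\<bar> \<le> L / 2" using b1[of 1] by simp
  \<comment> \<open>This difference is multiplied by \<open>2 q - 1\<close> only, which is why the
    Lipschitz bound on the second partials is enough for it.\<close>
  have m: "\<bar>f1 1 - f1 0\<bar> \<le> (l1norm y)\<^sup>2"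
  proof -
    have "f1 1 - f1 0 = (\<Sum>j\<in>UNIV. y $ j * (g2 i j (b + y) - g2 i j b))"
      by (simp add: f1_def sum_subtractf[symmetric] right_diff_distrib)
    also have "\<bar>\<dots>\<bar> \<le> l1norm y * l1norm y" by (intro abs_sum_mult_le g2_lip)
    finally show ?thesis by (simp add: power2_eq_square)
  qed
  have tri: "\<bar>u - v / 2 - w\<bar> \<le> \<bar>u\<bar> + \<bar>v\<bar> / 2 + \<bar>w\<bar>" for u v w :: real by linarith
  \<comment> \<open>The term \<open>f2 0 / 2\<close> cancels between the Taylor remainder and half
    of the remainder of \<open>f1\<close>; these contribute L / 6 and L / 4, together 5/12 of
    L.\<close>
  have "f 1 - f 0 - (q * f1 1 + (1 - q) * f1 0)
    = (f 1 - f 0 - f1 0 - f2 0 / 2) - (f1 1 - f1 0 - f2 0) / 2 - (q - (1 - q)) / 2 * (f1 1 - f1 0)"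
    by (simp add: field_simps)
  then have "\<bar>f 1 - f 0 - (q * f1 1 + (1 - q) * f1 0)\<bar>
      \<le> \<bar>f 1 - f 0 - f1 0 - f2 0 / 2\<bar> + \<bar>f1 1 - f1 0 - f2 0\<bar> / 2 + \<bar>(q - (1 - q)) / 2 * (f1 1 - f1 0)\<bar>"
    using tri[of "f 1 - f 0 - f1 0 - f2 0 / 2" "f1 1 - f1 0 - f2 0" "(q - (1 - q)) / 2 * (f1 1 - f1 0)"] by simp
  also have "\<dots> \<le> L / 6 + L / 4 + \<bar>q - (1 - q)\<bar> / 2 * (l1norm y)\<^sup>2"
  proof (intro add_mono)
    show "\<bar>(q - (1 - q)) / 2 * (f1 1 - f1 0)\<bar> \<le> \<bar>q - (1 - q)\<bar> / 2 * (l1norm y)\<^sup>2"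
      unfolding abs_mult using m by (intro mult_mono) auto
  qed (use b0 b1' in auto)
  also have "\<dots> = \<bar>q - (1 - q)\<bar> / 2 * (l1norm y)\<^sup>2 + 5/12 * (l1norm y) ^ 3"
    by (simp add: L_def)
  finally have "\<bar>f 1 - f 0 - (q * f1 1 + (1 - q) * f1 0)\<bar>
      \<le> \<bar>q - (1 - q)\<bar> / 2 * (l1norm y)\<^sup>2 + 5/12 * (l1norm y) ^ 3" .
  moreover have "q * f1 1 + (1 - q) * f1 0
      = (\<Sum>j\<in>UNIV. (a $ j - b $ j) * (q * g2 i j a + (1 - q) * g2 i j b))"
    by (simp add: f1_def y_def sum_distrib_left sum.distrib[symmetric] algebra_simps)
  ultimately show ?thesis by (simp add: f_def y_def)
qed

lemma g_continuous: "continuous_on UNIV g" "continuous_on UNIV (g1 i)" "continuous_on UNIV (g2 i j)"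
proof -
  have "continuous_on UNIV h" if "\<And>x y. \<bar>h (x + y) - h x\<bar> \<le> l1norm y" for h :: "real ^ 'd \<Rightarrow> real"
  proof -
    have "(h \<longlongrightarrow> h x) (at x)" for x
    proof (rule Lim_null[THEN iffD2], rule Lim_null_comparison)
      show "((\<lambda>y. l1norm (y - x)) \<longlongrightarrow> 0) (at x)"
        by (auto intro!: tendsto_eq_intros)
      show "\<forall>\<^sub>F y in at x. norm (h y - h x) \<le> l1norm (y - x)"
        using that[of x "_ - x"] by (simp del: vector_minus_component)
    qed
    then show ?thesis by (simp add: continuous_on_eq_continuous_at isCont_def)
  qed
  then show "continuous_on UNIV g" "continuous_on UNIV (g1 i)" "continuous_on UNIV (g2 i j)"
    using g_lip g1_lip g2_lip by blast+
qed

end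

section \<open>Gaussian vectors\<close>

text \<open>A degenerate law with mean zero is concentrated at 0, where all claims are trivial.
  Otherwise the variable is rescaled to a standard normal one, and the real and imaginary parts of
  its characteristic function are read off.\<close>

lemma (in prob_space) centred_normal:
  fixes X :: "'a \<Rightarrow> real"
  assumes [measurable]: "X \<in> borel_measurable M"
    and X: "(\<exists>\<mu>. AE w in M. X w = \<mu>) \<or>
      (\<exists>\<mu> \<sigma>. \<sigma> > 0 \<and> distributed M lborel X (\<lambda>x. ennreal (normal_density \<mu> \<sigma> x)))"
    and mean: "expectation X = 0"
  shows "integrable M (\<lambda>w. \<bar>X w\<bar> ^ k)"
    and "expectation (\<lambda>w. cos (X w)) = exp (- expectation (\<lambda>w. (X w)\<^sup>2) / 2)"
    and "expectation (\<lambda>w. sin (X w)) = 0"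
proof -
  have "integrable M (\<lambda>w. \<bar>X w\<bar> ^ k) \<and>
    expectation (\<lambda>w. cos (X w)) = exp (- expectation (\<lambda>w. (X w)\<^sup>2) / 2) \<and>
    expectation (\<lambda>w. sin (X w)) = 0"
    using X
  proof (elim disjE exE conjE)
    fix \<mu> assume AE: "AE w in M. X w = \<mu>"
    have "expectation X = expectation (\<lambda>_. \<mu>)" using AE by (intro integral_cong_AE) auto
    then have "\<mu> = 0" using mean by (simp add: prob_space)
    then have AE0: "AE w in M. X w = 0" using AE by simp
    have "integrable M (\<lambda>w. \<bar>X w\<bar> ^ k) \<longleftrightarrow> integrable M (\<lambda>_. \<bar>0\<bar> ^ k :: real)"
      using AE0 by (intro integrable_cong_AE) auto
    moreover have "expectation (\<lambda>w. (X w)\<^sup>2) = expectation (\<lambda>w. 0)"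
      using AE0 by (intro integral_cong_AE) auto
    moreover have "expectation (\<lambda>w. cos (X w)) = expectation (\<lambda>w. 1)"
      using AE0 by (intro integral_cong_AE) auto
    moreover have "expectation (\<lambda>w. sin (X w)) = expectation (\<lambda>w. 0)"
      using AE0 by (intro integral_cong_AE) auto
    ultimately show ?thesis by (simp add: prob_space)
  next
    fix \<mu> \<sigma> :: real
    assume \<sigma>: "\<sigma> > 0" and D: "distributed M lborel X (\<lambda>x. ennreal (normal_density \<mu> \<sigma> x))"
    have \<mu>: "\<mu> = 0" using normal_distributed_expectation[OF \<sigma> D] mean by simp
    have int_k: "integrable M (\<lambda>w. \<bar>X w\<bar> ^ k)"
      using distributed_integrable[OF D, of "\<lambda>x. \<bar>x\<bar> ^ k"] integrable_normal_moment_abs[OF \<sigma>, of 0 k]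
      by (simp add: \<mu>)
    have var: "expectation (\<lambda>w. (X w)\<^sup>2) = \<sigma>\<^sup>2"
      using normal_distributed_variance[OF \<sigma> D] mean by simp
    define Y where "Y = (\<lambda>w. X w / \<sigma>)"
    have [measurable]: "Y \<in> borel_measurable M" by (simp add: Y_def)
    have "distributed M lborel Y (\<lambda>x. ennreal (std_normal_density x))"
      using normal_standard_normal_convert[OF \<sigma>, of X \<mu>] D by (simp add: Y_def \<mu>)
    then have dY: "distr M lborel Y = std_normal_distribution"
      by (simp add: distributed_def)
    have "(CLINT w|M. iexp (\<sigma> * Y w)) = (CLINT x|distr M lborel Y. iexp (\<sigma> * x))"
      by (subst integral_distr) auto
    also have "\<dots> = char std_normal_distribution \<sigma>"
      unfolding dY char_def ..
    finally have c: "(CLINT w|M. iexp (X w)) = complex_of_real (exp (- (\<sigma>\<^sup>2) / 2))"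
      using \<sigma> by (simp add: Y_def char_std_normal_distribution)
    have int: "complex_integrable M (\<lambda>w. iexp (X w))"
      by (intro integrable_iexp) auto
    have "expectation (\<lambda>w. cos (X w)) = exp (- (\<sigma>\<^sup>2) / 2)"
      using arg_cong[OF c, of Re] by (subst (asm) integral_Re[OF int, symmetric]) (simp add: Re_exp)
    moreover have "expectation (\<lambda>w. sin (X w)) = 0"
      using arg_cong[OF c, of Im] by (subst (asm) integral_Im[OF int, symmetric]) (simp add: Im_exp)
    ultimately show ?thesis using int_k by (simp add: var)
  qed
  then show "integrable M (\<lambda>w. \<bar>X w\<bar> ^ k)"
    "expectation (\<lambda>w. cos (X w)) = exp (- expectation (\<lambda>w. (X w)\<^sup>2) / 2)"
    "expectation (\<lambda>w. sin (X w)) = 0" by auto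
qed

section \<open>Trigonometric polynomials and equality in law\<close>

text \<open>The free phase \<open>b\<close> includes the sines, and the product-to-sum formula makes
  the set an algebra. Its members are bounded on the whole space, unlike polynomials.\<close>

inductive_set trig_functions :: "('a::euclidean_space \<Rightarrow> real) set" where
  cos: "(\<lambda>x. cos (t \<bullet> x + b)) \<in> trig_functions"
| add: "f \<in> trig_functions \<Longrightarrow> g \<in> trig_functions \<Longrightarrow> (\<lambda>x. f x + g x) \<in> trig_functions"
| cmult: "f \<in> trig_functions \<Longrightarrow> (\<lambda>x. c * f x) \<in> trig_functions"

lemma trig_const: "(\<lambda>x. c) \<in> trig_functions"
  using trig_functions.cmult[OF trig_functions.cos[of 0 0], of c] by simp

lemma trig_sum: "(\<And>i. i \<in> A \<Longrightarrow> f i \<in> trig_functions) \<Longrightarrow> (\<lambda>x. \<Sum>i\<in>A. f i x) \<in> trig_functions"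
  by (induction A rule: infinite_finite_induct) (auto intro: trig_const trig_functions.add)

lemma trig_mult_cos:
  "f \<in> trig_functions \<Longrightarrow> (\<lambda>x. cos (t \<bullet> x + b) * f x) \<in> trig_functions"
proof (induction rule: trig_functions.induct)
  case (cos s c)
  have "(\<lambda>x. cos (t \<bullet> x + b) * cos (s \<bullet> x + c))
      = (\<lambda>x. (1/2) * cos ((t - s) \<bullet> x + (b - c)) + (1/2) * cos ((t + s) \<bullet> x + (b + c)))"
    by (simp add: cos_times_cos inner_diff_left inner_add_left algebra_simps add_divide_distrib)
  then show ?case
    by (rule ssubst) (intro trig_functions.add trig_functions.cmult trig_functions.cos)
next
  case (add f g)
  then show ?case by (simp add: distrib_left trig_functions.add)
next
  case (cmult f c)
  then show ?case using trig_functions.cmult[OF cmult.IH, of c] by (simp add: mult_ac)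
qed

lemma trig_mult: "f \<in> trig_functions \<Longrightarrow> g \<in> trig_functions \<Longrightarrow> (\<lambda>x. f x * g x) \<in> trig_functions"
proof (induction rule: trig_functions.induct)
  case (cos t b)
  then show ?case by (rule trig_mult_cos)
next
  case (add f h)
  then show ?case by (simp add: distrib_right trig_functions.add)
next
  case (cmult f c)
  then show ?case using trig_functions.cmult[OF cmult.IH, of c] by (simp add: mult_ac)
qed

lemma trig_continuous: "f \<in> trig_functions \<Longrightarrow> continuous_on UNIV f"
  by (induction rule: trig_functions.induct) (auto intro!: continuous_intros)

lemma trig_bounded: "f \<in> trig_functions \<Longrightarrow> \<exists>B. \<forall>x. \<bar>f x\<bar> \<le> B"
proof (induction rule: trig_functions.induct)
  case (cos t b)
  show ?case by (intro exI[of _ 1]) auto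
next
  case (add f g)
  then obtain A B where "\<And>x. \<bar>f x\<bar> \<le> A" "\<And>x. \<bar>g x\<bar> \<le> B" by auto
  then have "\<bar>f x + g x\<bar> \<le> A + B" for x by (meson abs_triangle_ineq add_mono order_trans)
  then show ?case by blast
next
  case (cmult f c)
  then obtain A where "\<And>x. \<bar>f x\<bar> \<le> A" by auto
  then have "\<bar>c * f x\<bar> \<le> \<bar>c\<bar> * A" for x by (simp add: abs_mult mult_left_mono)
  then show ?case by blast
qed

lemma trig_polynomial:
  fixes y :: "'a::euclidean_space \<Rightarrow> real ^ 'd::finite"
  assumes y: "\<And>i. (\<lambda>x. y x $ i) \<in> trig_functions"
  shows "real_polynomial_function P \<Longrightarrow> (\<lambda>x. P (y x)) \<in> trig_functions"
proof (induction rule: real_polynomial_function.induct)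
  case (linear f)
  interpret bounded_linear f by fact
  have "f v = (\<Sum>i\<in>UNIV. f (axis i 1) * v $ i)" for v
  proof -
    have "f v = f (\<Sum>i\<in>UNIV. (v $ i) *\<^sub>R axis i 1)" by (simp add: sum_axis)
    then show ?thesis by (simp add: sum scaleR mult.commute)
  qed
  then have "(\<lambda>x. f (y x)) = (\<lambda>x. \<Sum>i\<in>UNIV. f (axis i 1) * y x $ i)"
    by (intro ext)
  then show ?case by (rule ssubst) (rule trig_sum, rule trig_functions.cmult, rule y)
qed (auto intro: trig_const trig_functions.add trig_mult)

text \<open>Equality of characteristic functions in real form: the phases 0 and -pi/2 give the real
  and imaginary parts. The vectors live on different spaces, as a single Gaussian vector is compared
  with a sum of two independent ones.\<close>

locale equal_trig_means = A: prob_space MA + B: prob_space MB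
  for MA :: "'a measure" and MB :: "'b measure" +
  fixes A :: "'a \<Rightarrow> real ^ 'd::finite" and B :: "'b \<Rightarrow> real ^ 'd"
  assumes A_meas [measurable]: "A \<in> borel_measurable MA"
    and B_meas [measurable]: "B \<in> borel_measurable MB"
    and cos_eq: "\<And>t b. (\<integral>w. cos (t \<bullet> A w + b) \<partial>MA) = (\<integral>w. cos (t \<bullet> B w + b) \<partial>MB)"
begin

lemma integrable_bounded:
  fixes f :: "real ^ 'd \<Rightarrow> real"
  assumes "continuous_on UNIV f" "\<And>x. \<bar>f x\<bar> \<le> K"
  shows "integrable MA (\<lambda>w. f (A w))" "integrable MB (\<lambda>w. f (B w))"
proof -
  have [measurable]: "f \<in> borel_measurable borel"
    using assms(1) by (rule borel_measurable_continuous_onI)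
  show "integrable MA (\<lambda>w. f (A w))"
    using assms(2) by (intro A.integrable_const_bound[of _ K]) auto
  show "integrable MB (\<lambda>w. f (B w))"
    using assms(2) by (intro B.integrable_const_bound[of _ K]) auto
qed

lemma trig_eq: "f \<in> trig_functions \<Longrightarrow> (\<integral>w. f (A w) \<partial>MA) = (\<integral>w. f (B w) \<partial>MB)"
proof (induction rule: trig_functions.induct)
  case (add f g)
  obtain K L where K: "\<And>x. \<bar>f x\<bar> \<le> K" and L: "\<And>x. \<bar>g x\<bar> \<le> L"
    using trig_bounded[OF add(1)] trig_bounded[OF add(2)] by auto
  note i = integrable_bounded[OF trig_continuous[OF add(1)] K]
    integrable_bounded[OF trig_continuous[OF add(2)] L]
  show ?case
    by (simp add: Bochner_Integration.integral_add[OF i(1) i(3)]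
        Bochner_Integration.integral_add[OF i(2) i(4)] add.IH)
qed (simp_all add: cos_eq)

text \<open>The substitution \<open>y\<^sub>i = sin (x\<^sub>i / r)\<close> turns polynomials on the cube into trigonometric
  polynomials, so that the Stone-Weierstrass approximation is uniform on the whole space.\<close>

lemma bounded_continuous_eq:
  fixes h :: "real ^ 'd \<Rightarrow> real"
  assumes h: "continuous_on UNIV h" and K: "\<And>x. \<bar>h x\<bar> \<le> K"
  shows "(\<integral>w. h (A w) \<partial>MA) = (\<integral>w. h (B w) \<partial>MB)"
proof -
  define r where "r n = 1 + real n" for n
  define y where "y n x = (\<chi> i. sin (x $ i / r n))" for n and x :: "real ^ 'd"
  define H where "H n z = h (\<chi> i. r n * arcsin (z $ i))" for n z
  define Q where "Q = cbox (\<chi> i. -1) (\<chi> i. (1::real)) \<inter> (UNIV :: (real ^ 'd) set)"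
  have Q: "z \<in> Q \<longleftrightarrow> (\<forall>i. -1 \<le> z $ i \<and> z $ i \<le> 1)" for z by (simp add: Q_def mem_box_cart)
  have yQ: "y n x \<in> Q" for n x by (simp add: Q y_def)
  have r: "r n > 0" for n by (simp add: r_def add_pos_nonneg)
  have Hc: "continuous_on Q (H n)" for n
  proof -
    have "continuous_on Q (\<lambda>z. arcsin (z $ i))" for i
      by (intro continuous_on_arcsin continuous_intros) (auto simp: Q)
    then have "continuous_on Q (\<lambda>z. \<chi> i. r n * arcsin (z $ i))"
      by (intro continuous_on_vec_lambda continuous_on_mult continuous_on_const)
    from continuous_on_compose2[OF h this] show ?thesis by (simp add: H_def[abs_def])
  qed
  have ycont: "continuous_on UNIV (y n)" for n
    unfolding y_def using r[of n] by (intro continuous_intros) auto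
  have Hy: "continuous_on UNIV (\<lambda>x. H n (y n x))" for n
    by (rule continuous_on_compose2[OF Hc ycont]) (use yQ in auto)
  have HyK: "\<bar>H n (y n x)\<bar> \<le> K" for n x by (simp add: H_def K)
  have ytrig: "(\<lambda>x. y n x $ i) \<in> trig_functions" for n i
  proof -
    have "(\<lambda>x. y n x $ i) = (\<lambda>x. cos (axis i (1 / r n) \<bullet> x + (- pi / 2)))"
      by (simp add: y_def inner_axis' cos_diff cos_add fun_eq_iff)
    then show ?thesis by (simp only: trig_functions.cos)
  qed
  have eq: "(\<integral>w. H n (y n (A w)) \<partial>MA) = (\<integral>w. H n (y n (B w)) \<partial>MB)" (is "?a = ?b") for n
  proof -
    have "\<bar>?a - ?b\<bar> \<le> 2 * \<epsilon>" if \<epsilon>: "\<epsilon> > 0" for \<epsilon>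
    proof -
      have "compact Q" by (simp add: Q_def compact_cbox)
      then obtain P where P: "real_polynomial_function P" "\<And>z. z \<in> Q \<Longrightarrow> \<bar>H n z - P z\<bar> < \<epsilon>"
        using Stone_Weierstrass_real_polynomial_function[OF _ Hc \<epsilon>] by blast
      let ?p = "\<lambda>x. P (y n x)"
      have p: "?p \<in> trig_functions" using ytrig P(1) by (rule trig_polynomial)
      obtain C where C: "\<And>x. \<bar>?p x\<bar> \<le> C" using trig_bounded[OF p] by auto
      note ip = integrable_bounded[OF trig_continuous[OF p] C]
      note iH = integrable_bounded[OF Hy[of n] HyK]
      have "\<bar>?a - (\<integral>w. ?p (A w) \<partial>MA)\<bar> \<le> \<epsilon>"
      proof -
        have "\<bar>?a - (\<integral>w. ?p (A w) \<partial>MA)\<bar> = \<bar>\<integral>w. H n (y n (A w)) - ?p (A w) \<partial>MA\<bar>"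
          using ip iH by simp
        also have "\<dots> \<le> (\<integral>w. \<bar>H n (y n (A w)) - ?p (A w)\<bar> \<partial>MA)" by (rule integral_abs_bound)
        also have "\<dots> \<le> (\<integral>w. \<epsilon> \<partial>MA)"
          using ip iH P(2)[OF yQ] by (intro integral_mono) (auto intro: less_imp_le)
        finally show ?thesis by (simp add: A.prob_space)
      qed
      moreover have "\<bar>?b - (\<integral>w. ?p (B w) \<partial>MB)\<bar> \<le> \<epsilon>"
      proof -
        have "\<bar>?b - (\<integral>w. ?p (B w) \<partial>MB)\<bar> = \<bar>\<integral>w. H n (y n (B w)) - ?p (B w) \<partial>MB\<bar>"
          using ip iH by simp
        also have "\<dots> \<le> (\<integral>w. \<bar>H n (y n (B w)) - ?p (B w)\<bar> \<partial>MB)" by (rule integral_abs_bound)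
        also have "\<dots> \<le> (\<integral>w. \<epsilon> \<partial>MB)"
          using ip iH P(2)[OF yQ] by (intro integral_mono) (auto intro: less_imp_le)
        finally show ?thesis by (simp add: B.prob_space)
      qed
      ultimately show ?thesis using trig_eq[OF p] by linarith
    qed
    \<comment> \<open>With \<epsilon> a quarter of the distance the estimate says that the distance
      is at most half of itself, so it vanishes.\<close>
    from this[of "\<bar>?a - ?b\<bar> / 4"] show ?thesis by force
  qed
  \<comment> \<open>Once every coordinate of \<open>x\<close> is at most \<open>r n\<close> in size,
    the sine is inverted exactly by \<open>arcsin\<close>, so the sequence is eventually
    constant.\<close>
  have ev: "(\<lambda>n. H n (y n x)) \<longlonglongrightarrow> h x" for x
  proof (rule tendsto_eventually)
    have "eventually (\<lambda>n. \<forall>i. \<bar>x $ i / r n\<bar> \<le> pi / 2) sequentially"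
    proof -
      obtain n0 where n0: "norm x \<le> real n0" using real_arch_simple by blast
      show ?thesis
      proof (rule eventually_sequentiallyI[of n0], intro allI)
        fix n i assume "n0 \<le> n"
        have "\<bar>x $ i\<bar> \<le> norm x" by (rule component_le_norm_cart)
        also have "\<dots> \<le> r n" using n0 \<open>n0 \<le> n\<close> by (simp add: r_def)
        finally have "\<bar>x $ i / r n\<bar> \<le> 1" using r[of n] by simp
        also have "1 \<le> pi / 2" using pi_ge_two by simp
        finally show "\<bar>x $ i / r n\<bar> \<le> pi / 2" .
      qed
    qed
    then show "\<forall>\<^sub>F n in sequentially. H n (y n x) = h x"
    proof eventually_elim
      case (elim n)
      have "r n * arcsin (sin (x $ i / r n)) = x $ i" for i
      proof -
        have "- (pi / 2) \<le> x $ i / r n" "x $ i / r n \<le> pi / 2"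
          using spec[OF elim, of i] unfolding abs_le_iff by linarith+
        then show ?thesis using r[of n] by (simp add: arcsin_sin)
      qed
      then show ?case by (simp add: H_def y_def)
    qed
  qed
  have [measurable]: "h \<in> borel_measurable borel" "\<And>n. (\<lambda>x. H n (y n x)) \<in> borel_measurable borel"
    using h Hy by (auto intro: borel_measurable_continuous_onI)
  have "(\<lambda>n. \<integral>w. H n (y n (A w)) \<partial>MA) \<longlonglongrightarrow> (\<integral>w. h (A w) \<partial>MA)"
    by (rule integral_dominated_convergence[where w = "\<lambda>_. K"]) (use ev HyK in auto)
  moreover have "(\<lambda>n. \<integral>w. H n (y n (A w)) \<partial>MA) \<longlonglongrightarrow> (\<integral>w. h (B w) \<partial>MB)"
    unfolding eq
    by (rule integral_dominated_convergence[where w = "\<lambda>_. K"]) (use ev HyK in auto)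
  ultimately show ?thesis by (rule LIMSEQ_unique)
qed

text \<open>Truncation at the levels -n and n reduces the claim to bounded functions; the
  truncations are dominated by the absolute value of \<open>h\<close>.\<close>

lemma continuous_eq:
  fixes h :: "real ^ 'd \<Rightarrow> real"
  assumes h: "continuous_on UNIV h"
    and int: "integrable MA (\<lambda>w. h (A w))" "integrable MB (\<lambda>w. h (B w))"
  shows "(\<integral>w. h (A w) \<partial>MA) = (\<integral>w. h (B w) \<partial>MB)"
proof -
  define k where "k n x = max (- real n) (min (real n) (h x))" for n x
  have kc: "continuous_on UNIV (k n)" for n
    unfolding k_def by (intro continuous_intros h)
  have kb: "\<bar>k n x\<bar> \<le> real n" "\<bar>k n x\<bar> \<le> \<bar>h x\<bar>" for n x by (auto simp: k_def)
  have lim: "(\<lambda>n. k n x) \<longlonglongrightarrow> h x" for x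
  proof (rule tendsto_eventually)
    obtain n0 where n0: "\<bar>h x\<bar> \<le> real n0" using real_arch_simple by blast
    show "\<forall>\<^sub>F n in sequentially. k n x = h x"
      by (rule eventually_sequentiallyI[of n0]) (use n0 in \<open>auto simp: k_def\<close>)
  qed
  have [measurable]: "h \<in> borel_measurable borel" "\<And>n. k n \<in> borel_measurable borel"
    using h kc by (auto intro: borel_measurable_continuous_onI)
  have "(\<lambda>n. \<integral>w. k n (A w) \<partial>MA) \<longlonglongrightarrow> (\<integral>w. h (A w) \<partial>MA)"
    by (rule integral_dominated_convergence[where w = "\<lambda>w. \<bar>h (A w)\<bar>"]) (use int lim kb in auto)
  moreover have "(\<lambda>n. \<integral>w. k n (B w) \<partial>MB) \<longlonglongrightarrow> (\<integral>w. h (B w) \<partial>MB)"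
    by (rule integral_dominated_convergence[where w = "\<lambda>w. \<bar>h (B w)\<bar>"]) (use int lim kb in auto)
  ultimately show ?thesis
    unfolding bounded_continuous_eq[OF kc kb(1)] by (rule LIMSEQ_unique)
qed

end

section \<open>Moments and stability of a centred Gaussian vector\<close>

locale centred_gaussian = prob_space M for M :: "'b measure" +
  fixes N :: "'b \<Rightarrow> real ^ 'd::finite" and \<Sigma> :: "real ^ 'd ^ 'd"
  assumes gauss: "gaussian_random_vector M N"
    and mean: "\<And>i. (\<integral>w. N w $ i \<partial>M) = 0"
    and cov: "\<And>i j. covariance M (\<lambda>w. N w $ i) (\<lambda>w. N w $ j) = \<Sigma> $ i $ j"
begin

lemma N_meas [measurable]: "N \<in> borel_measurable M"
  using gauss by (simp add: gaussian_random_vector_def)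

lemma N_component_meas [measurable]: "(\<lambda>w. N w $ i) \<in> borel_measurable M"
  by (rule measurable_compose[OF N_meas])
     (intro borel_measurable_continuous_onI continuous_intros)

lemma linear_law: "(\<exists>\<mu>. AE w in M. t \<bullet> N w = \<mu>) \<or>
      (\<exists>\<mu> \<sigma>. \<sigma> > 0 \<and> distributed M lborel (\<lambda>w. t \<bullet> N w) (\<lambda>x. ennreal (normal_density \<mu> \<sigma> x)))"
  using gauss by (auto simp: gaussian_random_vector_def)

lemma integrable_component_power: "integrable M (\<lambda>w. \<bar>N w $ i\<bar> ^ k)"
  using centred_normal(1)[of "\<lambda>w. axis i 1 \<bullet> N w" k] linear_law[of "axis i 1"] mean[of i]
  by (simp add: inner_axis')

lemma integrable_component: "integrable M (\<lambda>w. N w $ i)"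
  using integrable_component_power[of i 1] integrable_abs_cancel[of M "\<lambda>w. N w $ i"] by simp

lemma integrable_component_mult: "integrable M (\<lambda>w. N w $ i * N w $ j)"
proof (rule Bochner_Integration.integrable_bound)
  show "integrable M (\<lambda>w. \<bar>N w $ i\<bar> ^ 2 + \<bar>N w $ j\<bar> ^ 2)"
    by (intro Bochner_Integration.integrable_add integrable_component_power)
  have "\<bar>x * y\<bar> \<le> \<bar>x\<bar> ^ 2 + \<bar>y\<bar> ^ 2" for x y :: real
    using sum_squares_bound[of "\<bar>x\<bar>" "\<bar>y\<bar>"] mult_nonneg_nonneg[of "\<bar>x\<bar>" "\<bar>y\<bar>"]
    unfolding abs_mult by linarith
  then show "AE w in M. norm (N w $ i * N w $ j) \<le> norm (\<bar>N w $ i\<bar> ^ 2 + \<bar>N w $ j\<bar> ^ 2)"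
    by simp
qed simp

lemma cov': "(\<integral>w. N w $ i * N w $ j \<partial>M) = \<Sigma> $ i $ j"
  using cov[of i j] by (simp add: covariance_def mean)

lemma integrable_l1: "integrable M (\<lambda>w. l1norm (N w))"
  by (intro Bochner_Integration.integrable_sum integrable_abs integrable_component)

lemma integrable_l1_cube: "integrable M (\<lambda>w. (l1norm (N w)) ^ 3)"
proof -
  have l1_4: "(l1norm y) ^ 3 \<le> 1 + (real CARD('d)) ^ 3 * (\<Sum>i\<in>UNIV. \<bar>y $ i\<bar> ^ 3)" for y :: "real ^ 'd"
  proof -
    define m where "m = Max (range (\<lambda>i. \<bar>y $ i\<bar>))"
    have m: "\<bar>y $ i\<bar> \<le> m" for i by (simp add: m_def)
    have "m \<in> range (\<lambda>i. \<bar>y $ i\<bar>)" unfolding m_def by (rule Max_in) auto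
    then obtain i0 where i0: "m = \<bar>y $ i0\<bar>" by auto
    have "(l1norm y) ^ 3 \<le> (real CARD('d) * m) ^ 3"
      using sum_bounded_above[of UNIV "\<lambda>i. \<bar>y $ i\<bar>" m] m by (intro power_mono l1norm_nonneg) auto
    also have "\<dots> = (real CARD('d)) ^ 3 * m ^ 3" by (simp add: power_mult_distrib)
    also have "m ^ 3 \<le> (\<Sum>i\<in>UNIV. \<bar>y $ i\<bar> ^ 3)"
      unfolding i0 by (rule member_le_sum) auto
    finally show ?thesis by (simp add: mult_left_mono)
  qed
  show ?thesis
  proof (rule Bochner_Integration.integrable_bound)
    show "integrable M (\<lambda>w. 1 + (real CARD('d)) ^ 3 * (\<Sum>i\<in>UNIV. \<bar>N w $ i\<bar> ^ 3))"
      by (intro Bochner_Integration.integrable_add integrable_mult_right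
          Bochner_Integration.integrable_sum integrable_component_power) auto
    show "AE w in M. norm ((l1norm (N w)) ^ 3) \<le> norm (1 + (real CARD('d)) ^ 3 * (\<Sum>i\<in>UNIV. \<bar>N w $ i\<bar> ^ 3))"
    proof (intro AE_I2)
      fix w
      have "norm ((l1norm (N w)) ^ 3) = (l1norm (N w)) ^ 3" by (simp add: sum_nonneg)
      also note l1_4
      also have "1 + (real CARD('d)) ^ 3 * (\<Sum>i\<in>UNIV. \<bar>N w $ i\<bar> ^ 3) 
        \<le> norm (1 + (real CARD('d)) ^ 3 * (\<Sum>i\<in>UNIV. \<bar>N w $ i\<bar> ^ 3))" by simp
      finally show "norm ((l1norm (N w)) ^ 3) \<le> norm (1 + (real CARD('d)) ^ 3 * (\<Sum>i\<in>UNIV. \<bar>N w $ i\<bar> ^ 3))" .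
    qed
  qed measurable
qed

definition quad where "quad t = (\<Sum>i\<in>UNIV. \<Sum>j\<in>UNIV. t $ i * t $ j * \<Sigma> $ i $ j)"

lemma expectation_inner: "(\<integral>w. t \<bullet> N w \<partial>M) = 0"
  by (simp add: inner_vec_def Bochner_Integration.integral_sum integrable_component mean)

lemma expectation_inner_square: "(\<integral>w. (t \<bullet> N w)\<^sup>2 \<partial>M) = quad t"
proof -
  have "(\<lambda>w. (t \<bullet> N w)\<^sup>2) = (\<lambda>w. \<Sum>i\<in>UNIV. \<Sum>j\<in>UNIV. (t $ i * t $ j) * (N w $ i * N w $ j))"
    by (simp add: inner_vec_def power2_eq_square sum_product mult_ac)
  then show ?thesis
    by (simp only: quad_def) (simp add: Bochner_Integration.integral_sum integrable_component_mult cov')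
qed

lemma cos_mean: "(\<integral>w. cos (t \<bullet> N w + b) \<partial>M) = cos b * exp (- quad t / 2)"
proof -
  note c = centred_normal[of "\<lambda>w. t \<bullet> N w", OF _ linear_law expectation_inner]
  have i: "integrable M (\<lambda>w. cos (t \<bullet> N w))" "integrable M (\<lambda>w. sin (t \<bullet> N w))"
    by (auto intro!: integrable_const_bound[of _ 1])
  have "(\<integral>w. cos (t \<bullet> N w + b) \<partial>M) = (\<integral>w. cos (t \<bullet> N w) * cos b - sin (t \<bullet> N w) * sin b \<partial>M)"
    by (simp add: cos_add)
  also have "\<dots> = (\<integral>w. cos (t \<bullet> N w) \<partial>M) * cos b - (\<integral>w. sin (t \<bullet> N w) \<partial>M) * sin b"
    using i by simp
  finally show ?thesis using c(2,3) by (simp add: expectation_inner_square)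
qed

lemma quad_scale: "quad (c *\<^sub>R t) = c\<^sup>2 * quad t"
  by (simp add: quad_def sum_distrib_left power2_eq_square mult_ac)

sublocale pair: pair_prob_space M M ..

text \<open>Characteristic functions of independent summands multiply, and the quadratic form of the
  covariance scales with the square of the factor, so the variances v and \<delta> add up.
  Degenerate covariances are included.\<close>

lemma gaussian_stable:
  assumes v: "0 \<le> v" "0 \<le> \<delta>"
  shows "equal_trig_means M (M \<Otimes>\<^sub>M M) (\<lambda>w. sqrt (v + \<delta>) *\<^sub>R N w)
    (\<lambda>(w, w'). sqrt v *\<^sub>R N w + sqrt \<delta> *\<^sub>R N w')"
proof
  fix t :: "real ^ 'd" and b :: real
  have 1: "(\<integral>w. cos (t \<bullet> (sqrt (v + \<delta>) *\<^sub>R N w) + b) \<partial>M) = cos b * exp (- ((v + \<delta>) * quad t) / 2)"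
    using cos_mean[of "sqrt (v + \<delta>) *\<^sub>R t" b] v by (simp add: quad_scale)
  have int: "integrable (M \<Otimes>\<^sub>M M) (\<lambda>(w, w'). cos (t \<bullet> (sqrt v *\<^sub>R N w + sqrt \<delta> *\<^sub>R N w') + b))"
    by (rule pair.P.integrable_const_bound[of _ 1]) (auto simp: split_beta')
  have "(\<integral>z. cos (t \<bullet> (case z of (w, w') \<Rightarrow> sqrt v *\<^sub>R N w + sqrt \<delta> *\<^sub>R N w') + b) \<partial>(M \<Otimes>\<^sub>M M))
    = (\<integral>w. \<integral>w'. cos (t \<bullet> (sqrt v *\<^sub>R N w + sqrt \<delta> *\<^sub>R N w') + b) \<partial>M \<partial>M)"
    using pair.integral_fst'[OF int] by (simp add: split_beta')
  also have "\<dots> = (\<integral>w. cos ((sqrt v *\<^sub>R t) \<bullet> N w + b) * exp (- (\<delta> * quad t) / 2) \<partial>M)"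
  proof (rule Bochner_Integration.integral_cong)
    fix w
    show "(\<integral>w'. cos (t \<bullet> (sqrt v *\<^sub>R N w + sqrt \<delta> *\<^sub>R N w') + b) \<partial>M)
      = cos ((sqrt v *\<^sub>R t) \<bullet> N w + b) * exp (- (\<delta> * quad t) / 2)"
      using cos_mean[of "sqrt \<delta> *\<^sub>R t" "(sqrt v *\<^sub>R t) \<bullet> N w + b"] v
      by (simp add: quad_scale inner_add_right algebra_simps)
  qed simp
  also have "\<dots> = cos b * exp (- ((v + \<delta>) * quad t) / 2)"
    using cos_mean[of "sqrt v *\<^sub>R t" b] v
    by (simp add: quad_scale exp_add[symmetric] add_divide_distrib distrib_right)
  finally show "(\<integral>w. cos (t \<bullet> (sqrt (v + \<delta>) *\<^sub>R N w) + b) \<partial>M) =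
    (\<integral>z. cos (t \<bullet> (case z of (w, w') \<Rightarrow> sqrt v *\<^sub>R N w + sqrt \<delta> *\<^sub>R N w') + b) \<partial>(M \<Otimes>\<^sub>M M))"
    unfolding 1 by simp
qed (simp_all add: split_beta')

end

section \<open>Gaussian smoothing of a test function\<close>

locale gaussian_smoothing = centred_gaussian M N \<Sigma> + d4_test g
  for M :: "'b measure" and N :: "'b \<Rightarrow> real ^ 'd::finite" and \<Sigma> and g :: "real ^ 'd \<Rightarrow> real"
begin

text \<open>The parameter \<open>v\<close> is a variance and not a standard deviation: variances add
  under independent sums, and the resulting heat equation has constant coefficients.\<close>

definition U0 where "U0 v x = (\<integral>w. g (x + sqrt v *\<^sub>R N w) \<partial>M)"
definition U1 where "U1 i v x = (\<integral>w. g1 i (x + sqrt v *\<^sub>R N w) \<partial>M)"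
definition U2 where "U2 i j v x = (\<integral>w. g2 i j (x + sqrt v *\<^sub>R N w) \<partial>M)"

lemma g_meas [measurable]: "g \<in> borel_measurable borel" "g1 i \<in> borel_measurable borel"
    "g2 i j \<in> borel_measurable borel"
  using g_continuous by (auto intro: borel_measurable_continuous_onI)

lemma g_int: "integrable M (\<lambda>w. g (x + c *\<^sub>R N w))"
proof (rule Bochner_Integration.integrable_bound)
  show "integrable M (\<lambda>w. \<bar>g x\<bar> + \<bar>c\<bar> * l1norm (N w))"
    by (intro Bochner_Integration.integrable_add integrable_mult_right integrable_l1) auto
  show "AE w in M. norm (g (x + c *\<^sub>R N w)) \<le> norm (\<bar>g x\<bar> + \<bar>c\<bar> * l1norm (N w))"
  proof (intro AE_I2)
    fix w
    have "\<bar>g (x + c *\<^sub>R N w) - g x\<bar> \<le> \<bar>c\<bar> * l1norm (N w)"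
      using g_lip[of x "c *\<^sub>R N w"] unfolding l1norm_scaleR .
    then show "norm (g (x + c *\<^sub>R N w)) \<le> norm (\<bar>g x\<bar> + \<bar>c\<bar> * l1norm (N w))" by simp
  qed
qed simp

lemma g1_int: "integrable M (\<lambda>w. g1 i (x + c *\<^sub>R N w))"
  using g1_bound by (intro integrable_const_bound[of _ 1]) auto
lemma g2_int: "integrable M (\<lambda>w. g2 i j (x + c *\<^sub>R N w))"
  using g2_bound by (intro integrable_const_bound[of _ 1]) auto

lemma abs_integral_le:
  fixes f h :: "'b \<Rightarrow> real"
  assumes "integrable M f" "integrable M h" "\<And>w. \<bar>f w\<bar> \<le> h w"
  shows "\<bar>\<integral>w. f w \<partial>M\<bar> \<le> (\<integral>w. h w \<partial>M)"
proof -
  have "\<bar>\<integral>w. f w \<partial>M\<bar> \<le> (\<integral>w. \<bar>f w\<bar> \<partial>M)" by (rule integral_abs_bound)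
  also have "\<dots> \<le> (\<integral>w. h w \<partial>M)"
    by (intro integral_mono integrable_abs assms)
  finally show ?thesis .
qed

lemma abs_integral_le_const:
  fixes f :: "'b \<Rightarrow> real"
  assumes "integrable M f" "\<And>w. \<bar>f w\<bar> \<le> c"
  shows "\<bar>\<integral>w. f w \<partial>M\<bar> \<le> c"
  using abs_integral_le[of f "\<lambda>_. c"] assms by (simp add: prob_space)

lemma U2_bound: "\<bar>U2 i j v x\<bar> \<le> 1"
  unfolding U2_def by (intro abs_integral_le_const g2_int g2_bound)

text \<open>The estimate for \<open>g1\<close> is linear in the test function and uniform over
  translates, so averaging over Gaussian translates keeps its constants. Thus \<open>U1\<close> and
  \<open>U2\<close> can serve as \<open>h1\<close> and \<open>h2\<close> in
  \<open>stein_interpolation\<close>.\<close>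

lemma U1_trapezoid:
  assumes q: "0 \<le> q" "q \<le> 1"
  shows "\<bar>U1 i v a - U1 i v b - (\<Sum>j\<in>UNIV. (a $ j - b $ j) * (q * U2 i j v a + (1 - q) * U2 i j v b))\<bar>
    \<le> \<bar>q - (1 - q)\<bar> / 2 * (\<Sum>j\<in>UNIV. \<bar>a $ j - b $ j\<bar>)\<^sup>2 + 5/12 * (\<Sum>j\<in>UNIV. \<bar>a $ j - b $ j\<bar>) ^ 3"
proof -
  let ?n = "\<lambda>w. sqrt v *\<^sub>R N w"
  let ?f = "\<lambda>w. g1 i (a + ?n w) - g1 i (b + ?n w)
    - (\<Sum>j\<in>UNIV. (a $ j - b $ j) * (q * g2 i j (a + ?n w) + (1 - q) * g2 i j (b + ?n w)))"
  have i: "integrable M ?f"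
    by (intro Bochner_Integration.integrable_diff Bochner_Integration.integrable_sum
        Bochner_Integration.integrable_add integrable_mult_right g1_int g2_int)
  have "\<bar>U1 i v a - U1 i v b - (\<Sum>j\<in>UNIV. (a $ j - b $ j) * (q * U2 i j v a + (1 - q) * U2 i j v b))\<bar> = \<bar>(\<integral>w. ?f w \<partial>M)\<bar>"
    unfolding U1_def U2_def
    by (simp add: Bochner_Integration.integral_sum Bochner_Integration.integral_diff g1_int g2_int)
  also have "\<dots> \<le> \<bar>q - (1 - q)\<bar> / 2 * (\<Sum>j\<in>UNIV. \<bar>a $ j - b $ j\<bar>)\<^sup>2 + 5/12 * (\<Sum>j\<in>UNIV. \<bar>a $ j - b $ j\<bar>) ^ 3"
  proof (rule abs_integral_le_const[OF i])
    show "\<bar>?f w\<bar> \<le> \<bar>q - (1 - q)\<bar> / 2 * (\<Sum>j\<in>UNIV. \<bar>a $ j - b $ j\<bar>)\<^sup>2 + 5/12 * (\<Sum>j\<in>UNIV. \<bar>a $ j - b $ j\<bar>) ^ 3" for w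
      using g1_trapezoid[OF q, of i "a + ?n w" "b + ?n w"] by (simp del: scaleR_conv_of_real)
  qed
  finally show ?thesis .
qed

lemma U0_lip: "\<bar>U0 v (x + y) - U0 v x\<bar> \<le> l1norm y"
proof -
  have "\<bar>U0 v (x + y) - U0 v x\<bar> = \<bar>(\<integral>w. g ((x + sqrt v *\<^sub>R N w) + y) - g (x + sqrt v *\<^sub>R N w) \<partial>M)\<bar>"
    unfolding U0_def using g_int[of "x + y" "sqrt v"] g_int[of x "sqrt v"] by (simp add: algebra_simps)
  also have "\<dots> \<le> l1norm y"
    using g_int[of "x + y" "sqrt v"] g_int[of x "sqrt v"]
    by (intro abs_integral_le_const g_lip) (simp add: algebra_simps)
  finally show ?thesis .
qed

lemma U0_first_order:
  "\<bar>U0 v (x + y) - U0 v x - (\<Sum>i\<in>UNIV. y $ i * U1 i v x)\<bar> \<le> (l1norm y)\<^sup>2"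
proof -
  let ?f = "\<lambda>w. g ((x + sqrt v *\<^sub>R N w) + y) - g (x + sqrt v *\<^sub>R N w)
    - (\<Sum>i\<in>UNIV. y $ i * g1 i (x + sqrt v *\<^sub>R N w))"
  have gi: "integrable M (\<lambda>w. g ((x + sqrt v *\<^sub>R N w) + y))"
    using g_int[of "x + y" "sqrt v"] by (simp add: algebra_simps)
  have i: "integrable M ?f"
    by (intro Bochner_Integration.integrable_diff Bochner_Integration.integrable_sum
        integrable_mult_right gi g_int g1_int)
  have "\<bar>U0 v (x + y) - U0 v x - (\<Sum>i\<in>UNIV. y $ i * U1 i v x)\<bar> = \<bar>(\<integral>w. ?f w \<partial>M)\<bar>"
  proof -
    have "U0 v (x + y) = (\<integral>w. g ((x + sqrt v *\<^sub>R N w) + y) \<partial>M)"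
      by (simp add: U0_def algebra_simps)
    then show ?thesis unfolding U1_def
      by (simp add: U0_def gi g_int g1_int)
  qed
  also have "\<dots> \<le> (l1norm y)\<^sup>2"
    by (intro abs_integral_le_const i g_first_order)
  finally show ?thesis .
qed

definition L1 where "L1 = (\<integral>w. l1norm (N w) \<partial>M)"
definition L3 where "L3 = (\<integral>w. (l1norm (N w)) ^ 3 \<partial>M)"

lemma L1_nonneg: "0 \<le> L1" unfolding L1_def by (intro Bochner_Integration.integral_nonneg) (simp add: sum_nonneg)

lemma sqrt_diff_le: "0 \<le> v \<Longrightarrow> 0 \<le> u \<Longrightarrow> \<bar>sqrt v - sqrt u\<bar> \<le> sqrt \<bar>v - u\<bar>"
proof -
  have "sqrt v - sqrt u \<le> sqrt (v - u)" if "0 \<le> u" "u \<le> v" for v u :: real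
    using sqrt_add_le_add_sqrt[of "v - u" u] that by simp
  then show "0 \<le> v \<Longrightarrow> 0 \<le> u \<Longrightarrow> \<bar>sqrt v - sqrt u\<bar> \<le> sqrt \<bar>v - u\<bar>"
    by (cases "u \<le> v") (auto simp: abs_real_def)
qed

text \<open>In terms of the variance the scaling \<open>sqrt v\<close> is Hoelder continuous of
  order 1/2, also at 0. This exponent recurs in all remainders below.\<close>

lemma variance_modulus:
  assumes f: "\<And>x y. \<bar>f (x + y) - f x\<bar> \<le> l1norm y"
    and i: "\<And>x c. integrable M (\<lambda>w. f (x + c *\<^sub>R N w))"
    and v: "0 \<le> v" "0 \<le> u"
  shows "\<bar>(\<integral>w. f (x + sqrt v *\<^sub>R N w) \<partial>M) - (\<integral>w. f (x + sqrt u *\<^sub>R N w) \<partial>M)\<bar> \<le> L1 * sqrt \<bar>v - u\<bar>"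
proof -
  have "\<bar>(\<integral>w. f (x + sqrt v *\<^sub>R N w) \<partial>M) - (\<integral>w. f (x + sqrt u *\<^sub>R N w) \<partial>M)\<bar> = \<bar>(\<integral>w. f (x + sqrt v *\<^sub>R N w) - f (x + sqrt u *\<^sub>R N w) \<partial>M)\<bar>" by (simp add: i)
  also have "\<dots> \<le> (\<integral>w. \<bar>sqrt v - sqrt u\<bar> * l1norm (N w) \<partial>M)"
  proof (rule abs_integral_le)
    show "\<bar>f (x + sqrt v *\<^sub>R N w) - f (x + sqrt u *\<^sub>R N w)\<bar> \<le> \<bar>sqrt v - sqrt u\<bar> * l1norm (N w)" for w
      using f[of "x + sqrt u *\<^sub>R N w" "(sqrt v - sqrt u) *\<^sub>R N w"] unfolding l1norm_scaleR
      by (simp add: scaleR_left_diff_distrib)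
  qed (auto intro!: integrable_l1 i)
  also have "\<dots> = \<bar>sqrt v - sqrt u\<bar> * L1" by (simp add: L1_def)
  also have "\<dots> \<le> sqrt \<bar>v - u\<bar> * L1" using sqrt_diff_le[OF v] L1_nonneg by (rule mult_right_mono)
  finally show ?thesis by (simp add: mult.commute)
qed

section \<open>The heat equation in the variance parameter\<close>

text \<open>Half the trace of \<Sigma> times the Hessian: the generator of Brownian motion with
  covariance \<Sigma>, applied to the smoothed function.\<close>

definition lap where "lap v x = 1/2 * (\<Sum>i\<in>UNIV. \<Sum>j\<in>UNIV. \<Sigma> $ i $ j * U2 i j v x)"
definition S1 where "S1 = 1/2 * (\<Sum>i\<in>UNIV. \<Sum>j\<in>UNIV. \<bar>\<Sigma> $ i $ j\<bar>)"

lemma S1_nonneg: "0 \<le> S1" by (simp add: S1_def sum_nonneg)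

lemma lap_diff_le:
  assumes "\<And>i j. \<bar>U2 i j v x - U2 i j u y\<bar> \<le> c"
  shows "\<bar>lap v x - lap u y\<bar> \<le> S1 * c"
proof -
  have "\<bar>lap v x - lap u y\<bar> = \<bar>1/2 * (\<Sum>i\<in>UNIV. \<Sum>j\<in>UNIV. \<Sigma> $ i $ j * (U2 i j v x - U2 i j u y))\<bar>"
    by (simp add: lap_def right_diff_distrib sum_subtractf)
  also have "\<dots> \<le> 1/2 * (\<Sum>i\<in>UNIV. \<Sum>j\<in>UNIV. \<bar>\<Sigma> $ i $ j\<bar> * c)"
    unfolding abs_mult using assms
    by (intro mult_mono order_trans[OF sum_abs] sum_mono) (auto simp: abs_mult intro!: mult_left_mono sum_nonneg order_trans[OF abs_ge_zero assms])
  finally show ?thesis by (simp add: S1_def sum_distrib_right)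
qed

text \<open>By stability, the additional variance \<delta> is an independent small step from each
  point. In the second-order expansion of that step the linear term vanishes by centring, the
  quadratic one produces the covariance, and the cubic remainder is of order 3/2 in
  \<delta>.\<close>

lemma heat_forward:
  assumes v: "0 \<le> v" "0 \<le> \<delta>"
  shows "\<bar>U0 (v + \<delta>) x - U0 v x - \<delta> * lap v x\<bar> \<le> L3 * (\<delta> * sqrt \<delta>)"
proof -
  let ?Z = "\<lambda>w. x + sqrt v *\<^sub>R N w"
  interpret E: equal_trig_means M "M \<Otimes>\<^sub>M M" "\<lambda>w. sqrt (v + \<delta>) *\<^sub>R N w"
    "\<lambda>(w, w'). sqrt v *\<^sub>R N w + sqrt \<delta> *\<^sub>R N w'"
    using v by (rule gaussian_stable)
  \<comment> \<open>Fubini's theorem asks for joint integrability; it comes from the linear growth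
    of the Lipschitz function \<open>g\<close>.\<close>
  have int_pair: "integrable (M \<Otimes>\<^sub>M M) (\<lambda>(w, w'). g (?Z w + sqrt \<delta> *\<^sub>R N w'))"
  proof (rule pair.Fubini_integrable)
    have m: "(\<lambda>w. \<integral>w'. norm (case (w, w') of (w, w') \<Rightarrow> g (?Z w + sqrt \<delta> *\<^sub>R N w')) \<partial>M) \<in> borel_measurable M"
      by measurable
    show "integrable M (\<lambda>w. \<integral>w'. norm (case (w, w') of (w, w') \<Rightarrow> g (?Z w + sqrt \<delta> *\<^sub>R N w')) \<partial>M)"
    proof (rule Bochner_Integration.integrable_bound[OF _ m])
      show "integrable M (\<lambda>w. \<bar>g (?Z w)\<bar> + sqrt \<delta> * L1)"
        by (intro Bochner_Integration.integrable_add integrable_abs g_int) simp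
      show "AE w in M. norm (\<integral>w'. norm (case (w, w') of (w, w') \<Rightarrow> g (?Z w + sqrt \<delta> *\<^sub>R N w')) \<partial>M)
         \<le> norm (\<bar>g (?Z w)\<bar> + sqrt \<delta> * L1)"
      proof (intro AE_I2)
        fix w
        have "\<bar>\<integral>w'. \<bar>g (?Z w + sqrt \<delta> *\<^sub>R N w')\<bar> \<partial>M\<bar> \<le> (\<integral>w'. \<bar>g (?Z w)\<bar> + sqrt \<delta> * l1norm (N w') \<partial>M)"
        proof (rule abs_integral_le)
          show "\<bar>\<bar>g (?Z w + sqrt \<delta> *\<^sub>R N w')\<bar>\<bar> \<le> \<bar>g (?Z w)\<bar> + sqrt \<delta> * l1norm (N w')" for w'
            using g_lip[of "?Z w" "sqrt \<delta> *\<^sub>R N w'"] v(2) unfolding l1norm_scaleR by simp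
        qed (auto intro!: integrable_l1 g_int)
        also have "\<dots> = \<bar>g (?Z w)\<bar> + sqrt \<delta> * L1"
          by (simp add: L1_def integrable_l1 prob_space)
        finally show "norm (\<integral>w'. norm (case (w, w') of (w, w') \<Rightarrow> g (?Z w + sqrt \<delta> *\<^sub>R N w')) \<partial>M)
         \<le> norm (\<bar>g (?Z w)\<bar> + sqrt \<delta> * L1)" by simp
      qed
    qed
    show "AE w in M. integrable M (\<lambda>w'. case (w, w') of (w, w') \<Rightarrow> g (?Z w + sqrt \<delta> *\<^sub>R N w'))"
      by (simp add: g_int)
  qed measurable
  have "U0 (v + \<delta>) x = (\<integral>z. g (x + (case z of (w, w') \<Rightarrow> sqrt v *\<^sub>R N w + sqrt \<delta> *\<^sub>R N w')) \<partial>(M \<Otimes>\<^sub>M M))"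
    unfolding U0_def
  proof (rule E.continuous_eq)
    show "continuous_on UNIV (\<lambda>y. g (x + y))"
      by (intro continuous_on_compose2[OF g_continuous(1)] continuous_intros) auto
    show "integrable (M \<Otimes>\<^sub>M M) (\<lambda>z. g (x + (case z of (w, w') \<Rightarrow> sqrt v *\<^sub>R N w + sqrt \<delta> *\<^sub>R N w')))"
      using int_pair by (simp add: split_beta' add.assoc)
  qed (rule g_int)
  also have "\<dots> = (\<integral>w. \<integral>w'. g (?Z w + sqrt \<delta> *\<^sub>R N w') \<partial>M \<partial>M)"
    using pair.integral_fst'[OF int_pair] by (simp add: split_beta' add.assoc)
  finally have U: "U0 (v + \<delta>) x = (\<integral>w. \<integral>w'. g (?Z w + sqrt \<delta> *\<^sub>R N w') \<partial>M \<partial>M)" .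
  have int_inner: "integrable M (\<lambda>w. \<integral>w'. g (?Z w + sqrt \<delta> *\<^sub>R N w') \<partial>M)"
    using pair.integrable_fst'[OF int_pair] by simp
  let ?q = "\<lambda>z. 1/2 * (\<Sum>i\<in>UNIV. \<Sum>j\<in>UNIV. \<Sigma> $ i $ j * g2 i j z)"
  have step: "\<bar>(\<integral>w'. g (z + sqrt \<delta> *\<^sub>R N w') \<partial>M) - g z - \<delta> * ?q z\<bar> \<le> L3 * (\<delta> * sqrt \<delta>)" for z
  proof -
    let ?y = "\<lambda>w. sqrt \<delta> *\<^sub>R N w"
    let ?A = "\<lambda>w. \<Sum>i\<in>UNIV. ?y w $ i * g1 i z"
    let ?B = "\<lambda>w. \<Sum>i\<in>UNIV. \<Sum>j\<in>UNIV. ?y w $ i * ?y w $ j * g2 i j z"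
    have A: "integrable M ?A" "(\<integral>w. ?A w \<partial>M) = 0"
      by (auto simp: integrable_component Bochner_Integration.integral_sum mean
          intro!: Bochner_Integration.integrable_sum)
    have Beq: "?B = (\<lambda>w. \<Sum>i\<in>UNIV. \<Sum>j\<in>UNIV. (\<delta> * g2 i j z) * (N w $ i * N w $ j))"
      using v(2) by (simp add: mult_ac flip: mult.assoc[of "sqrt \<delta>" "sqrt \<delta>"])
    have t: "integrable M (\<lambda>w. (\<delta> * g2 i j z) * (N w $ i * N w $ j))" for i j
      by (intro integrable_mult_right integrable_component_mult)
    have B: "integrable M ?B" "(\<integral>w. ?B w \<partial>M) = 2 * (\<delta> * ?q z)"
      unfolding Beq
      by (intro Bochner_Integration.integrable_sum t)
        (simp only: Bochner_Integration.integral_sum[OF Bochner_Integration.integrable_sum[OF t]]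
          Bochner_Integration.integral_sum[OF t] integral_mult_right_zero cov',
         simp add: sum_distrib_left mult_ac)
    have "\<bar>(\<integral>w'. g (z + ?y w') \<partial>M) - g z - \<delta> * ?q z\<bar> = \<bar>(\<integral>w. g (z + ?y w) - g z - ?A w - 1/2 * ?B w \<partial>M)\<bar>"
      using A B by (simp add: g_int prob_space)
    also have "\<dots> \<le> (\<integral>w. (\<delta> * sqrt \<delta>) * (l1norm (N w)) ^ 3 \<partial>M)"
    proof (rule abs_integral_le)
      show "integrable M (\<lambda>w. g (z + ?y w) - g z - ?A w - 1/2 * ?B w)"
        by (intro Bochner_Integration.integrable_diff integrable_mult_right A B g_int) simp
      show "integrable M (\<lambda>w. (\<delta> * sqrt \<delta>) * (l1norm (N w)) ^ 3)"
        by (intro integrable_mult_right integrable_l1_cube)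
      show "\<bar>g (z + ?y w) - g z - ?A w - 1/2 * ?B w\<bar> \<le> (\<delta> * sqrt \<delta>) * (l1norm (N w)) ^ 3" for w
      proof -
        have "(l1norm (?y w)) ^ 3 = (\<delta> * sqrt \<delta>) * (l1norm (N w)) ^ 3"
          unfolding l1norm_scaleR using v(2) by (simp add: power_mult_distrib power3_eq_cube)
        then show ?thesis using g_second_order[of z "?y w"] by simp
      qed
    qed
    also have "\<dots> = L3 * (\<delta> * sqrt \<delta>)" by (simp add: L3_def)
    finally show ?thesis .
  qed
  have qi: "integrable M (\<lambda>w. \<delta> * ?q (?Z w))"
    by (intro integrable_mult_right Bochner_Integration.integrable_sum g2_int)
  have lapq: "lap v x = (\<integral>w. ?q (?Z w) \<partial>M)"
    by (simp add: lap_def U2_def g2_int Bochner_Integration.integral_sum)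
  have "\<bar>U0 (v + \<delta>) x - U0 v x - \<delta> * lap v x\<bar> = \<bar>(\<integral>w. (\<integral>w'. g (?Z w + sqrt \<delta> *\<^sub>R N w') \<partial>M) - g (?Z w) - \<delta> * ?q (?Z w) \<partial>M)\<bar>"
    unfolding U lapq unfolding U0_def using int_inner qi g_int[of x "sqrt v"] by simp
  also have "\<dots> \<le> L3 * (\<delta> * sqrt \<delta>)"
    by (intro abs_integral_le_const Bochner_Integration.integrable_diff int_inner qi g_int step)
  finally show ?thesis .
qed

text \<open>The forward expansion is one-sided. For a decreasing variance it is started at the
  smaller value, and moving the generator back to \<open>v\<close> costs its Hoelder modulus, again
  a term of order 3/2.\<close>

lemma heat:
  assumes v: "0 \<le> v" "0 \<le> u"
  shows "\<bar>U0 u x - U0 v x - (u - v) * lap v x\<bar> \<le> (L3 + S1 * L1) * (\<bar>u - v\<bar> * sqrt \<bar>u - v\<bar>)"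
proof (cases "v \<le> u")
  case True
  then have "\<bar>U0 u x - U0 v x - (u - v) * lap v x\<bar> \<le> L3 * (\<bar>u - v\<bar> * sqrt \<bar>u - v\<bar>)"
    using heat_forward[of v "u - v" x] v by simp
  also have "\<dots> \<le> (L3 + S1 * L1) * (\<bar>u - v\<bar> * sqrt \<bar>u - v\<bar>)"
    using S1_nonneg L1_nonneg by (intro mult_right_mono) auto
  finally show ?thesis .
next
  case False
  have 1: "\<bar>U0 v x - U0 u x - (v - u) * lap u x\<bar> \<le> L3 * (\<bar>u - v\<bar> * sqrt \<bar>u - v\<bar>)"
    using heat_forward[of u "v - u" x] v False by simp
  have "\<bar>lap v x - lap u x\<bar> \<le> S1 * (L1 * sqrt \<bar>v - u\<bar>)"
    by (intro lap_diff_le) (unfold U2_def, intro variance_modulus g2_lip g2_int v)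
  then have "\<bar>(u - v) * (lap v x - lap u x)\<bar> \<le> \<bar>u - v\<bar> * (S1 * (L1 * sqrt \<bar>v - u\<bar>))"
    unfolding abs_mult by (intro mult_left_mono) auto
  then have 2: "\<bar>(u - v) * (lap v x - lap u x)\<bar> \<le> S1 * L1 * (\<bar>u - v\<bar> * sqrt \<bar>u - v\<bar>)"
    by (simp add: abs_minus_commute mult_ac)
  have "U0 u x - U0 v x - (u - v) * lap v x
     = - (U0 v x - U0 u x - (v - u) * lap u x) - (u - v) * (lap v x - lap u x)"
    by (simp add: algebra_simps)
  then show ?thesis using 1 2 by (simp only: distrib_right) linarith
qed

end

section \<open>Differentiating the interpolation between the two laws\<close>

lemma mehler_DERIV:
  assumes "\<And>w. ((\<lambda>t. \<Phi> t w) has_real_derivative \<Phi>' w) (at t)"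
  shows "((\<lambda>t. mehler p s n (\<Phi> t) w) has_real_derivative mehler p s n \<Phi>' w) (at t)"
  using assms
proof (induction n arbitrary: \<Phi> \<Phi>')
  case (Suc n)
  have "((\<lambda>t. resample p s n (\<Phi> t) w) has_real_derivative resample p s n \<Phi>' w) (at t)" for w
    unfolding resample_def avg_def using Suc.prems by (intro derivative_intros DERIV_cmult)
  then show ?case unfolding mehler.simps by (rule Suc.IH)
qed simp

lemma mehler_continuous_on:
  assumes "\<And>w. continuous_on S (\<lambda>t. \<Phi> t w)"
  shows "continuous_on S (\<lambda>t. mehler p s n (\<Phi> t) w)"
  using assms
proof (induction n arbitrary: \<Phi>)
  case (Suc n)
  have "continuous_on S (\<lambda>t. resample p s n (\<Phi> t) w)" for w
    unfolding resample_def avg_def using Suc.prems by (intro continuous_intros)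
  then show ?case unfolding mehler.simps by (rule Suc.IH)
qed simp

lemma DERIV_from_modulus:
  fixes f :: "real \<Rightarrow> real"
  assumes S: "open S" "x \<in> S"
    and "\<And>y. y \<in> S \<Longrightarrow> \<bar>f y - f x - (y - x) * D\<bar> \<le> C * (\<bar>y - x\<bar> * sqrt \<bar>y - x\<bar>)"
  shows "(f has_real_derivative D) (at x)"
proof -
  have "((\<lambda>y. (f y - f x) / (y - x) - D) \<longlongrightarrow> 0) (at x)"
  proof (rule Lim_null_comparison)
    show "((\<lambda>y. C * sqrt \<bar>y - x\<bar>) \<longlongrightarrow> 0) (at x)"
      by (auto intro!: tendsto_eq_intros)
    have "\<forall>\<^sub>F y in at x. y \<in> S" using S eventually_at_topological by blast
    moreover have "\<forall>\<^sub>F y in at x. y \<noteq> x" by (simp add: eventually_at_filter)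
    ultimately show "\<forall>\<^sub>F y in at x. norm ((f y - f x) / (y - x) - D) \<le> C * sqrt \<bar>y - x\<bar>"
    proof eventually_elim
      case (elim y)
      have "d * (a / d - D) = a - d * D" if "d \<noteq> 0" for a d :: real
        using that by (simp add: field_simps)
      from this[of "y - x" "f y - f x"] have "\<bar>y - x\<bar> * \<bar>(f y - f x) / (y - x) - D\<bar> = \<bar>f y - f x - (y - x) * D\<bar>"
        unfolding abs_mult[symmetric] using elim by simp
      also have "\<dots> \<le> \<bar>y - x\<bar> * (C * sqrt \<bar>y - x\<bar>)" using assms(3)[OF elim(1)] by (simp add: mult_ac)
      finally show ?case using elim by simp
    qed
  qed
  then show ?thesis unfolding has_field_derivative_iff by (rule Lim_null[THEN iffD2])
qed

context gaussian_smoothing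
begin

lemma U2_lip: "\<bar>U2 i j v (x + y) - U2 i j v x\<bar> \<le> l1norm y"
proof -
  have "\<bar>U2 i j v (x + y) - U2 i j v x\<bar>
      = \<bar>\<integral>w. g2 i j ((x + sqrt v *\<^sub>R N w) + y) - g2 i j (x + sqrt v *\<^sub>R N w) \<partial>M\<bar>"
    unfolding U2_def using g2_int[where i = i and j = j and c = "sqrt v" and x = "x + y"]
      g2_int[where i = i and j = j and c = "sqrt v" and x = x] by (simp add: algebra_simps)
  also have "\<dots> \<le> l1norm y"
    using g2_int[where i = i and j = j and c = "sqrt v" and x = "x + y"]
      g2_int[where i = i and j = j and c = "sqrt v" and x = x]
    by (intro abs_integral_le_const g2_lip) (simp add: algebra_simps)
  finally show ?thesis .
qed

lemma U0_line_DERIV: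
  "((\<lambda>c. U0 v (c *\<^sub>R f)) has_real_derivative (\<Sum>i\<in>UNIV. f $ i * U1 i v (c *\<^sub>R f))) (at c)"
proof (rule DERIV_from_modulus[where S = "{c - 1<..<c + 1}" and C = "(l1norm f)\<^sup>2"])
  fix y assume y: "y \<in> {c - 1<..<c + 1}"
  \<comment> \<open>Within distance 1 a quadratic remainder is below the order 3/2 that
    \<open>DERIV_from_modulus\<close> expects.\<close>
  have "\<bar>y - c\<bar> \<le> sqrt \<bar>y - c\<bar>"
    using y by (intro real_le_rsqrt) (auto simp: power2_eq_square abs_if intro!: mult_left_le_one_le)
  then have "\<bar>y - c\<bar>\<^sup>2 \<le> \<bar>y - c\<bar> * sqrt \<bar>y - c\<bar>"
    unfolding power2_eq_square by (rule mult_left_mono) simp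
  then have 1: "(l1norm f)\<^sup>2 * \<bar>y - c\<bar>\<^sup>2 \<le> (l1norm f)\<^sup>2 * (\<bar>y - c\<bar> * sqrt \<bar>y - c\<bar>)"
    by (rule mult_left_mono) simp
  have "\<bar>U0 v (y *\<^sub>R f) - U0 v (c *\<^sub>R f) - (y - c) * (\<Sum>i\<in>UNIV. f $ i * U1 i v (c *\<^sub>R f))\<bar>
      \<le> (\<bar>y - c\<bar> * l1norm f)\<^sup>2"
  proof -
    have "c *\<^sub>R f + (y - c) *\<^sub>R f = y *\<^sub>R f" by (simp add: scaleR_left_diff_distrib)
    moreover have "(\<Sum>i\<in>UNIV. ((y - c) *\<^sub>R f) $ i * U1 i v (c *\<^sub>R f))
        = (y - c) * (\<Sum>i\<in>UNIV. f $ i * U1 i v (c *\<^sub>R f))"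
      by (simp only: vector_scaleR_component real_scaleR_def sum_distrib_left mult.assoc)
    ultimately show ?thesis
      using U0_first_order[of v "c *\<^sub>R f" "(y - c) *\<^sub>R f"] unfolding l1norm_scaleR by simp
  qed
  then show "\<bar>U0 v (y *\<^sub>R f) - U0 v (c *\<^sub>R f) - (y - c) * (\<Sum>i\<in>UNIV. f $ i * U1 i v (c *\<^sub>R f))\<bar>
      \<le> (l1norm f)\<^sup>2 * (\<bar>y - c\<bar> * sqrt \<bar>y - c\<bar>)"
    using 1 by (simp add: power_mult_distrib mult_ac)
qed auto

text \<open>The increment splits into a change of variance at the moving point and a move of the
  point at fixed variance. The first part yields the generator at the moving point; replacing it by
  the generator at the fixed point costs another factor \<open>sqrt \<bar>y - t\<bar>\<close>, hence
  still order 3/2.\<close>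

lemma interpolation_DERIV:
  assumes t: "0 < t" "t < 1"
  shows "((\<lambda>t. U0 (1 - t) (sqrt t *\<^sub>R f)) has_real_derivative
    (\<Sum>i\<in>UNIV. f $ i * U1 i (1 - t) (sqrt t *\<^sub>R f)) / (2 * sqrt t) - lap (1 - t) (sqrt t *\<^sub>R f)) (at t)"
proof -
  let ?R = "\<lambda>y. U0 (1 - y) (sqrt y *\<^sub>R f) - U0 (1 - t) (sqrt y *\<^sub>R f)"
  let ?l = "lap (1 - t) (sqrt t *\<^sub>R f)"
  have "(?R has_real_derivative - ?l) (at t)"
  proof (rule DERIV_from_modulus[where S = "{0<..<1}" and C = "(L3 + S1 * L1) + S1 * l1norm f"])
    fix y :: real assume y: "y \<in> {0<..<1}"
    have ab: "\<bar>1 - y - (1 - t)\<bar> = \<bar>y - t\<bar>" by simp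
    have 1: "\<bar>?R y - ((1 - y) - (1 - t)) * lap (1 - t) (sqrt y *\<^sub>R f)\<bar>
       \<le> (L3 + S1 * L1) * (\<bar>y - t\<bar> * sqrt \<bar>y - t\<bar>)"
      using heat[of "1 - t" "1 - y" "sqrt y *\<^sub>R f"] t y unfolding ab by simp
    have "\<bar>lap (1 - t) (sqrt y *\<^sub>R f) - ?l\<bar> \<le> S1 * (l1norm f * sqrt \<bar>y - t\<bar>)"
    proof (rule lap_diff_le)
      fix i j
      have "\<bar>U2 i j (1 - t) (sqrt y *\<^sub>R f) - U2 i j (1 - t) (sqrt t *\<^sub>R f)\<bar> \<le> \<bar>sqrt y - sqrt t\<bar> * l1norm f"
        using U2_lip[of i j "1 - t" "sqrt t *\<^sub>R f" "(sqrt y - sqrt t) *\<^sub>R f"] unfolding l1norm_scaleR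
        by (simp add: scaleR_left_diff_distrib)
      also have "\<dots> \<le> sqrt \<bar>y - t\<bar> * l1norm f"
        using y t by (intro mult_right_mono sqrt_diff_le l1norm_nonneg) auto
      finally show "\<bar>U2 i j (1 - t) (sqrt y *\<^sub>R f) - U2 i j (1 - t) (sqrt t *\<^sub>R f)\<bar> \<le> l1norm f * sqrt \<bar>y - t\<bar>"
        by (simp add: mult.commute)
    qed
    then have "\<bar>(y - t) * (lap (1 - t) (sqrt y *\<^sub>R f) - ?l)\<bar> \<le> \<bar>y - t\<bar> * (S1 * (l1norm f * sqrt \<bar>y - t\<bar>))"
      unfolding abs_mult by (rule mult_left_mono) simp
    then have 2: "\<bar>(y - t) * (lap (1 - t) (sqrt y *\<^sub>R f) - ?l)\<bar> \<le> S1 * l1norm f * (\<bar>y - t\<bar> * sqrt \<bar>y - t\<bar>)"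
      by (simp only: mult_ac)
    have "?R y - ?R t - (y - t) * (- ?l) = (?R y - ((1 - y) - (1 - t)) * lap (1 - t) (sqrt y *\<^sub>R f))
        - (y - t) * (lap (1 - t) (sqrt y *\<^sub>R f) - ?l)"
      by (simp add: algebra_simps)
    then show "\<bar>?R y - ?R t - (y - t) * (- ?l)\<bar>
       \<le> ((L3 + S1 * L1) + S1 * l1norm f) * (\<bar>y - t\<bar> * sqrt \<bar>y - t\<bar>)"
      using 1 2 unfolding distrib_right[of "L3 + S1 * L1"] by linarith
  qed (use t in auto)
  moreover have "((\<lambda>y. U0 (1 - t) (sqrt y *\<^sub>R f)) has_real_derivative
      (\<Sum>i\<in>UNIV. f $ i * U1 i (1 - t) (sqrt t *\<^sub>R f)) * (inverse (sqrt t) / 2)) (at t)"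
    by (rule DERIV_chain2[OF U0_line_DERIV DERIV_real_sqrt[OF t(1)]])
  ultimately have "((\<lambda>y. ?R y + U0 (1 - t) (sqrt y *\<^sub>R f)) has_real_derivative
     - ?l + (\<Sum>i\<in>UNIV. f $ i * U1 i (1 - t) (sqrt t *\<^sub>R f)) * (inverse (sqrt t) / 2)) (at t)"
    by (rule DERIV_add)
  then show ?thesis using t by (simp add: field_simps)
qed

text \<open>Needed at the end points, where differentiability is not claimed: the square root is
  singular at 0, and the variance reaches 0 at t = 1.\<close>

lemma interpolation_continuous: "continuous_on {0..1} (\<lambda>t. U0 (1 - t) (sqrt t *\<^sub>R f))"
  unfolding continuous_on_def
proof
  fix t :: real assume t: "t \<in> {0..1}"
  show "((\<lambda>t. U0 (1 - t) (sqrt t *\<^sub>R f)) \<longlongrightarrow> U0 (1 - t) (sqrt t *\<^sub>R f)) (at t within {0..1})"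
  proof (rule Lim_null[THEN iffD2], rule Lim_null_comparison)
    show "((\<lambda>y. L1 * sqrt \<bar>y - t\<bar> + \<bar>sqrt y - sqrt t\<bar> * l1norm f) \<longlongrightarrow> 0) (at t within {0..1})"
      by (auto intro!: tendsto_eq_intros)
    have "norm (U0 (1 - y) (sqrt y *\<^sub>R f) - U0 (1 - t) (sqrt t *\<^sub>R f))
        \<le> L1 * sqrt \<bar>y - t\<bar> + \<bar>sqrt y - sqrt t\<bar> * l1norm f" if y: "y \<in> {0..1}" for y
    proof -
      have ab: "\<bar>1 - y - (1 - t)\<bar> = \<bar>y - t\<bar>" by simp
      have "\<bar>U0 (1 - y) (sqrt y *\<^sub>R f) - U0 (1 - t) (sqrt y *\<^sub>R f)\<bar> \<le> L1 * sqrt \<bar>1 - y - (1 - t)\<bar>"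
        unfolding U0_def by (intro variance_modulus g_lip g_int) (use t y in auto)
      moreover have "\<bar>U0 (1 - t) (sqrt y *\<^sub>R f) - U0 (1 - t) (sqrt t *\<^sub>R f)\<bar> \<le> \<bar>sqrt y - sqrt t\<bar> * l1norm f"
        using U0_lip[of "1 - t" "sqrt t *\<^sub>R f" "(sqrt y - sqrt t) *\<^sub>R f"] unfolding l1norm_scaleR
        by (simp add: scaleR_left_diff_distrib)
      ultimately show ?thesis unfolding ab real_norm_def by linarith
    qed
    then show "\<forall>\<^sub>F y in at t within {0..1}. norm (U0 (1 - y) (sqrt y *\<^sub>R f) - U0 (1 - t) (sqrt t *\<^sub>R f))
        \<le> L1 * sqrt \<bar>y - t\<bar> + \<bar>sqrt y - sqrt t\<bar> * l1norm f"
      by (auto simp: eventually_at_filter)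
  qed
qed

end

section \<open>The bound for fixed frozen coordinates\<close>

locale rademacher_gaussian = rademacher p + gaussian_smoothing M N \<Sigma> g
  for p and M :: "'b measure" and N :: "'b \<Rightarrow> real ^ 'd::finite" and \<Sigma> and g :: "real ^ 'd \<Rightarrow> real"
begin

text \<open>The derivative of the interpolation is \<open>1 / (2 sqrt t)\<close> times the defect in
  Stein's identity at scale \<open>c = sqrt t\<close>. The factor \<open>c\<close> in
  \<open>stein_interpolation\<close> leaves the bound 1/2 uniformly in t, so one intermediate point
  suffices. The variance is 1 at t = 0, which gives the Gaussian mean, and 0 at t = 1.\<close>

lemma finite_bound_centred:
  fixes F :: "'d \<Rightarrow> (nat \<Rightarrow> real) \<Rightarrow> real"
  assumes F0: "\<And>i. e n (F i) w = 0"
  shows "\<bar>e n (\<lambda>w. g (vec F w)) w - (\<integral>w. g (N w) \<partial>M)\<bar>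
    \<le> 1/2 * (\<Sum>i\<in>UNIV. \<Sum>j\<in>UNIV. \<bar>\<Sigma> $ i $ j - e n (\<lambda>w. F i w * F j w) w\<bar> + bsum n F i j w)"
    (is "_ \<le> 1/2 * ?B")
proof -
  define \<Psi> where "\<Psi> t = e n (\<lambda>w. U0 (1 - t) (sqrt t *\<^sub>R vec F w)) w" for t
  define \<Psi>' where "\<Psi>' t = e n (\<lambda>w. (\<Sum>i\<in>UNIV. vec F w $ i * U1 i (1 - t) (sqrt t *\<^sub>R vec F w)) / (2 * sqrt t)
      - lap (1 - t) (sqrt t *\<^sub>R vec F w)) w" for t
  have d: "(\<Psi> has_real_derivative \<Psi>' t) (at t)" if "0 < t" "t < 1" for t
    unfolding \<Psi>_def \<Psi>'_def by (intro mehler_DERIV interpolation_DERIV that)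
  have c: "continuous_on {0..1} \<Psi>"
    unfolding \<Psi>_def by (intro mehler_continuous_on interpolation_continuous)
  have bound: "\<bar>\<Psi>' t\<bar> \<le> 1/2 * ?B" if t: "0 < t" "t < 1" for t
  proof -
    let ?W = "\<lambda>w. sqrt t *\<^sub>R vec F w"
    let ?X = "\<Sum>i\<in>UNIV. e n (\<lambda>w. U1 i (1 - t) (?W w) * F i w) w"
    let ?Y = "\<Sum>i\<in>UNIV. \<Sum>j\<in>UNIV. \<Sigma> $ i $ j * e n (\<lambda>w. U2 i j (1 - t) (?W w)) w"
    have s: "0 \<le> sqrt t" "sqrt t \<le> 1" using t by auto
    have st: "\<bar>?X - sqrt t * ?Y\<bar> \<le> sqrt t * ?B"
      using U1_trapezoid U2_bound s F0 by (rule stein_interpolation)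
    have "(\<lambda>w. (\<Sum>i\<in>UNIV. vec F w $ i * U1 i (1 - t) (?W w)) / (2 * sqrt t) - lap (1 - t) (?W w))
      = (\<lambda>w. (1 / (2 * sqrt t)) * (\<Sum>i\<in>UNIV. U1 i (1 - t) (?W w) * F i w)
          + (- 1/2) * (\<Sum>i\<in>UNIV. \<Sum>j\<in>UNIV. \<Sigma> $ i $ j * U2 i j (1 - t) (?W w)))"
      by (simp add: lap_def mult.commute)
    then have "\<Psi>' t = (1 / (2 * sqrt t)) * ?X + (- 1/2) * ?Y"
      unfolding \<Psi>'_def by (simp only: mehler_lin mehler_sum mehler_cmult)
    also have "\<dots> = (1 / (2 * sqrt t)) * (?X - sqrt t * ?Y)"
      using t by (simp add: field_simps)
    finally have "\<bar>\<Psi>' t\<bar> = (1 / (2 * sqrt t)) * \<bar>?X - sqrt t * ?Y\<bar>"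
      using t by (simp add: abs_mult)
    also have "\<dots> \<le> (1 / (2 * sqrt t)) * (sqrt t * ?B)"
      using st t by (intro mult_left_mono) auto
    also have "\<dots> = 1/2 * ?B" using t by simp
    finally show ?thesis .
  qed
  obtain l z where z: "0 < z" "z < 1" "(\<Psi> has_real_derivative l) (at z)" "\<Psi> 1 - \<Psi> 0 = (1 - 0) * l"
    using MVT[of 0 1 \<Psi>] c d by (metis real_differentiable_def zero_less_one)
  have "l = \<Psi>' z" using z(3) d[OF z(1,2)] by (rule DERIV_unique)
  then have "\<bar>\<Psi> 1 - \<Psi> 0\<bar> \<le> 1/2 * ?B" using bound[OF z(1,2)] z(4) by simp
  moreover have "\<Psi> 1 = e n (\<lambda>w. g (vec F w)) w"
    by (simp add: \<Psi>_def U0_def prob_space)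
  moreover have "\<Psi> 0 = (\<integral>w. g (N w) \<partial>M)"
    by (simp add: \<Psi>_def U0_def)
  ultimately show ?thesis by simp
qed

text \<open>Recentring at the frozen coordinates \<open>w\<close> leaves the derivatives unchanged.\<close>

lemma finite_bound:
  fixes F :: "'d \<Rightarrow> (nat \<Rightarrow> real) \<Rightarrow> real"
  shows "\<bar>e n (\<lambda>w. g (vec F w)) w - (\<integral>w. g (N w) \<partial>M)\<bar>
    \<le> (\<Sum>i\<in>UNIV. \<bar>e n (F i) w\<bar>) + 1/2 * (\<Sum>i\<in>UNIV. \<Sum>j\<in>UNIV.
        \<bar>\<Sigma> $ i $ j - (e n (\<lambda>w. F i w * F j w) w - e n (F i) w * e n (F j) w)\<bar> + bsum n F i j w)"
proof -
  define c where "c i = e n (F i) w" for i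
  define G where "G i = (\<lambda>w. F i w - c i)" for i
  have G0: "e n (G i) w = 0" for i unfolding G_def by (simp add: mehler_diff c_def)
  have D: "D k (G i) = D k (F i)" for k i by (simp add: G_def malliavin_D_def fun_eq_iff)
  have b: "bsum n G i j w = bsum n F i j w" for i j
    unfolding bsum_def b1_def b2_def b3_def b4_def D ..
  have prod: "e n (\<lambda>w. G i w * G j w) w = e n (\<lambda>w. F i w * F j w) w - c i * c j" for i j
  proof -
    have "(\<lambda>w. G i w * G j w) = (\<lambda>w. ((F i w * F j w - c j * F i w) - c i * F j w) + c i * c j)"
      by (simp add: G_def algebra_simps)
    then show ?thesis
      by (simp only: mehler_add mehler_diff mehler_cmult mehler_const) (simp add: c_def)
  qed
  have "\<bar>e n (\<lambda>w. g (vec F w)) w - e n (\<lambda>w. g (vec G w)) w\<bar> \<le> (\<Sum>i\<in>UNIV. \<bar>c i\<bar>)"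
  proof -
    have "\<bar>g (vec F w) - g (vec G w)\<bar> \<le> (\<Sum>i\<in>UNIV. \<bar>c i\<bar>)" for w
    proof -
      have "vec F w = vec G w + (\<chi> i. c i)" by (simp add: G_def vec_eq_iff)
      then show ?thesis using g_lip[of "vec G w" "\<chi> i. c i"] by simp
    qed
    then have "e n (\<lambda>w. \<bar>g (vec F w) - g (vec G w)\<bar>) w \<le> e n (\<lambda>_. \<Sum>i\<in>UNIV. \<bar>c i\<bar>) w"
      by (rule e_mono)
    moreover have "\<bar>e n (\<lambda>w. g (vec F w) - g (vec G w)) w\<bar> \<le> e n (\<lambda>w. \<bar>g (vec F w) - g (vec G w)\<bar>) w"
      by (rule mehler_abs) auto
    ultimately show ?thesis by (simp add: mehler_diff)
  qed
  moreover note finite_bound_centred[of n G w, OF G0]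
  ultimately show ?thesis unfolding b prod c_def by linarith
qed

end

section \<open>The Rademacher space\<close>

lemma epowr_zero [simp]: "epowr 0 a = 0"
  by (simp add: epowr_def)

lemma epowr_ennreal: "0 \<le> x \<Longrightarrow> epowr (ennreal x) a = ennreal (x powr a)"
  by (simp add: epowr_def)

lemma epowr_top [simp]: "epowr \<infinity> a = \<infinity>"
  by (simp add: epowr_def)

lemma epowr_mono: "0 < a \<Longrightarrow> x \<le> y \<Longrightarrow> epowr x a \<le> epowr y a"
  by (cases x; cases y) (auto simp: epowr_ennreal epowr_def powr_mono2 top_unique)

lemma epowr_epowr: "0 < a \<Longrightarrow> 0 < b \<Longrightarrow> epowr (epowr x a) b = epowr x (a * b)"
  by (cases x) (auto simp: epowr_ennreal powr_powr epowr_def)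

lemma epowr_add: "0 < a \<Longrightarrow> 0 < b \<Longrightarrow> epowr x a * epowr x b = epowr x (a + b)"
  by (cases x) (auto simp: epowr_ennreal powr_add ennreal_mult epowr_def)

lemma epowr_eq_0_iff: "epowr x a = 0 \<longleftrightarrow> x = 0"
  by (cases x) (auto simp: epowr_ennreal epowr_def)

lemma epowr_mult: "0 < a \<Longrightarrow> epowr (x * y) a = epowr x a * epowr y a"
proof (cases "x = \<infinity> \<or> y = \<infinity>")
  case True
  then show ?thesis
  \<comment> \<open>The convention that 0 times infinity is 0 holds on both sides, so a zero factor
    is harmless even next to an infinite one.\<close>
  proof (cases "x = 0 \<or> y = 0")
    case False
    then have "x * y = \<top>" "epowr x a * epowr y a = \<top>"
      using True epowr_top[of a] by (auto simp: ennreal_mult_eq_top_iff epowr_eq_0_iff)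
    then show ?thesis using epowr_top[of a] by simp
  qed auto
next
  case False
  then obtain u v where "x = ennreal u" "y = ennreal v" "0 \<le> u" "0 \<le> v"
    by (cases x; cases y) auto
  then show ?thesis by (simp add: ennreal_mult[symmetric] epowr_ennreal powr_mult)
qed

lemma le_epowr_half:
  assumes "z\<^sup>2 \<le> x" shows "z \<le> epowr x (1/2)"
proof (cases x)
  case (real u)
  with assms have "z \<noteq> \<infinity>" by (auto simp: power2_eq_square top_unique)
  then obtain w where w: "z = ennreal w" "0 \<le> w" by (cases z) auto
  then have "w\<^sup>2 \<le> u" using assms real by (simp add: ennreal_power)
  then have "w \<le> sqrt u" by (rule real_le_rsqrt)
  then show ?thesis using w real by (simp add: epowr_ennreal powr_half_sqrt)
qed (simp add: epowr_def)

text \<open>Stated for extended nonnegative values, so both sides may be infinite. With conditional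
  means for \<open>X\<close> and \<open>Y\<close> it is the passage from conditional to
  unconditional bounds.\<close>

lemma nn_integral_sqrt_mult:
  assumes [measurable]: "X \<in> borel_measurable M" "Y \<in> borel_measurable M"
    and nn: "\<And>w. 0 \<le> X w" "\<And>w. 0 \<le> Y w"
  shows "(\<integral>\<^sup>+w. ennreal (sqrt (X w) * sqrt (Y w)) \<partial>M)
    \<le> epowr (\<integral>\<^sup>+w. ennreal (X w) \<partial>M) (1/2) * epowr (\<integral>\<^sup>+w. ennreal (Y w) \<partial>M) (1/2)"
proof -
  have "(\<integral>\<^sup>+w. ennreal (sqrt (X w)) * ennreal (sqrt (Y w)) \<partial>M)\<^sup>2
     \<le> (\<integral>\<^sup>+w. (ennreal (sqrt (X w)))\<^sup>2 \<partial>M) * (\<integral>\<^sup>+w. (ennreal (sqrt (Y w)))\<^sup>2 \<partial>M)"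
    by (rule Cauchy_Schwarz_nn_integral) auto
  then have "(\<integral>\<^sup>+w. ennreal (sqrt (X w) * sqrt (Y w)) \<partial>M)\<^sup>2
     \<le> (\<integral>\<^sup>+w. ennreal (X w) \<partial>M) * (\<integral>\<^sup>+w. ennreal (Y w) \<partial>M)"
    using nn by (simp add: ennreal_power ennreal_mult)
  then show ?thesis by (subst epowr_mult[symmetric]) (auto intro: le_epowr_half)
qed

lemma (in prob_space) nn_integral_sqrt:
  assumes [measurable]: "X \<in> borel_measurable M" and nn: "\<And>w. 0 \<le> X w"
  shows "(\<integral>\<^sup>+w. ennreal (sqrt (X w)) \<partial>M) \<le> epowr (\<integral>\<^sup>+w. ennreal (X w) \<partial>M) (1/2)"
proof -
  have "epowr 1 (1/2) = 1" using epowr_ennreal[of 1 "1/2"] by simp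
  then show ?thesis
    using nn_integral_sqrt_mult[of X M "\<lambda>_. 1"] nn by (simp add: emeasure_space_1)
qed

section \<open>Functions of finitely many coordinates\<close>

definition depends_on_first :: "nat \<Rightarrow> ((nat \<Rightarrow> real) \<Rightarrow> real) \<Rightarrow> bool" where
  "depends_on_first m h \<longleftrightarrow> (\<forall>w w'. (\<forall>k<m. w k = w' k) \<longrightarrow> h w = h w')"

lemma depends_on_first_mono: "depends_on_first m h \<Longrightarrow> m \<le> n \<Longrightarrow> depends_on_first n h"
  unfolding depends_on_first_def by (meson less_le_trans)

lemma depends_on_first_mehler: "depends_on_first m h \<Longrightarrow> depends_on_first m (mehler p s n h)"
proof (induction n arbitrary: h)
  case (Suc n)
  have "depends_on_first m (resample p s n h)"
    unfolding depends_on_first_def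
  proof (intro allI impI)
    fix w w' :: "nat \<Rightarrow> real" assume a: "\<forall>k<m. w k = w' k"
    have "h (fun_upd w n x) = h (fun_upd w' n x)" for x
      using Suc.prems[unfolded depends_on_first_def, rule_format, of "fun_upd w n x" "fun_upd w' n x"] a
      by simp
    moreover have "h w = h w'" using Suc.prems a unfolding depends_on_first_def by blast
    ultimately show "resample p s n h w = resample p s n h w'"
      by (simp add: resample_def avg_def)
  qed
  then show ?case using Suc.IH by simp
qed simp

text \<open>Averaging removes the dependence on the first \<open>n\<close> coordinates and creates
  no new one, while \<open>h\<close> did not depend on the others.\<close>

lemma head_mean_constant:
  assumes h: "depends_on_first m h" and n: "m \<le> n"
  shows "head_mean p n h w = head_mean p n h w'"
proof -
  let ?H = "head_mean p n h"
  \<comment> \<open>The sequence \<open>w\<close> is turned into \<open>w'\<close> one coordinate at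
    a time, because \<open>free_of\<close> speaks of a single coordinate.\<close>
  define mix where "mix j = (\<lambda>k. if k < j then w' k else w k)" for j
  have "j \<le> n \<Longrightarrow> ?H (mix j) = ?H w" for j
  proof (induction j)
    case (Suc j)
    have "mix (Suc j) = fun_upd (mix j) j (w' j)" by (auto simp: mix_def fun_eq_iff)
    moreover have "?H (fun_upd (mix j) j (w' j)) = ?H (mix j)"
      by (rule free_ofD[OF head_mean_free]) (use Suc.prems in simp)
    ultimately have "?H (mix (Suc j)) = ?H (mix j)" by (simp only:)
    then show ?case using Suc by simp
  qed (simp add: mix_def)
  moreover have "?H (mix n) = ?H w'"
    using depends_on_first_mehler[OF h, of p 0 n, unfolded depends_on_first_def, rule_format, of "mix n" w'] n
    by (auto simp: mix_def)
  ultimately show ?thesis by simp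
qed

definition cylinder :: "((nat \<Rightarrow> real) \<Rightarrow> real) \<Rightarrow> bool" where
  "cylinder h \<longleftrightarrow> (\<exists>m. depends_on_first m h)"

lemma cylinder_const: "cylinder (\<lambda>_. c)"
  by (auto simp: cylinder_def depends_on_first_def)

lemma cylinder_combine:
  assumes "cylinder f" "cylinder g" shows "cylinder (\<lambda>w. \<Phi> (f w) (g w))"
proof -
  obtain m n where mn: "depends_on_first m f" "depends_on_first n g" using assms by (auto simp: cylinder_def)
  have "depends_on_first (max m n) f" "depends_on_first (max m n) g"
    by (rule depends_on_first_mono[OF mn(1)], simp, rule depends_on_first_mono[OF mn(2)], simp)
  then have "depends_on_first (max m n) (\<lambda>w. \<Phi> (f w) (g w))"
    unfolding depends_on_first_def by metis
  then show ?thesis by (auto simp: cylinder_def)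
qed

lemma cylinder_rad_Y: "cylinder (rad_Y p k)"
  unfolding cylinder_def depends_on_first_def rad_Y_def by (intro exI[of _ "Suc k"]) auto

lemma cylinder_monomial: "cylinder (\<lambda>w. prod_list (map (\<lambda>i. rad_Y p i w) xs))"
  by (induction xs) (auto intro: cylinder_const cylinder_combine[of _ _ "(*)"] cylinder_rad_Y)

section \<open>The product measure and the tower property of head means\<close>

context rademacher
begin

abbreviation "R \<equiv> rademacher_space p"
abbreviation "coin k \<equiv> point_measure {-1, 1 :: real} (\<lambda>x. ennreal (if x = 1 then p k else qprob p k))"

lemma prob_coin: "prob_space (coin k)"
proof
  have "emeasure (coin k) (space (coin k)) = ennreal (qprob p k) + ennreal (p k)"
    by (simp add: space_point_measure emeasure_point_measure_finite)
  also have "\<dots> = 1" using p_pos[of k] q_pos[of k] by (simp flip: ennreal_plus)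
  finally show "emeasure (coin k) (space (coin k)) = 1" .
qed

sublocale R: prob_space R
  unfolding rademacher_space_def by (intro prob_space_PiM prob_coin)

lemma coord_measurable [measurable]: "(\<lambda>w. w k) \<in> borel_measurable R"
proof -
  have "(\<lambda>w. w k) \<in> measurable R (coin k)"
    unfolding rademacher_space_def by measurable
  moreover have "(\<lambda>x. x) \<in> measurable (coin k) borel"
    by (simp add: measurable_def space_point_measure sets_point_measure)
  ultimately show ?thesis by (rule measurable_compose)
qed

text \<open>The new value has to be an outcome of the coin, since otherwise the updated sequence
  leaves the space of \<open>R\<close>.\<close>

lemma upd_measurable:
  assumes "x \<in> {-1, 1}" shows "(\<lambda>w. fun_upd w k x) \<in> measurable R R"
  unfolding rademacher_space_def
  by (rule measurable_fun_upd[where J = UNIV]) (use assms in \<open>auto simp: space_point_measure\<close>)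

lemma upd_measurable' [measurable]:
  "(\<lambda>w. fun_upd w k 1) \<in> measurable R R" "(\<lambda>w. fun_upd w k (-1)) \<in> measurable R R"
  by (auto intro: upd_measurable)

lemma upd_compose_measurable:
  assumes "F \<in> borel_measurable R"
  shows "(\<lambda>w. F (fun_upd w k 1)) \<in> borel_measurable R" "(\<lambda>w. F (fun_upd w k (-1))) \<in> borel_measurable R"
  by (rule measurable_compose[OF upd_measurable'(1) assms], rule measurable_compose[OF upd_measurable'(2) assms])

lemma avg_measurable [measurable (raw)]: "F \<in> borel_measurable R \<Longrightarrow> avg p k F \<in> borel_measurable R"
  unfolding avg_def[abs_def]
  by (intro borel_measurable_add borel_measurable_times borel_measurable_const upd_compose_measurable)

lemma D_measurable [measurable (raw)]: "F \<in> borel_measurable R \<Longrightarrow> D k F \<in> borel_measurable R"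
  unfolding malliavin_D_def[abs_def]
  by (intro borel_measurable_diff borel_measurable_times borel_measurable_const upd_compose_measurable)

lemma mehler_measurable [measurable (raw)]:
  "F \<in> borel_measurable R \<Longrightarrow> mehler p s n F \<in> borel_measurable R"
proof (induction n arbitrary: F)
  case (Suc n)
  have "resample p s n F \<in> borel_measurable R"
    unfolding resample_def[abs_def] using Suc.prems
    by (intro borel_measurable_add borel_measurable_times borel_measurable_const avg_measurable)
  then show ?case using Suc.IH by simp
qed simp

lemma rad_Y_measurable [measurable]: "rad_Y p k \<in> borel_measurable R"
  unfolding rad_Y_def[abs_def] by measurable

lemma monomial_measurable [measurable]:
  "(\<lambda>w. prod_list (map (\<lambda>i. rad_Y p i w) xs)) \<in> borel_measurable R"
  by (induction xs) simp_all

text \<open>Overwriting coordinate \<open>k\<close> of a sample by an independent coin does not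
  change the law; Fubini's theorem then integrates the coin out as a two-point sum.\<close>

lemma nn_integral_coordinate:
  assumes [measurable]: "f \<in> borel_measurable R"
  shows "(\<integral>\<^sup>+w. f w \<partial>R) = ennreal (p k) * (\<integral>\<^sup>+w. f (fun_upd w k 1) \<partial>R)
     + ennreal (qprob p k) * (\<integral>\<^sup>+w. f (fun_upd w k (-1)) \<partial>R)"
proof -
  have R: "distr (coin k \<Otimes>\<^sub>M R) R (\<lambda>(x, X). fun_upd X k x) = R"
    using distr_pair_PiM_eq_PiM[of UNIV coin k] prob_coin
    by (simp add: rademacher_space_def insert_absorb)
  have m: "(\<lambda>(x, X). fun_upd X k x) \<in> measurable (coin k \<Otimes>\<^sub>M R) R"
    unfolding rademacher_space_def split_beta'
    by (rule measurable_fun_upd[where J = UNIV]) auto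
  have "(\<integral>\<^sup>+w. f w \<partial>R) = (\<integral>\<^sup>+w. f w \<partial>distr (coin k \<Otimes>\<^sub>M R) R (\<lambda>(x, X). fun_upd X k x))"
    unfolding R ..
  also have "\<dots> = (\<integral>\<^sup>+z. f (case z of (x, X) \<Rightarrow> fun_upd X k x) \<partial>(coin k \<Otimes>\<^sub>M R))"
    by (rule nn_integral_distr[OF m]) simp
  also have "\<dots> = (\<integral>\<^sup>+x. \<integral>\<^sup>+X. f (fun_upd X k x) \<partial>R \<partial>coin k)"
    using R.nn_integral_fst[OF measurable_compose[OF m assms]] by simp
  also have "\<dots> = ennreal (p k) * (\<integral>\<^sup>+w. f (fun_upd w k 1) \<partial>R)
     + ennreal (qprob p k) * (\<integral>\<^sup>+w. f (fun_upd w k (-1)) \<partial>R)"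
    by (subst nn_integral_point_measure_finite) (auto simp: mult.commute add.commute)
  finally show ?thesis .
qed

lemma nn_integral_avg:
  assumes [measurable]: "G \<in> borel_measurable R" and "\<And>w. 0 \<le> G w"
  shows "(\<integral>\<^sup>+w. ennreal (avg p k G w) \<partial>R) = (\<integral>\<^sup>+w. ennreal (G w) \<partial>R)"
proof -
  have "(\<integral>\<^sup>+w. ennreal (avg p k G w) \<partial>R)
      = (\<integral>\<^sup>+w. ennreal (p k) * ennreal (G (fun_upd w k 1)) + ennreal (qprob p k) * ennreal (G (fun_upd w k (-1))) \<partial>R)"
    unfolding avg_def using assms(2) p_pos[of k] q_pos[of k]
    by (simp add: ennreal_mult ennreal_plus less_imp_le del: ennreal_plus[symmetric])
  also have "\<dots> = ennreal (p k) * (\<integral>\<^sup>+w. ennreal (G (fun_upd w k 1)) \<partial>R)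
     + ennreal (qprob p k) * (\<integral>\<^sup>+w. ennreal (G (fun_upd w k (-1))) \<partial>R)"
    by (simp add: nn_integral_add nn_integral_cmult)
  also have "\<dots> = (\<integral>\<^sup>+w. ennreal (G w) \<partial>R)"
    by (rule nn_integral_coordinate[symmetric]) simp
  finally show ?thesis .
qed

lemma nn_integral_e:
  assumes "G \<in> borel_measurable R" "\<And>w. 0 \<le> G w"
  shows "(\<integral>\<^sup>+w. ennreal (e n G w) \<partial>R) = (\<integral>\<^sup>+w. ennreal (G w) \<partial>R)"
  using assms
proof (induction n arbitrary: G)
  case (Suc n)
  have "0 \<le> avg p n G w" for w
    unfolding avg_def using Suc.prems(2) p_pos[of n] q_pos[of n]
    by (intro add_nonneg_nonneg mult_nonneg_nonneg) auto
  then show ?case using Suc by (simp add: avg_eq_resample[symmetric] nn_integral_avg)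
qed simp

lemma nn_integral_abs_e_le:
  assumes [measurable]: "G \<in> borel_measurable R"
  shows "(\<integral>\<^sup>+w. ennreal \<bar>e n G w\<bar> \<partial>R) \<le> (\<integral>\<^sup>+w. ennreal \<bar>G w\<bar> \<partial>R)"
proof -
  have "(\<integral>\<^sup>+w. ennreal \<bar>e n G w\<bar> \<partial>R) \<le> (\<integral>\<^sup>+w. ennreal (e n (\<lambda>w. \<bar>G w\<bar>) w) \<partial>R)"
    by (intro nn_integral_mono ennreal_leI mehler_abs) auto
  then show ?thesis by (simp add: nn_integral_e)
qed

lemma integrable_e:
  assumes "integrable R G" shows "integrable R (e n G)"
proof (rule integrableI_bounded)
  show "e n G \<in> borel_measurable R" using assms by measurable
  show "(\<integral>\<^sup>+w. ennreal (norm (e n G w)) \<partial>R) < \<infinity>"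
    using nn_integral_abs_e_le[of G n] assms by (auto simp: integrable_iff_bounded intro: le_less_trans)
qed

lemma integral_e_nonneg:
  assumes "integrable R G" "\<And>w. 0 \<le> G w"
  shows "(\<integral>w. e n G w \<partial>R) = (\<integral>w. G w \<partial>R)"
  using assms nn_integral_e[of G n] integrable_e[OF assms(1), of n]
  by (subst (1 2) integral_eq_nn_integral) (auto intro: e_nonneg)

lemma integral_e:
  assumes G: "integrable R G"
  shows "(\<integral>w. e n G w \<partial>R) = (\<integral>w. G w \<partial>R)"
proof -
  \<comment> \<open>A difference of two nonnegative integrable functions, to each of which the
    nonnegative case applies.\<close>
  let ?P = "\<lambda>w. \<bar>G w\<bar>" and ?Q = "\<lambda>w. \<bar>G w\<bar> - G w"
  have i: "integrable R ?P" "integrable R ?Q" using G by auto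
  have "e n G = (\<lambda>w. e n ?P w - e n ?Q w)"
    by (simp add: mehler_diff[symmetric])
  then have "(\<integral>w. e n G w \<partial>R) = (\<integral>w. e n ?P w \<partial>R) - (\<integral>w. e n ?Q w \<partial>R)"
    using i[THEN integrable_e[of _ n]] by simp
  also have "\<dots> = (\<integral>w. G w \<partial>R)"
    using i G integral_e_nonneg[OF i(1), of n] integral_e_nonneg[OF i(2), of n] by simp
  finally show ?thesis .
qed

section \<open>Approximation by cylinder functions and limits of head means\<close>

definition L1_approximable where
  "L1_approximable H \<longleftrightarrow> integrable R H \<and>
    (\<forall>\<eta>>0. \<exists>h. cylinder h \<and> integrable R h \<and> (\<integral>w. \<bar>H w - h w\<bar> \<partial>R) \<le> \<eta>)"

definition L2_approximable where
  "L2_approximable F \<longleftrightarrow> square_integrable R F \<and>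
    (\<forall>\<eta>>0. \<exists>h. cylinder h \<and> square_integrable R h \<and> (\<integral>w. (F w - h w)\<^sup>2 \<partial>R) \<le> \<eta>)"

text \<open>For a cylinder function the head mean is eventually the constant expectation. The head
  mean contracts the mean absolute value, so the approximation error is not increased. This is the
  convergence of a reversed martingale to a trivial limit, without martingale theory.\<close>

lemma e_L1_limit:
  assumes H: "L1_approximable H"
  shows "(\<lambda>n. \<integral>w. \<bar>e n H w - (\<integral>w. H w \<partial>R)\<bar> \<partial>R) \<longlonglongrightarrow> 0"
proof (rule LIMSEQ_I)
  fix \<epsilon> :: real assume \<epsilon>: "0 < \<epsilon>"
  have iH: "integrable R H" using H by (simp add: L1_approximable_def)
  obtain h m where h: "depends_on_first m h" "integrable R h" "(\<integral>w. \<bar>H w - h w\<bar> \<partial>R) \<le> \<epsilon> / 3"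
    using H \<epsilon> unfolding L1_approximable_def cylinder_def by (metis divide_pos_pos zero_less_numeral)
  have "\<bar>\<integral>w. \<bar>e n H w - (\<integral>w. H w \<partial>R)\<bar> \<partial>R\<bar> < \<epsilon>" if n: "m \<le> n" for n
  proof -
    let ?d = "\<lambda>w. H w - h w"
    have id: "integrable R ?d" using iH h by simp
    have c: "e n h w = (\<integral>w. h w \<partial>R)" for w
    proof -
      have "(\<integral>w. h w \<partial>R) = (\<integral>w'. e n h w \<partial>R)"
        unfolding integral_e[OF h(2), of n, symmetric] using head_mean_constant[OF h(1) n] by metis
      then show ?thesis by (simp add: R.prob_space)
    qed
    have pt: "\<bar>e n H w - (\<integral>w. H w \<partial>R)\<bar> \<le> e n (\<lambda>w. \<bar>?d w\<bar>) w + \<epsilon> / 3" for w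
    proof -
      have "e n H w - (\<integral>w. H w \<partial>R) = e n ?d w - (\<integral>w. ?d w \<partial>R)"
        using iH h by (simp add: mehler_diff c)
      moreover have "\<bar>e n ?d w\<bar> \<le> e n (\<lambda>w. \<bar>?d w\<bar>) w" by (rule mehler_abs) auto
      moreover have "\<bar>\<integral>w. ?d w \<partial>R\<bar> \<le> \<epsilon> / 3" using integral_abs_bound[of R ?d] h(3) by linarith
      ultimately show ?thesis by linarith
    qed
    have "(\<integral>w. \<bar>e n H w - (\<integral>w. H w \<partial>R)\<bar> \<partial>R) \<le> (\<integral>w. e n (\<lambda>w. \<bar>?d w\<bar>) w + \<epsilon> / 3 \<partial>R)"
      using pt id iH by (intro integral_mono) (auto intro!: integrable_e)
    also have "\<dots> = (\<integral>w. \<bar>?d w\<bar> \<partial>R) + \<epsilon> / 3"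
      using id integrable_e[of "\<lambda>w. \<bar>?d w\<bar>" n] integral_e[of "\<lambda>w. \<bar>?d w\<bar>" n] by (simp add: R.prob_space)
    also have "\<dots> < \<epsilon>" using h(3) \<epsilon> by linarith
    finally show ?thesis by simp
  qed
  then show "\<exists>m. \<forall>n\<ge>m. norm ((\<integral>w. \<bar>e n H w - (\<integral>w. H w \<partial>R)\<bar> \<partial>R) - 0) < \<epsilon>" by auto
qed

lemma square_integrable_mult:
  assumes "square_integrable R F" "square_integrable R G"
  shows "integrable R (\<lambda>w. F w * G w)"
proof (rule Bochner_Integration.integrable_bound)
  show "integrable R (\<lambda>w. (F w)\<^sup>2 + (G w)\<^sup>2)" using assms by (simp add: square_integrable_def)
  show "(\<lambda>w. F w * G w) \<in> borel_measurable R"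
    using assms by (intro borel_measurable_times) (auto simp: square_integrable_def)
  have "\<bar>x * y\<bar> \<le> x\<^sup>2 + y\<^sup>2" for x y :: real
    using sum_squares_bound[of "\<bar>x\<bar>" "\<bar>y\<bar>"] mult_nonneg_nonneg[of "\<bar>x\<bar>" "\<bar>y\<bar>"]
    unfolding abs_mult power2_abs by linarith
  then show "AE w in R. norm (F w * G w) \<le> norm ((F w)\<^sup>2 + (G w)\<^sup>2)" by simp
qed

lemma square_integrable_lin:
  assumes "square_integrable R F" "square_integrable R G"
  shows "square_integrable R (\<lambda>w. a * F w + b * G w)"
proof -
  have "(\<lambda>w. (a * F w + b * G w)\<^sup>2) = (\<lambda>w. a\<^sup>2 * (F w)\<^sup>2 + (2 * a * b) * (F w * G w) + b\<^sup>2 * (G w)\<^sup>2)"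
    by (simp add: power2_eq_square algebra_simps)
  moreover have "(\<lambda>w. a * F w + b * G w) \<in> borel_measurable R"
    using assms by (intro borel_measurable_add borel_measurable_times) (auto simp: square_integrable_def)
  ultimately show ?thesis using assms square_integrable_mult[OF assms]
    by (simp add: square_integrable_def)
qed

lemma square_integrable_const: "square_integrable R (\<lambda>_. c)"
  by (simp add: square_integrable_def)

lemma square_integrable_add:
  "square_integrable R F \<Longrightarrow> square_integrable R G \<Longrightarrow> square_integrable R (\<lambda>w. F w + G w)"
  using square_integrable_lin[of F G 1 1] by simp

lemma square_integrable_diff:
  "square_integrable R F \<Longrightarrow> square_integrable R G \<Longrightarrow> square_integrable R (\<lambda>w. F w - G w)"
  using square_integrable_lin[of F G 1 "-1"] by simp

lemma square_integrable_integrable: "square_integrable R F \<Longrightarrow> integrable R F"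
  using square_integrable_mult[of F "\<lambda>_. 1"] square_integrable_const by simp

lemma integral_square_add_le:
  assumes "square_integrable R F" "square_integrable R G"
  shows "(\<integral>w. (F w + G w)\<^sup>2 \<partial>R) \<le> 2 * (\<integral>w. (F w)\<^sup>2 \<partial>R) + 2 * (\<integral>w. (G w)\<^sup>2 \<partial>R)"
proof -
  have "(\<integral>w. (F w + G w)\<^sup>2 \<partial>R) \<le> (\<integral>w. 2 * (F w)\<^sup>2 + 2 * (G w)\<^sup>2 \<partial>R)"
  proof (rule integral_mono)
    show "(F w + G w)\<^sup>2 \<le> 2 * (F w)\<^sup>2 + 2 * (G w)\<^sup>2" for w
      using sum_squares_bound[of "F w" "G w"] by (simp add: power2_sum)
  qed (use assms square_integrable_add[OF assms] in \<open>auto simp: square_integrable_def\<close>)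
  then show ?thesis using assms by (simp add: square_integrable_def)
qed

lemma L2_approximable_closed:
  assumes F: "square_integrable R F"
    and G: "\<And>\<eta>. \<eta> > 0 \<Longrightarrow> \<exists>G. L2_approximable G \<and> (\<integral>w. (F w - G w)\<^sup>2 \<partial>R) \<le> \<eta>"
  shows "L2_approximable F"
  unfolding L2_approximable_def
proof (intro conjI allI impI F)
  fix \<eta> :: real assume \<eta>: "0 < \<eta>"
  obtain G where g: "L2_approximable G" "(\<integral>w. (F w - G w)\<^sup>2 \<partial>R) \<le> \<eta> / 4" using G[of "\<eta> / 4"] \<eta> by auto
  have g2: "square_integrable R G" using g(1) by (simp add: L2_approximable_def)
  obtain h where h: "cylinder h" "square_integrable R h" "(\<integral>w. (G w - h w)\<^sup>2 \<partial>R) \<le> \<eta> / 4"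
    using g(1) \<eta> unfolding L2_approximable_def by (metis divide_pos_pos zero_less_numeral)
  have "(\<integral>w. ((F w - G w) + (G w - h w))\<^sup>2 \<partial>R) \<le> \<eta>"
    using integral_square_add_le[OF square_integrable_diff[OF F g2] square_integrable_diff[OF g2 h(2)]] g(2) h(3)
    by linarith
  then show "\<exists>h. cylinder h \<and> square_integrable R h \<and> (\<integral>w. (F w - h w)\<^sup>2 \<partial>R) \<le> \<eta>"
    using h by auto
qed

lemma L2_approximable_add:
  assumes F: "L2_approximable F" and G: "L2_approximable G"
  shows "L2_approximable (\<lambda>w. F w + G w)"
  unfolding L2_approximable_def
proof (intro conjI allI impI)
  have sF: "square_integrable R F" and sG: "square_integrable R G"
    using F G by (auto simp: L2_approximable_def)
  then show "square_integrable R (\<lambda>w. F w + G w)" by (rule square_integrable_add)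
  fix \<eta> :: real assume \<eta>: "0 < \<eta>"
  obtain f where f: "cylinder f" "square_integrable R f" "(\<integral>w. (F w - f w)\<^sup>2 \<partial>R) \<le> \<eta> / 4"
    using F \<eta> unfolding L2_approximable_def by (metis divide_pos_pos zero_less_numeral)
  obtain g where g: "cylinder g" "square_integrable R g" "(\<integral>w. (G w - g w)\<^sup>2 \<partial>R) \<le> \<eta> / 4"
    using G \<eta> unfolding L2_approximable_def by (metis divide_pos_pos zero_less_numeral)
  have "(\<integral>w. ((F w - f w) + (G w - g w))\<^sup>2 \<partial>R) \<le> \<eta>"
    using integral_square_add_le[OF square_integrable_diff[OF sF f(2)] square_integrable_diff[OF sG g(2)]] f(3) g(3)
    by linarith
  moreover have "cylinder (\<lambda>w. f w + g w)" using f(1) g(1) by (rule cylinder_combine)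
  moreover have "square_integrable R (\<lambda>w. f w + g w)" using f g by (intro square_integrable_add)
  ultimately show "\<exists>h. cylinder h \<and> square_integrable R h \<and> (\<integral>w. (F w + G w - h w)\<^sup>2 \<partial>R) \<le> \<eta>"
    by (intro exI[of _ "\<lambda>w. f w + g w"]) (simp add: algebra_simps)
qed

lemma L2_approximable_cylinder:
  "cylinder h \<Longrightarrow> square_integrable R h \<Longrightarrow> L2_approximable h"
  unfolding L2_approximable_def by (auto intro!: exI[of _ h])

lemma L2_approximable_sum:
  "(\<And>i. i \<in> A \<Longrightarrow> L2_approximable (G i)) \<Longrightarrow> L2_approximable (\<lambda>w. \<Sum>i\<in>A. G i w)"
proof (induction A rule: infinite_finite_induct)
  case (insert i A) then show ?case by (simp add: L2_approximable_add)
qed (simp_all add: L2_approximable_cylinder cylinder_const square_integrable_const)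

text \<open>The bound is claimed on the space of \<open>R\<close> only: on arbitrary real sequences
  the factors are unbounded.\<close>

lemma monomial_bounded: "\<exists>B. \<forall>w\<in>space R. \<bar>prod_list (map (\<lambda>i. rad_Y p i w) xs)\<bar> \<le> B"
proof (induction xs)
  case (Cons k xs)
  then obtain B where B: "\<And>w. w \<in> space R \<Longrightarrow> \<bar>prod_list (map (\<lambda>i. rad_Y p i w) xs)\<bar> \<le> B" by auto
  let ?C = "max \<bar>(1 - p k + qprob p k) / (2 * sqrt (p k * qprob p k))\<bar>
                \<bar>(-1 - p k + qprob p k) / (2 * sqrt (p k * qprob p k))\<bar>"
  have "\<bar>rad_Y p k w\<bar> \<le> ?C" if "w \<in> space R" for w
  proof -
    have "w k \<in> {-1, 1}"
      using that by (auto simp: rademacher_space_def space_PiM space_point_measure)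
    then show ?thesis unfolding rad_Y_def by auto
  qed
  then have "\<bar>prod_list (map (\<lambda>i. rad_Y p i w) (k # xs))\<bar> \<le> ?C * B" if "w \<in> space R" for w
    using that B by (simp only: list.map prod_list.Cons abs_mult) (intro mult_mono, auto simp: le_max_iff_disj)
  then show ?case by blast
qed auto

lemma square_integrable_monomial:
  "square_integrable R (\<lambda>w. prod_list (map (\<lambda>i. rad_Y p i w) xs))"
proof -
  obtain B where B: "\<And>w. w \<in> space R \<Longrightarrow> \<bar>prod_list (map (\<lambda>i. rad_Y p i w) xs)\<bar> \<le> B"
    using monomial_bounded by blast
  have "integrable R (\<lambda>w. (prod_list (map (\<lambda>i. rad_Y p i w) xs))\<^sup>2)"
  proof (rule R.integrable_const_bound[of _ "B\<^sup>2"])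
    show "AE w in R. norm ((prod_list (map (\<lambda>i. rad_Y p i w) xs))\<^sup>2) \<le> B\<^sup>2"
    proof (rule AE_I2)
      fix w assume "w \<in> space R"
      from power_mono[OF B[OF this], of 2]
      show "norm ((prod_list (map (\<lambda>i. rad_Y p i w) xs))\<^sup>2) \<le> B\<^sup>2" by simp
    qed
  qed measurable
  then show ?thesis by (simp add: square_integrable_def)
qed

lemma L2_small:
  assumes "square_integrable R F" "square_integrable R G"
    and "(\<integral>\<^sup>+w. ennreal ((G w - F w)\<^sup>2) \<partial>R) < ennreal \<eta>" "0 < \<eta>"
  shows "(\<integral>w. (F w - G w)\<^sup>2 \<partial>R) \<le> \<eta>"
proof -
  have "integrable R (\<lambda>w. (G w - F w)\<^sup>2)"
    using square_integrable_diff[OF assms(2,1)] by (simp add: square_integrable_def)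
  then have "ennreal (\<integral>w. (G w - F w)\<^sup>2 \<partial>R) < ennreal \<eta>"
    using assms(3) by (simp add: nn_integral_eq_integral)
  then show ?thesis using assms(4) by (simp add: power2_commute ennreal_less_iff)
qed

lemma multiple_integral_approximable:
  assumes "is_multiple_integral p n f G" shows "L2_approximable G"
proof (rule L2_approximable_closed)
  show G: "square_integrable R G" using assms by (simp add: is_multiple_integral_def)
  fix \<eta> :: real assume \<eta>: "0 < \<eta>"
  let ?S = "\<lambda>A w. \<Sum>xs\<in>A. f xs * prod_list (map (\<lambda>i. rad_Y p i w) xs)"
  have "\<forall>\<^sub>F A in finite_subsets_at_top {xs. length xs = n}.
      (\<integral>\<^sup>+w. ennreal ((?S A w - G w)\<^sup>2) \<partial>R) < ennreal \<eta>"
    using assms \<eta> unfolding is_multiple_integral_def L2_tendsto_def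
    by (intro order_tendstoD(2)[where y = 0]) auto
  then obtain A where A: "finite A" "(\<integral>\<^sup>+w. ennreal ((?S A w - G w)\<^sup>2) \<partial>R) < ennreal \<eta>"
    unfolding eventually_finite_subsets_at_top by blast
  have t: "L2_approximable (\<lambda>w. f xs * prod_list (map (\<lambda>i. rad_Y p i w) xs))" for xs
    using square_integrable_lin[OF square_integrable_monomial[of xs] square_integrable_const[of 0], of "f xs" 0]
      cylinder_combine[OF cylinder_const cylinder_monomial, of "(*)" "f xs" p xs]
    by (intro L2_approximable_cylinder) auto
  have S: "L2_approximable (?S A)" by (intro L2_approximable_sum t)
  then have "(\<integral>w. (G w - ?S A w)\<^sup>2 \<partial>R) \<le> \<eta>"
    using A(2) \<eta> by (intro L2_small G) (auto simp: L2_approximable_def)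
  with S show "\<exists>H. L2_approximable H \<and> (\<integral>w. (G w - H w)\<^sup>2 \<partial>R) \<le> \<eta>" by blast
qed

text \<open>Partial sums of the chaos decomposition are sums of multiple integrals, and each of
  these is a mean-square limit of finite sums of monomials. Closedness under such limits is used
  once for the tuples and once for the order of the chaos.\<close>

lemma malliavin_dom_approximable:
  assumes "F \<in> malliavin_dom p r" shows "L2_approximable F"
proof (rule L2_approximable_closed)
  show F: "square_integrable R F" using assms by (simp add: malliavin_dom_def)
  obtain f where "is_chaos_kernels p F f" using assms by (auto simp: malliavin_dom_def)
  then obtain G where G: "\<And>n. n \<ge> 1 \<Longrightarrow> is_multiple_integral p n (f n) (G n)"
    and lim: "L2_tendsto R (\<lambda>K w. (\<integral>w'. F w' \<partial>R) + (\<Sum>n=1..K. G n w)) F sequentially"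
    unfolding is_chaos_kernels_def by blast
  fix \<eta> :: real assume \<eta>: "0 < \<eta>"
  let ?S = "\<lambda>K w. (\<integral>w'. F w' \<partial>R) + (\<Sum>n=1..K. G n w)"
  have "\<forall>\<^sub>F K in sequentially. (\<integral>\<^sup>+w. ennreal ((?S K w - F w)\<^sup>2) \<partial>R) < ennreal \<eta>"
    using lim \<eta> unfolding L2_tendsto_def by (intro order_tendstoD(2)[where y = 0]) auto
  then obtain K where K: "(\<integral>\<^sup>+w. ennreal ((?S K w - F w)\<^sup>2) \<partial>R) < ennreal \<eta>"
    by (auto simp: eventually_sequentially)
  have S: "L2_approximable (?S K)"
    by (intro L2_approximable_add L2_approximable_sum multiple_integral_approximable[OF G])
       (auto simp: L2_approximable_cylinder cylinder_const square_integrable_const)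
  then have "(\<integral>w. (F w - ?S K w)\<^sup>2 \<partial>R) \<le> \<eta>"
    using K \<eta> by (intro L2_small F) (auto simp: L2_approximable_def)
  with S show "\<exists>H. L2_approximable H \<and> (\<integral>w. (F w - H w)\<^sup>2 \<partial>R) \<le> \<eta>" by blast
qed

end

context rademacher
begin

lemma L1_approximable_mult:
  assumes F: "L2_approximable F" and G: "L2_approximable G"
  shows "L1_approximable (\<lambda>w. F w * G w)"
  unfolding L1_approximable_def
proof (intro conjI allI impI)
  have sF: "square_integrable R F" and sG: "square_integrable R G"
    using F G by (auto simp: L2_approximable_def)
  then show iFG: "integrable R (\<lambda>w. F w * G w)" by (rule square_integrable_mult)
  fix \<epsilon> :: real assume \<epsilon>: "0 < \<epsilon>"
  define A where "A = (\<integral>w. (F w)\<^sup>2 \<partial>R) + (\<integral>w. (G w)\<^sup>2 \<partial>R) + 2"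
  have A: "A > 0" unfolding A_def by (intro add_nonneg_pos add_nonneg_nonneg) auto
  define \<eta> where "\<eta> = min 1 (\<epsilon> / A)"
  have \<eta>: "0 < \<eta>" "\<eta> \<le> 1" "\<eta> * A \<le> \<epsilon>" using A \<epsilon> by (auto simp: \<eta>_def min_def field_simps)
  obtain f where f: "cylinder f" "square_integrable R f" "(\<integral>w. (F w - f w)\<^sup>2 \<partial>R) \<le> \<eta>\<^sup>2"
    using F \<eta>(1) unfolding L2_approximable_def by (metis zero_less_power)
  obtain g where g: "cylinder g" "square_integrable R g" "(\<integral>w. (G w - g w)\<^sup>2 \<partial>R) \<le> \<eta>\<^sup>2"
    using G \<eta>(1) unfolding L2_approximable_def by (metis zero_less_power)
  let ?f = "\<lambda>w. F w - f w" and ?g = "\<lambda>w. G w - g w"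
  have s2: "integrable R (\<lambda>w. (F w)\<^sup>2)" "integrable R (\<lambda>w. (G w)\<^sup>2)"
      "integrable R (\<lambda>w. (?f w)\<^sup>2)" "integrable R (\<lambda>w. (?g w)\<^sup>2)"
    using sF sG square_integrable_diff[OF sF f(2)] square_integrable_diff[OF sG g(2)]
    by (auto simp: square_integrable_def)
  \<comment> \<open>Young's inequality is weighted by \<eta> because the errors of \<open>f\<close>
    and \<open>g\<close> have mean square at most the square of \<eta>: each mixed term then becomes
    of order \<eta>, and \<open>A\<close> collects the constants.\<close>
  have yi: "\<bar>x * y\<bar> \<le> \<eta> / 2 * x\<^sup>2 + 1 / (2 * \<eta>) * y\<^sup>2" for x y :: real
  proof -
    have "2 * \<bar>\<eta> * x\<bar> * \<bar>y\<bar> \<le> (\<eta> * x)\<^sup>2 + y\<^sup>2"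
      using sum_squares_bound[of "\<bar>\<eta> * x\<bar>" "\<bar>y\<bar>"] unfolding power2_abs .
    then show ?thesis using \<eta>(1) by (simp add: abs_mult field_simps power2_eq_square)
  qed
  have pt: "\<bar>F w * G w - f w * g w\<bar> \<le> \<eta> / 2 * (F w)\<^sup>2 + 1 / (2 * \<eta>) * (?g w)\<^sup>2
      + (\<eta> / 2 * (G w)\<^sup>2 + 1 / (2 * \<eta>) * (?f w)\<^sup>2) + (1/2 * (?f w)\<^sup>2 + 1/2 * (?g w)\<^sup>2)" for w
  proof -
    have "F w * G w - f w * g w = F w * ?g w + G w * ?f w - ?f w * ?g w" by (simp add: algebra_simps)
    moreover have "\<bar>?f w * ?g w\<bar> \<le> 1/2 * (?f w)\<^sup>2 + 1/2 * (?g w)\<^sup>2"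
      using sum_squares_bound[of "\<bar>?f w\<bar>" "\<bar>?g w\<bar>"] by (simp add: abs_mult)
    ultimately show ?thesis using yi[of "F w" "?g w"] yi[of "G w" "?f w"] by linarith
  qed
  have ifg: "integrable R (\<lambda>w. f w * g w)" using f g by (intro square_integrable_mult)
  have "(\<integral>w. \<bar>F w * G w - f w * g w\<bar> \<partial>R) \<le> (\<integral>w. \<eta> / 2 * (F w)\<^sup>2 + 1 / (2 * \<eta>) * (?g w)\<^sup>2
      + (\<eta> / 2 * (G w)\<^sup>2 + 1 / (2 * \<eta>) * (?f w)\<^sup>2) + (1/2 * (?f w)\<^sup>2 + 1/2 * (?g w)\<^sup>2) \<partial>R)"
    by (rule integral_mono[OF _ _ pt])
      (intro integrable_abs Bochner_Integration.integrable_diff iFG ifg,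
       intro Bochner_Integration.integrable_add integrable_mult_right s2)
  also have "\<dots> = \<eta> / 2 * (\<integral>w. (F w)\<^sup>2 \<partial>R) + 1 / (2 * \<eta>) * (\<integral>w. (?g w)\<^sup>2 \<partial>R)
      + (\<eta> / 2 * (\<integral>w. (G w)\<^sup>2 \<partial>R) + 1 / (2 * \<eta>) * (\<integral>w. (?f w)\<^sup>2 \<partial>R))
      + (1/2 * (\<integral>w. (?f w)\<^sup>2 \<partial>R) + 1/2 * (\<integral>w. (?g w)\<^sup>2 \<partial>R))"
    using s2 by simp
  also have "\<dots> \<le> \<eta> / 2 * (\<integral>w. (F w)\<^sup>2 \<partial>R) + 1 / (2 * \<eta>) * \<eta>\<^sup>2
      + (\<eta> / 2 * (\<integral>w. (G w)\<^sup>2 \<partial>R) + 1 / (2 * \<eta>) * \<eta>\<^sup>2) + (1/2 * \<eta>\<^sup>2 + 1/2 * \<eta>\<^sup>2)"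
    using f g \<eta> by (intro add_mono mult_left_mono) auto
  also have "\<dots> = \<eta> / 2 * ((\<integral>w. (F w)\<^sup>2 \<partial>R) + (\<integral>w. (G w)\<^sup>2 \<partial>R)) + \<eta> + \<eta> * \<eta>"
    using \<eta>(1) by (simp add: field_simps power2_eq_square)
  also have "\<dots> \<le> \<eta> * ((\<integral>w. (F w)\<^sup>2 \<partial>R) + (\<integral>w. (G w)\<^sup>2 \<partial>R)) + \<eta> + \<eta> * 1"
    using \<eta> by (intro add_mono mult_left_mono mult_right_mono) auto
  also have "\<dots> = \<eta> * A" by (simp add: A_def algebra_simps)
  also note \<eta>(3)
  finally have "(\<integral>w. \<bar>F w * G w - f w * g w\<bar> \<partial>R) \<le> \<epsilon>" .
  moreover have "cylinder (\<lambda>w. f w * g w)" using f(1) g(1) by (rule cylinder_combine)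
  ultimately show "\<exists>h. cylinder h \<and> integrable R h \<and> (\<integral>w. \<bar>F w * G w - h w\<bar> \<partial>R) \<le> \<epsilon>"
    using ifg by blast
qed

lemma L2_approximable_imp_L1: "L2_approximable F \<Longrightarrow> L1_approximable F"
  using L1_approximable_mult[of F "\<lambda>_. 1"]
    L2_approximable_cylinder[OF cylinder_const square_integrable_const, of 1] by simp

lemma square_integrable_e:
  assumes "square_integrable R F" shows "square_integrable R (e n F)"
proof -
  have F: "F \<in> borel_measurable R" "integrable R (\<lambda>w. (F w)\<^sup>2)"
    using assms by (auto simp: square_integrable_def)
  have m: "e n F \<in> borel_measurable R" using F(1) by (rule mehler_measurable)
  have "integrable R (\<lambda>w. (e n F w)\<^sup>2)"
  proof (rule Bochner_Integration.integrable_bound[OF integrable_e[OF F(2), of n]])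
    have "(e n F w)\<^sup>2 \<le> e n (\<lambda>w. (F w)\<^sup>2) w" for w by (rule mehler_power2_le) auto
    then show "AE w in R. norm ((e n F w)\<^sup>2) \<le> norm (e n (\<lambda>w. (F w)\<^sup>2) w)"
      by (intro AE_I2) (auto intro: order_trans[OF _ abs_ge_self])
  qed (use m in measurable)
  then show ?thesis using m by (simp add: square_integrable_def)
qed

lemma integral_power2_le:
  assumes "square_integrable R X" shows "(\<integral>w. X w \<partial>R)\<^sup>2 \<le> (\<integral>w. (X w)\<^sup>2 \<partial>R)"
proof -
  have "0 \<le> (\<integral>w. (X w - (\<integral>w. X w \<partial>R))\<^sup>2 \<partial>R)"
    by (rule Bochner_Integration.integral_nonneg) simp
  moreover have "(\<integral>w. (X w - (\<integral>w. X w \<partial>R))\<^sup>2 \<partial>R) = (\<integral>w. (X w)\<^sup>2 \<partial>R) - (\<integral>w. X w \<partial>R)\<^sup>2"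
    using R.variance_eq[of X] assms square_integrable_integrable[OF assms]
    by (simp add: square_integrable_def)
  ultimately show ?thesis by linarith
qed

text \<open>The mean-square version is needed for the products of conditional means that arise from
  recentring.\<close>

lemma e_L2_limit:
  assumes F: "L2_approximable F" and F0: "(\<integral>w. F w \<partial>R) = 0"
  shows "(\<lambda>n. \<integral>w. (e n F w)\<^sup>2 \<partial>R) \<longlonglongrightarrow> 0"
proof (rule LIMSEQ_I)
  fix \<epsilon> :: real assume \<epsilon>: "0 < \<epsilon>"
  have sF: "square_integrable R F" using F by (simp add: L2_approximable_def)
  obtain h m where h: "depends_on_first m h" "square_integrable R h" "(\<integral>w. (F w - h w)\<^sup>2 \<partial>R) \<le> \<epsilon> / 5"
    using F \<epsilon> unfolding L2_approximable_def cylinder_def by (metis divide_pos_pos zero_less_numeral)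
  let ?d = "\<lambda>w. F w - h w"
  have sd: "square_integrable R ?d" using sF h(2) by (rule square_integrable_diff)
  have "\<bar>\<integral>w. (e n F w)\<^sup>2 \<partial>R\<bar> < \<epsilon>" if n: "m \<le> n" for n
  proof -
    have c: "e n h w = (\<integral>w. h w \<partial>R)" for w
    proof -
      have "(\<integral>w. h w \<partial>R) = (\<integral>w'. e n h w \<partial>R)"
        unfolding integral_e[OF square_integrable_integrable[OF h(2)], of n, symmetric]
        using head_mean_constant[OF h(1) n] by metis
      then show ?thesis by (simp add: R.prob_space)
    qed
    \<comment> \<open>As \<open>F\<close> is centred, the mean of \<open>h\<close> is itself an
      approximation error.\<close>
    have "(\<integral>w. h w \<partial>R) = - (\<integral>w. ?d w \<partial>R)"
      using F0 square_integrable_integrable[OF sF] square_integrable_integrable[OF h(2)] by simp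
    then have c2: "(\<integral>w. h w \<partial>R)\<^sup>2 \<le> \<epsilon> / 5" using integral_power2_le[OF sd] h(3) by simp
    have "e n F = (\<lambda>w. e n ?d w + (\<integral>w. h w \<partial>R))" by (simp add: mehler_diff c)
    then have "(\<integral>w. (e n F w)\<^sup>2 \<partial>R) = (\<integral>w. (e n ?d w + (\<integral>w. h w \<partial>R))\<^sup>2 \<partial>R)" by simp
    also have "\<dots> \<le> 2 * (\<integral>w. (e n ?d w)\<^sup>2 \<partial>R) + 2 * (\<integral>w. h w \<partial>R)\<^sup>2"
      using integral_square_add_le[OF square_integrable_e[OF sd] square_integrable_const, of n "\<integral>w. h w \<partial>R"]
      by (simp add: R.prob_space)
    also have "(\<integral>w. (e n ?d w)\<^sup>2 \<partial>R) \<le> (\<integral>w. e n (\<lambda>w. (?d w)\<^sup>2) w \<partial>R)"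
      using square_integrable_e[OF sd, of n] sd
      by (intro integral_mono mehler_power2_le integrable_e) (auto simp: square_integrable_def)
    also have "\<dots> = (\<integral>w. (?d w)\<^sup>2 \<partial>R)"
      using sd by (intro integral_e) (simp add: square_integrable_def)
    finally have "(\<integral>w. (e n F w)\<^sup>2 \<partial>R) \<le> 2 * (\<epsilon> / 5) + 2 * (\<epsilon> / 5)" using c2 h(3) by linarith
    then have "(\<integral>w. (e n F w)\<^sup>2 \<partial>R) < \<epsilon>" using \<epsilon> by linarith
    then show ?thesis by simp
  qed
  then show "\<exists>m. \<forall>n\<ge>m. norm ((\<integral>w. (e n F w)\<^sup>2 \<partial>R) - 0) < \<epsilon>" by auto
qed

lemma sum_le_suminf_ennreal: "(\<Sum>k<n. f k) \<le> (\<Sum>k. f k :: ennreal)"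
  by (rule sum_le_suminf) auto

lemma triple_sum_le_suminf:
  fixes f :: "nat \<Rightarrow> nat \<Rightarrow> nat \<Rightarrow> ennreal"
  shows "(\<Sum>k<n. \<Sum>l<n. \<Sum>m<n. f k l m) \<le> (\<Sum>k. \<Sum>l. \<Sum>m. f k l m)"
proof -
  have "(\<Sum>k<n. \<Sum>l<n. \<Sum>m<n. f k l m) \<le> (\<Sum>k<n. \<Sum>l<n. \<Sum>m. f k l m)"
    by (intro sum_mono sum_le_suminf_ennreal)
  also have "\<dots> \<le> (\<Sum>k<n. \<Sum>l. \<Sum>m. f k l m)" by (intro sum_mono sum_le_suminf_ennreal)
  also have "\<dots> \<le> (\<Sum>k. \<Sum>l. \<Sum>m. f k l m)" by (rule sum_le_suminf_ennreal)
  finally show ?thesis .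
qed

lemma eexp_e: "G \<in> borel_measurable R \<Longrightarrow> (\<And>w. 0 \<le> G w) \<Longrightarrow> (\<integral>\<^sup>+w. ennreal (e n G w) \<partial>R) = eexp p G"
  by (simp add: eexp_def nn_integral_e)

lemma nn_integral_sqrt_e_mult:
  assumes "X \<in> borel_measurable R" "Y \<in> borel_measurable R" "\<And>w. 0 \<le> X w" "\<And>w. 0 \<le> Y w"
  shows "(\<integral>\<^sup>+w. ennreal (sqrt (e n X w) * sqrt (e n Y w)) \<partial>R)
     \<le> epowr (eexp p X) (1/2) * epowr (eexp p Y) (1/2)"
  using nn_integral_sqrt_mult[of "e n X" R "e n Y"] assms
  by (simp add: eexp_e mehler_measurable e_nonneg)

lemma nn_integral_sqrt_sum:
  assumes f: "\<And>k l m. f k l m \<in> borel_measurable R" "\<And>k l m w. 0 \<le> f k l m w"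
    and c: "0 \<le> c" "0 \<le> b" "b\<^sup>2 \<le> c"
    and B: "\<And>k l m. (\<integral>\<^sup>+w. ennreal (f k l m w) \<partial>R) \<le> B k l m"
  shows "(\<integral>\<^sup>+w. ennreal (b * sqrt (\<Sum>k<n. \<Sum>l<n. \<Sum>m<n. f k l m w)) \<partial>R)
    \<le> epowr (ennreal c * (\<Sum>k. \<Sum>l. \<Sum>m. B k l m)) (1/2)"
proof -
  let ?Z = "\<lambda>w. \<Sum>k<n. \<Sum>l<n. \<Sum>m<n. f k l m w"
  have Z: "0 \<le> ?Z w" for w by (intro sum_nonneg f)
  have Zm [measurable]: "?Z \<in> borel_measurable R" by (intro borel_measurable_sum f)
  have "(\<integral>\<^sup>+w. ennreal (b * sqrt (?Z w)) \<partial>R) \<le> (\<integral>\<^sup>+w. ennreal (sqrt (c * ?Z w)) \<partial>R)"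
  proof (intro nn_integral_mono ennreal_leI)
    fix w
    have "b \<le> sqrt c" using c by (intro real_le_rsqrt)
    then show "b * sqrt (?Z w) \<le> sqrt (c * ?Z w)"
      using Z[of w] by (simp add: real_sqrt_mult mult_right_mono)
  qed
  also have "\<dots> \<le> epowr (\<integral>\<^sup>+w. ennreal (c * ?Z w) \<partial>R) (1/2)"
    using c Z by (intro R.nn_integral_sqrt) auto
  also have "\<dots> \<le> epowr (ennreal c * (\<Sum>k. \<Sum>l. \<Sum>m. B k l m)) (1/2)"
  proof (intro epowr_mono)
    have "(\<integral>\<^sup>+w. ennreal (c * ?Z w) \<partial>R) = ennreal c * (\<integral>\<^sup>+w. ennreal (?Z w) \<partial>R)"
      using c Z by (simp add: ennreal_mult nn_integral_cmult)
    also have "(\<integral>\<^sup>+w. ennreal (?Z w) \<partial>R)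
        = (\<integral>\<^sup>+w. (\<Sum>k<n. \<Sum>l<n. \<Sum>m<n. ennreal (f k l m w)) \<partial>R)"
      by (intro nn_integral_cong) (simp add: f(2) sum_nonneg)
    also have "\<dots> = (\<Sum>k<n. \<Sum>l<n. \<Sum>m<n. (\<integral>\<^sup>+w. ennreal (f k l m w) \<partial>R))"
      using f(1) by (simp add: nn_integral_sum)
    also have "\<dots> \<le> (\<Sum>k<n. \<Sum>l<n. \<Sum>m<n. B k l m)" by (intro sum_mono B)
    also have "\<dots> \<le> (\<Sum>k. \<Sum>l. \<Sum>m. B k l m)" by (rule triple_sum_le_suminf)
    finally show "(\<integral>\<^sup>+w. ennreal (c * ?Z w) \<partial>R) \<le> ennreal c * (\<Sum>k. \<Sum>l. \<Sum>m. B k l m)"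
      by (simp add: mult_left_mono)
  qed simp
  finally show ?thesis .
qed

lemma nn_integral_weighted_sum:
  assumes f: "\<And>k. f k \<in> borel_measurable R" "\<And>k w. 0 \<le> f k w"
    and v: "\<And>k. 0 \<le> v k" and c: "0 \<le> c"
    and B: "\<And>k. (\<integral>\<^sup>+w. ennreal (f k w) \<partial>R) \<le> B k"
  shows "(\<integral>\<^sup>+w. ennreal (c * (\<Sum>k<n. v k * f k w)) \<partial>R) \<le> ennreal c * (\<Sum>k. ennreal (v k) * B k)"
proof -
  have "(\<integral>\<^sup>+w. ennreal (c * (\<Sum>k<n. v k * f k w)) \<partial>R)
      = (\<integral>\<^sup>+w. ennreal c * (\<Sum>k<n. ennreal (v k) * ennreal (f k w)) \<partial>R)"
    using f(2) v c
    by (intro nn_integral_cong) (simp add: ennreal_mult sum_nonneg sum_ennreal[symmetric] del: sum_ennreal)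
  also have "\<dots> = ennreal c * (\<Sum>k<n. ennreal (v k) * (\<integral>\<^sup>+w. ennreal (f k w) \<partial>R))"
    using f(1) by (simp add: nn_integral_sum nn_integral_cmult)
  also have "\<dots> \<le> ennreal c * (\<Sum>k<n. ennreal (v k) * B k)"
    by (intro mult_left_mono sum_mono B) auto
  also have "\<dots> \<le> ennreal c * (\<Sum>k. ennreal (v k) * B k)"
    by (intro mult_left_mono sum_le_suminf_ennreal) auto
  finally show ?thesis .
qed

lemma sqrt_measurable: "f \<in> borel_measurable R \<Longrightarrow> (\<lambda>w. sqrt (f w)) \<in> borel_measurable R"
  by (rule measurable_compose[of f R borel sqrt borel])
     (auto intro!: borel_measurable_continuous_onI continuous_intros)

lemma sqrt_e_measurable:
  "G \<in> borel_measurable R \<Longrightarrow> (\<lambda>w. sqrt (e n G w)) \<in> borel_measurable R"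
  by (intro sqrt_measurable mehler_measurable)

lemma DD_measurable:
  assumes F: "F \<in> borel_measurable R"
  shows "(\<lambda>w. (D k F w)\<^sup>2 * (D l F w)\<^sup>2) \<in> borel_measurable R"
    "(\<lambda>w. (D m (D k F) w)\<^sup>2 * (D m (D l F) w)\<^sup>2) \<in> borel_measurable R"
    "(\<lambda>w. (D k F w) ^ a) \<in> borel_measurable R"
  by (intro borel_measurable_times borel_measurable_power D_measurable F)+

lemma ennreal_fracs: "ennreal (15/4) = 15/4" "ennreal (3/4) = 3/4" "ennreal (1/2) = 1/2"
  using divide_ennreal[of 15 4] divide_ennreal[of 3 4] divide_ennreal[of 1 2] by simp_all

lemma nn_integral_b1:
  assumes F: "\<And>i. F i \<in> borel_measurable R"
  shows "(\<integral>\<^sup>+w. ennreal (3/2 * b1 n (F i) (F j) w) \<partial>R) \<le> bound_B1 p F i j"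
  unfolding b1_def bound_B1_def ennreal_fracs(1)[symmetric]
proof (rule nn_integral_sqrt_sum)
  fix k l m
  let ?X = "\<lambda>w. (D k (F i) w)\<^sup>2 * (D l (F i) w)\<^sup>2"
  let ?Y = "\<lambda>w. (D m (D k (F j)) w)\<^sup>2 * (D m (D l (F j)) w)\<^sup>2"
  show "(\<lambda>w. sqrt (e n ?X w) * sqrt (e n ?Y w)) \<in> borel_measurable R"
    by (intro borel_measurable_times sqrt_e_measurable DD_measurable F)
  show "0 \<le> sqrt (e n ?X w) * sqrt (e n ?Y w)" for w
    by (intro mult_nonneg_nonneg real_sqrt_ge_zero e_nonneg) auto
  show "(\<integral>\<^sup>+w. ennreal (sqrt (e n ?X w) * sqrt (e n ?Y w)) \<partial>R)
      \<le> epowr (eexp p ?X) (1/2) * epowr (eexp p ?Y) (1/2)"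
    by (intro nn_integral_sqrt_e_mult DD_measurable F) auto
qed (simp_all add: power2_eq_square)

lemma nn_integral_b2:
  assumes F: "\<And>i. F i \<in> borel_measurable R"
  shows "(\<integral>\<^sup>+w. ennreal (1/2 * b2 n (F i) (F j) w) \<partial>R) \<le> bound_B2 p F i j"
  unfolding b2_def bound_B2_def ennreal_fracs(2)[symmetric]
proof (rule nn_integral_sqrt_sum)
  fix k l m
  let ?w = "1 / (p m * qprob p m)"
  let ?X = "\<lambda>w. (D m (D k (F i)) w)\<^sup>2 * (D m (D l (F i)) w)\<^sup>2"
  let ?Y = "\<lambda>w. (D m (D k (F j)) w)\<^sup>2 * (D m (D l (F j)) w)\<^sup>2"
  have w: "0 \<le> ?w" using pq_pos[of m] by simp
  have m: "(\<lambda>w. sqrt (e n ?X w) * sqrt (e n ?Y w)) \<in> borel_measurable R"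
    by (intro borel_measurable_times sqrt_e_measurable DD_measurable F)
  show "(\<lambda>w. ?w * sqrt (e n ?X w) * sqrt (e n ?Y w)) \<in> borel_measurable R"
    by (intro borel_measurable_times borel_measurable_const sqrt_e_measurable DD_measurable F)
  have nn: "0 \<le> sqrt (e n ?X w) * sqrt (e n ?Y w)" for w
    by (intro mult_nonneg_nonneg real_sqrt_ge_zero e_nonneg) auto
  then show "0 \<le> ?w * sqrt (e n ?X w) * sqrt (e n ?Y w)" for w
    using w by (simp only: mult.assoc) (rule mult_nonneg_nonneg)
  have "(\<integral>\<^sup>+w. ennreal (?w * sqrt (e n ?X w) * sqrt (e n ?Y w)) \<partial>R)
      = ennreal ?w * (\<integral>\<^sup>+w. ennreal (sqrt (e n ?X w) * sqrt (e n ?Y w)) \<partial>R)"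
    using nn w m by (simp only: mult.assoc ennreal_mult nn_integral_cmult measurable_compose[OF m measurable_ennreal])
  also have "\<dots> \<le> ennreal ?w * (epowr (eexp p ?X) (1/2) * epowr (eexp p ?Y) (1/2))"
    by (intro mult_left_mono nn_integral_sqrt_e_mult DD_measurable F) auto
  finally show "(\<integral>\<^sup>+w. ennreal (?w * sqrt (e n ?X w) * sqrt (e n ?Y w)) \<partial>R)
      \<le> ennreal ?w * epowr (eexp p ?X) (1/2) * epowr (eexp p ?Y) (1/2)"
    by (simp only: mult.assoc)
qed (simp_all add: power2_eq_square)

lemma nn_integral_b3:
  fixes F :: "'d::finite \<Rightarrow> (nat \<Rightarrow> real) \<Rightarrow> real"
  assumes F: "\<And>i. F i \<in> borel_measurable R"
  shows "(\<integral>\<^sup>+w. ennreal (1/2 * real CARD('d) powr (3/2) * b3 n (F i) (F j) w) \<partial>R) \<le> bound_B3 p F i j"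
  unfolding b3_def bound_B3_def mult.assoc[of "_ / _" "sqrt _"] mult.assoc[of "ennreal (_ / _)"]
proof (rule nn_integral_weighted_sum)
  fix k
  let ?X = "\<lambda>w. (D k (F i) w)\<^sup>2" and ?Y = "\<lambda>w. (D k (F j) w) ^ 4"
  show "(\<lambda>w. sqrt (e n ?X w) * sqrt (e n ?Y w)) \<in> borel_measurable R"
    by (intro borel_measurable_times sqrt_e_measurable DD_measurable F)
  show "0 \<le> sqrt (e n ?X w) * sqrt (e n ?Y w)" for w
    by (intro mult_nonneg_nonneg real_sqrt_ge_zero e_nonneg) auto
  show "0 \<le> \<bar>p k - qprob p k\<bar> / sqrt (p k * qprob p k)" using pq_pos[of k] by simp
  show "(\<integral>\<^sup>+w. ennreal (sqrt (e n ?X w) * sqrt (e n ?Y w)) \<partial>R)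
      \<le> epowr (eexp p ?X) (1/2) * epowr (eexp p ?Y) (1/2)"
    by (intro nn_integral_sqrt_e_mult DD_measurable F) auto
qed simp

lemma nn_integral_b4:
  fixes F :: "'d::finite \<Rightarrow> (nat \<Rightarrow> real) \<Rightarrow> real"
  assumes F: "\<And>i. F i \<in> borel_measurable R"
  shows "(\<integral>\<^sup>+w. ennreal (5/12 * real CARD('d) ^ 2 * b4 n (F i) (F j) w) \<partial>R) \<le> bound_B4 p F i j"
  unfolding b4_def bound_B4_def mult.assoc[of "ennreal (_ / _)"]
proof (rule nn_integral_weighted_sum)
  fix k
  let ?X = "\<lambda>w. (D k (F i) w) ^ 4" and ?Y = "\<lambda>w. (D k (F j) w) ^ 4"
  let ?S = "\<lambda>w. sqrt (e n ?X w) * sqrt (e n ?Y w)"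
  have S: "?S \<in> borel_measurable R"
    by (intro borel_measurable_times sqrt_e_measurable DD_measurable F)
  have nnY: "0 \<le> e n ?Y w" for w by (intro e_nonneg) auto
  have nnS: "0 \<le> ?S w" for w
    by (intro mult_nonneg_nonneg real_sqrt_ge_zero e_nonneg) auto
  show "(\<lambda>w. sqrt (?S w) * sqrt (e n ?Y w)) \<in> borel_measurable R"
    by (intro borel_measurable_times sqrt_measurable S sqrt_e_measurable DD_measurable F)
  show "0 \<le> sqrt (?S w) * sqrt (e n ?Y w)" for w
    by (rule mult_nonneg_nonneg[OF real_sqrt_ge_zero[OF nnS] real_sqrt_ge_zero[OF nnY]])
  show "0 \<le> 1 / (p k * qprob p k)" using pq_pos[of k] by simp
  \<comment> \<open>Two nested Cauchy-Schwarz inequalities follow the nested roots of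
    \<open>b4\<close>: the inner one leaves the exponent 1/4 twice, the outer one adds 1/2 to that
    of \<open>Y\<close>, which makes 3/4.\<close>
  have "(\<integral>\<^sup>+w. ennreal (sqrt (?S w) * sqrt (e n ?Y w)) \<partial>R)
      \<le> epowr (\<integral>\<^sup>+w. ennreal (?S w) \<partial>R) (1/2) * epowr (\<integral>\<^sup>+w. ennreal (e n ?Y w) \<partial>R) (1/2)"
    by (intro nn_integral_sqrt_mult S mehler_measurable DD_measurable F nnS nnY)
  also have "(\<integral>\<^sup>+w. ennreal (e n ?Y w) \<partial>R) = eexp p ?Y"
    by (intro eexp_e DD_measurable F) auto
  also have "epowr (\<integral>\<^sup>+w. ennreal (?S w) \<partial>R) (1/2)
      \<le> epowr (epowr (eexp p ?X) (1/2) * epowr (eexp p ?Y) (1/2)) (1/2)"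
    by (intro epowr_mono nn_integral_sqrt_e_mult DD_measurable F) auto
  also have "\<dots> = epowr (eexp p ?X) (1/4) * epowr (eexp p ?Y) (1/4)"
    by (simp add: epowr_mult epowr_epowr)
  finally show "(\<integral>\<^sup>+w. ennreal (sqrt (?S w) * sqrt (e n ?Y w)) \<partial>R)
      \<le> epowr (eexp p ?X) (1/4) * epowr (eexp p ?Y) (3/4)"
    using epowr_add[of "1/4" "1/2" "eexp p ?Y"] by (simp add: mult.assoc mult_right_mono)
qed simp

lemma b_nonneg: "0 \<le> b1 n F G w" "0 \<le> b2 n F G w" "0 \<le> b3 n F G w" "0 \<le> b4 n F G w"
proof -
  have pq: "0 \<le> p k * qprob p k" for k using pq_pos[of k] by simp
  have sq: "0 \<le> sqrt (e n (\<lambda>w. (X w)\<^sup>2) w)" "0 \<le> sqrt (e n (\<lambda>w. (X w) ^ 4) w)"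
    "0 \<le> sqrt (e n (\<lambda>w. (X w)\<^sup>2 * (Y w)\<^sup>2) w)" for X Y :: "(nat \<Rightarrow> real) \<Rightarrow> real"
    by (intro real_sqrt_ge_zero e_nonneg; simp)+
  show "0 \<le> b1 n F G w" unfolding b1_def
    by (intro real_sqrt_ge_zero sum_nonneg mult_nonneg_nonneg sq)
  show "0 \<le> b2 n F G w" unfolding b2_def
    by (intro real_sqrt_ge_zero sum_nonneg mult_nonneg_nonneg divide_nonneg_nonneg sq pq) simp
  show "0 \<le> b3 n F G w" unfolding b3_def
    by (intro real_sqrt_ge_zero sum_nonneg mult_nonneg_nonneg divide_nonneg_nonneg sq pq) auto
  show "0 \<le> b4 n F G w" unfolding b4_def
    by (intro sum_nonneg mult_nonneg_nonneg divide_nonneg_nonneg real_sqrt_ge_zero[of "sqrt _ * sqrt _"] sq pq) auto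
qed

lemma b_measurable:
  assumes "F \<in> borel_measurable R" "G \<in> borel_measurable R"
  shows "b1 n F G \<in> borel_measurable R" "b2 n F G \<in> borel_measurable R"
    "b3 n F G \<in> borel_measurable R" "b4 n F G \<in> borel_measurable R"
  unfolding b1_def[abs_def] b2_def[abs_def] b3_def[abs_def] b4_def[abs_def]
  by (intro sqrt_measurable borel_measurable_sum borel_measurable_times borel_measurable_const
      mehler_measurable DD_measurable assms)+

lemma bsum_nonneg: "0 \<le> bsum n F i j w"
  unfolding bsum_def by (intro add_nonneg_nonneg mult_nonneg_nonneg b_nonneg) auto

lemma bsum_measurable:
  fixes F :: "'d::finite \<Rightarrow> (nat \<Rightarrow> real) \<Rightarrow> real"
  assumes F: "\<And>i. F i \<in> borel_measurable R"
  shows "bsum n F i j \<in> borel_measurable R"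
  unfolding bsum_def[abs_def]
  by (intro borel_measurable_add borel_measurable_times borel_measurable_const b_measurable F)

lemma nn_integral_bsum:
  fixes F :: "'d::finite \<Rightarrow> (nat \<Rightarrow> real) \<Rightarrow> real"
  assumes F: "\<And>i. F i \<in> borel_measurable R"
  shows "(\<integral>\<^sup>+w. ennreal (bsum n F i j w) \<partial>R)
    \<le> bound_B1 p F i j + bound_B2 p F i j + bound_B3 p F i j + bound_B4 p F i j"
proof -
  let ?f1 = "\<lambda>w. 3/2 * b1 n (F i) (F j) w" and ?f2 = "\<lambda>w. 1/2 * b2 n (F i) (F j) w"
  let ?f3 = "\<lambda>w. 1/2 * real CARD('d) powr (3/2) * b3 n (F i) (F j) w"
  let ?f4 = "\<lambda>w. 5/12 * real CARD('d) ^ 2 * b4 n (F i) (F j) w"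
  have m: "?f1 \<in> borel_measurable R" "?f2 \<in> borel_measurable R" "?f3 \<in> borel_measurable R" "?f4 \<in> borel_measurable R"
    by (intro borel_measurable_times borel_measurable_const b_measurable F)+
  have nn: "0 \<le> ?f1 w" "0 \<le> ?f2 w" "0 \<le> ?f3 w" "0 \<le> ?f4 w" for w
    by (intro mult_nonneg_nonneg b_nonneg; simp)+
  have "(\<integral>\<^sup>+w. ennreal (bsum n F i j w) \<partial>R)
     = (\<integral>\<^sup>+w. ennreal (?f1 w) + ennreal (?f2 w) + ennreal (?f3 w) + ennreal (?f4 w) \<partial>R)"
    unfolding bsum_def using nn by (simp only: ennreal_plus add_nonneg_nonneg)
  also have "\<dots> = (\<integral>\<^sup>+w. ennreal (?f1 w) \<partial>R) + (\<integral>\<^sup>+w. ennreal (?f2 w) \<partial>R)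
      + (\<integral>\<^sup>+w. ennreal (?f3 w) \<partial>R) + (\<integral>\<^sup>+w. ennreal (?f4 w) \<partial>R)"
    by (simp only: nn_integral_add borel_measurable_add m[THEN measurable_compose[OF _ measurable_ennreal]])
  also have "\<dots> \<le> bound_B1 p F i j + bound_B2 p F i j + bound_B3 p F i j + bound_B4 p F i j"
    by (intro add_mono nn_integral_b1 nn_integral_b2 nn_integral_b3 nn_integral_b4 F)
  finally show ?thesis .
qed

end

section \<open>Letting the number of averaged coordinates tend to infinity\<close>

lemma (in rademacher_gaussian) d4_test_bound:
  fixes F :: "'d \<Rightarrow> (nat \<Rightarrow> real) \<Rightarrow> real"
  assumes F: "\<And>i. L2_approximable (F i)" and F0: "\<And>i. (\<integral>w. F i w \<partial>R) = 0"
  shows "ennreal \<bar>(\<integral>w. g (vec F w) \<partial>R) - (\<integral>w. g (N w) \<partial>M)\<bar>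
    \<le> 1 / 2 * (\<Sum>i\<in>UNIV. \<Sum>j\<in>UNIV. ennreal \<bar>\<Sigma> $ i $ j - covariance R (F i) (F j)\<bar>
        + bound_B1 p F i j + bound_B2 p F i j + bound_B3 p F i j + bound_B4 p F i j)"
    (is "?L \<le> ?RHS")
proof -
  have sF: "square_integrable R (F i)" for i using F by (simp add: L2_approximable_def)
  have iF: "integrable R (F i)" for i using sF by (rule square_integrable_integrable)
  have mF [measurable]: "F i \<in> borel_measurable R" for i using iF by auto
  have iFF: "integrable R (\<lambda>w. F i w * F j w)" for i j using sF by (intro square_integrable_mult)
  define C where "C i j = (\<integral>w. F i w * F j w \<partial>R)" for i j
  have cov: "covariance R (F i) (F j) = C i j" for i j by (simp add: covariance_def F0 C_def)
  have mvec [measurable]: "vec F \<in> borel_measurable R"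
    by (subst borel_measurable_euclidean_space) (auto simp: Basis_vec_def inner_axis)
  have ig: "integrable R (\<lambda>w. g (vec F w))"
  proof (rule Bochner_Integration.integrable_bound)
    show "integrable R (\<lambda>w. \<bar>g 0\<bar> + (\<Sum>i\<in>UNIV. \<bar>F i w\<bar>))"
      by (intro Bochner_Integration.integrable_add Bochner_Integration.integrable_sum integrable_abs iF) simp
    show "AE w in R. norm (g (vec F w)) \<le> norm (\<bar>g 0\<bar> + (\<Sum>i\<in>UNIV. \<bar>F i w\<bar>))"
    proof (rule AE_I2)
      fix w
      show "norm (g (vec F w)) \<le> norm (\<bar>g 0\<bar> + (\<Sum>i\<in>UNIV. \<bar>F i w\<bar>))"
        using g_lip[of 0 "vec F w"] by simp
    qed
  qed measurable
  define c where "c = (\<integral>w. g (N w) \<partial>M)"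
  \<comment> \<open>The effects of freezing: conditional means differ from 0, conditional second
    moments differ from the expectations \<open>C i j\<close>, and products of conditional means
    remain, dominated here by squares.\<close>
  define r where "r n w = (\<Sum>i\<in>UNIV. \<bar>e n (F i) w - 0\<bar>) + 1/2 * (\<Sum>i\<in>UNIV. \<Sum>j\<in>UNIV.
      \<bar>e n (\<lambda>w. F i w * F j w) w - C i j\<bar> + (1/2 * (e n (F i) w)\<^sup>2 + 1/2 * (e n (F j) w)\<^sup>2))" for n w
  define \<epsilon> where "\<epsilon> n = (\<Sum>i\<in>UNIV. \<integral>w. \<bar>e n (F i) w - 0\<bar> \<partial>R) + 1/2 * (\<Sum>i\<in>UNIV. \<Sum>j\<in>UNIV.
      (\<integral>w. \<bar>e n (\<lambda>w. F i w * F j w) w - C i j\<bar> \<partial>R)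
      + (1/2 * (\<integral>w. (e n (F i) w)\<^sup>2 \<partial>R) + 1/2 * (\<integral>w. (e n (F j) w)\<^sup>2 \<partial>R)))" for n
  have \<epsilon>: "\<epsilon> \<longlonglongrightarrow> 0"
  proof -
    have 1: "(\<lambda>n. \<integral>w. \<bar>e n (F i) w - 0\<bar> \<partial>R) \<longlonglongrightarrow> 0" for i
      using e_L1_limit[OF L2_approximable_imp_L1[OF F]] by (simp only: F0)
    have 2: "(\<lambda>n. \<integral>w. \<bar>e n (\<lambda>w. F i w * F j w) w - C i j\<bar> \<partial>R) \<longlonglongrightarrow> 0" for i j
      unfolding C_def by (intro e_L1_limit L1_approximable_mult F)
    have 3: "(\<lambda>n. \<integral>w. (e n (F i) w)\<^sup>2 \<partial>R) \<longlonglongrightarrow> 0" for i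
      by (intro e_L2_limit F F0)
    have "\<epsilon> \<longlonglongrightarrow> (\<Sum>i\<in>(UNIV::'d set). 0) + 1/2 * (\<Sum>i\<in>(UNIV::'d set). \<Sum>j\<in>(UNIV::'d set). 0 + (1/2 * 0 + 1/2 * 0))"
      unfolding \<epsilon>_def by (intro tendsto_add tendsto_sum tendsto_mult tendsto_const 1 2 3)
    then show ?thesis by simp
  qed
  have ir1: "integrable R (\<lambda>w. \<bar>e n (F i) w - 0\<bar>)" for n i using integrable_e[OF iF] by simp
  have ir2: "integrable R (\<lambda>w. \<bar>e n (\<lambda>w. F i w * F j w) w - C i j\<bar>)" for n i j
    using integrable_e[OF iFF] by simp
  have ir3: "integrable R (\<lambda>w. (e n (F i) w)\<^sup>2)" for n i
    using square_integrable_e[OF sF] by (simp add: square_integrable_def)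
  have ir: "integrable R (r n)" for n unfolding r_def
    by (intro Bochner_Integration.integrable_add Bochner_Integration.integrable_sum
        integrable_mult_right ir1 ir2 ir3)
  have int_r: "(\<integral>w. r n w \<partial>R) = \<epsilon> n" for n
    unfolding r_def \<epsilon>_def using ir1 ir2 ir3
    by (simp add: Bochner_Integration.integral_sum)
  have r0: "0 \<le> r n w" for n w unfolding r_def
    by (intro add_nonneg_nonneg sum_nonneg mult_nonneg_nonneg) auto
  have bound: "?L \<le> ?RHS + ennreal (\<epsilon> n)" for n
  proof -
    let ?a = "\<lambda>i j. \<bar>\<Sigma> $ i $ j - C i j\<bar>"
    have pt: "\<bar>e n (\<lambda>w. g (vec F w)) w - c\<bar>
      \<le> r n w + 1/2 * (\<Sum>i\<in>UNIV. \<Sum>j\<in>UNIV. ?a i j + bsum n F i j w)" for w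
    proof -
      have "\<bar>\<Sigma> $ i $ j - (e n (\<lambda>w. F i w * F j w) w - e n (F i) w * e n (F j) w)\<bar>
        \<le> (\<bar>e n (\<lambda>w. F i w * F j w) w - C i j\<bar> + (1/2 * (e n (F i) w)\<^sup>2 + 1/2 * (e n (F j) w)\<^sup>2)) + ?a i j" for i j
      proof -
        have "\<bar>e n (F i) w * e n (F j) w\<bar> \<le> 1/2 * (e n (F i) w)\<^sup>2 + 1/2 * (e n (F j) w)\<^sup>2"
          using sum_squares_bound[of "\<bar>e n (F i) w\<bar>" "\<bar>e n (F j) w\<bar>"] by (simp add: abs_mult)
        then show ?thesis by linarith
      qed
      then have "(\<Sum>i\<in>UNIV. \<Sum>j\<in>UNIV. \<bar>\<Sigma> $ i $ j - (e n (\<lambda>w. F i w * F j w) w - e n (F i) w * e n (F j) w)\<bar> + bsum n F i j w)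
        \<le> (\<Sum>i\<in>UNIV. \<Sum>j\<in>UNIV. ((\<bar>e n (\<lambda>w. F i w * F j w) w - C i j\<bar> + (1/2 * (e n (F i) w)\<^sup>2 + 1/2 * (e n (F j) w)\<^sup>2)) + ?a i j) + bsum n F i j w)"
        by (intro sum_mono add_right_mono)
      also have "\<dots> = (\<Sum>i\<in>UNIV. \<Sum>j\<in>UNIV. (\<bar>e n (\<lambda>w. F i w * F j w) w - C i j\<bar> + (1/2 * (e n (F i) w)\<^sup>2 + 1/2 * (e n (F j) w)\<^sup>2)))
          + (\<Sum>i\<in>UNIV. \<Sum>j\<in>UNIV. ?a i j + bsum n F i j w)"
        by (simp add: sum.distrib)
      finally have Y: "(\<Sum>i\<in>UNIV. \<Sum>j\<in>UNIV. \<bar>\<Sigma> $ i $ j - (e n (\<lambda>w. F i w * F j w) w - e n (F i) w * e n (F j) w)\<bar> + bsum n F i j w)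
        \<le> (\<Sum>i\<in>UNIV. \<Sum>j\<in>UNIV. (\<bar>e n (\<lambda>w. F i w * F j w) w - C i j\<bar> + (1/2 * (e n (F i) w)\<^sup>2 + 1/2 * (e n (F j) w)\<^sup>2)))
          + (\<Sum>i\<in>UNIV. \<Sum>j\<in>UNIV. ?a i j + bsum n F i j w)" .
      have lin: "x \<le> a + 1/2 * y \<Longrightarrow> y \<le> z + w \<Longrightarrow> x \<le> (a + 1/2 * z) + 1/2 * w" for x y z w a :: real
        by simp
      show ?thesis
        unfolding r_def c_def diff_0_right by (rule lin[OF finite_bound Y])
    qed
    have "\<bar>(\<integral>w. g (vec F w) \<partial>R) - c\<bar> = \<bar>\<integral>w. e n (\<lambda>w. g (vec F w)) w - c \<partial>R\<bar>"
      using integral_e[OF ig, of n] integrable_e[OF ig, of n] by (simp add: R.prob_space)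
    also have "\<dots> \<le> (\<integral>w. \<bar>e n (\<lambda>w. g (vec F w)) w - c\<bar> \<partial>R)" by (rule integral_abs_bound)
    finally have "?L \<le> ennreal (\<integral>w. \<bar>e n (\<lambda>w. g (vec F w)) w - c\<bar> \<partial>R)"
      unfolding c_def by (rule ennreal_leI)
    also have "\<dots> = (\<integral>\<^sup>+w. ennreal \<bar>e n (\<lambda>w. g (vec F w)) w - c\<bar> \<partial>R)"
      using integrable_e[OF ig, of n] by (intro nn_integral_eq_integral[symmetric]) auto
    also have "\<dots> \<le> (\<integral>\<^sup>+w. ennreal (r n w + 1/2 * (\<Sum>i\<in>UNIV. \<Sum>j\<in>UNIV. ?a i j + bsum n F i j w)) \<partial>R)"
      by (intro nn_integral_mono ennreal_leI pt)
    also have "\<dots> = (\<integral>\<^sup>+w. ennreal (r n w) + 1/2 * (\<Sum>i\<in>UNIV. \<Sum>j\<in>UNIV. ennreal (?a i j) + ennreal (bsum n F i j w)) \<partial>R)"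
    proof (intro nn_integral_cong)
      fix w
      have s: "0 \<le> ?a i j + bsum n F i j w" for i j using bsum_nonneg[of n F i j w] by simp
      have "ennreal (r n w + 1/2 * (\<Sum>i\<in>UNIV. \<Sum>j\<in>UNIV. ?a i j + bsum n F i j w))
        = ennreal (r n w) + ennreal (1/2) * ennreal (\<Sum>i\<in>UNIV. \<Sum>j\<in>UNIV. ?a i j + bsum n F i j w)"
      proof -
        have T: "0 \<le> (\<Sum>i\<in>UNIV. \<Sum>j\<in>UNIV. ?a i j + bsum n F i j w)" by (intro sum_nonneg s)
        show ?thesis
          by (subst ennreal_plus[OF r0], intro mult_nonneg_nonneg T, simp, subst ennreal_mult[OF _ T], simp, rule refl)
      qed
      also have "ennreal (\<Sum>i\<in>UNIV. \<Sum>j\<in>UNIV. ?a i j + bsum n F i j w)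
          = (\<Sum>i\<in>UNIV. \<Sum>j\<in>UNIV. ennreal (?a i j) + ennreal (bsum n F i j w))"
        using s bsum_nonneg[of n F _ _ w] by (simp add: sum_nonneg flip: sum_ennreal)
      finally show "ennreal (r n w + 1/2 * (\<Sum>i\<in>UNIV. \<Sum>j\<in>UNIV. ?a i j + bsum n F i j w))
        = ennreal (r n w) + 1/2 * (\<Sum>i\<in>UNIV. \<Sum>j\<in>UNIV. ennreal (?a i j) + ennreal (bsum n F i j w))"
        unfolding ennreal_fracs .
    qed
    also have "\<dots> = (\<integral>\<^sup>+w. ennreal (r n w) \<partial>R)
        + 1/2 * (\<Sum>i\<in>UNIV. \<Sum>j\<in>UNIV. ennreal (?a i j) + (\<integral>\<^sup>+w. ennreal (bsum n F i j w) \<partial>R))"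
    proof -
      have [measurable]: "r n \<in> borel_measurable R" using ir by auto
      have [measurable]: "\<And>i j. bsum n F i j \<in> borel_measurable R" by (intro bsum_measurable mF)
      show ?thesis
        by (simp add: nn_integral_add nn_integral_cmult nn_integral_sum R.emeasure_space_1)
    qed
    also have "(\<integral>\<^sup>+w. ennreal (r n w) \<partial>R) = ennreal (\<epsilon> n)"
      using nn_integral_eq_integral[OF ir] r0 int_r by simp
    also have "ennreal (\<epsilon> n) + 1/2 * (\<Sum>i\<in>UNIV. \<Sum>j\<in>UNIV. ennreal (?a i j) + (\<integral>\<^sup>+w. ennreal (bsum n F i j w) \<partial>R))
       \<le> ennreal (\<epsilon> n) + 1/2 * (\<Sum>i\<in>UNIV. \<Sum>j\<in>UNIV. ennreal (?a i j)
          + (bound_B1 p F i j + bound_B2 p F i j + bound_B3 p F i j + bound_B4 p F i j))"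
      by (intro add_left_mono mult_left_mono sum_mono nn_integral_bsum mF) simp
    finally show ?thesis unfolding cov by (simp only: add.assoc add.commute add.left_commute)
  qed
  have "(\<lambda>n. ?RHS + ennreal (\<epsilon> n)) \<longlonglongrightarrow> ?RHS + ennreal 0"
    by (intro tendsto_add tendsto_const tendsto_ennrealI \<epsilon>)
  then have "?L \<le> ?RHS + ennreal 0"
    by (rule tendsto_lowerbound) (use bound in auto)
  then show ?thesis by simp
qed

theorem theorem3p7:
  fixes p :: "nat \<Rightarrow> real"
    and F :: "'d::finite \<Rightarrow> (nat \<Rightarrow> real) \<Rightarrow> real"
    and M' :: "'b measure"
    and N :: "'b \<Rightarrow> real ^ 'd"
    and \<Sigma> :: "real ^ 'd ^ 'd"
  assumes "\<And>k. 0 < p k" and "\<And>k. p k < 1"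
    and "\<And>i. F i \<in> borel_measurable (rademacher_space p)"
    and "\<And>i. F i \<in> malliavin_dom p 1"
    and "\<And>i. F i \<in> malliavin_dom p 2"
    and "\<And>i. (\<integral>\<omega>. F i \<omega> \<partial>rademacher_space p) = 0"
    and "\<And>i. (\<integral>\<^sup>+\<omega>. ell4_norm_pow4
              (\<lambda>k. (p k * qprob p k) powr (-1/4) * malliavin_D p k (F i) \<omega>)
              \<partial>rademacher_space p) < \<infinity>"
    and "prob_space M'"
    and "gaussian_random_vector M' N"
    and "\<And>i. (\<integral>\<omega>. N \<omega> $ i \<partial>M') = 0"
    and "\<And>i j. covariance M' (\<lambda>\<omega>. N \<omega> $ i) (\<lambda>\<omega>. N \<omega> $ j) = \<Sigma> $ i $ j"
    and "transpose \<Sigma> = \<Sigma>"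
    and "\<And>x. 0 \<le> x \<bullet> (\<Sigma> *v x)"
  shows "d4 (rademacher_space p) (\<lambda>\<omega>. \<chi> i. F i \<omega>) M' N
    \<le> 1 / 2 * (\<Sum>i\<in>UNIV. \<Sum>j\<in>UNIV.
        ennreal \<bar>\<Sigma> $ i $ j - covariance (rademacher_space p) (F i) (F j)\<bar>
        + bound_B1 p F i j + bound_B2 p F i j + bound_B3 p F i j + bound_B4 p F i j)"
  unfolding d4_def
proof (rule SUP_least)
  fix g :: "real ^ 'd \<Rightarrow> real" assume g: "g \<in> d4_test_functions"
  interpret prob_space M' by fact
  interpret rademacher_gaussian p M' N \<Sigma> g
    using assms g by unfold_locales auto
  show "ennreal \<bar>(\<integral>w. g (\<chi> i. F i w) \<partial>rademacher_space p) - (\<integral>w. g (N w) \<partial>M')\<bar>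
    \<le> 1 / 2 * (\<Sum>i\<in>UNIV. \<Sum>j\<in>UNIV.
        ennreal \<bar>\<Sigma> $ i $ j - covariance (rademacher_space p) (F i) (F j)\<bar>
        + bound_B1 p F i j + bound_B2 p F i j + bound_B3 p F i j + bound_B4 p F i j)"
    by (intro d4_test_bound malliavin_dom_approximable[where r = 1] assms)
qed

end
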